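(* Let $p$ be an odd prime, let $n\ge1$ and $T\in\mathcal H_n(\mathbb Z_p)$, let $k$ be a positive integer, and let $S_0$ be a $\mathbb Z_p$-maximal half-integral matrix of degree at most $2$. Then there exist rational numbers $a_i=a_i(k,S_0,T)$, $i=0,1,\dots,n$, such that $$\alpha_p(H_{k-l-1}\perp pH_l\perp S_0,\,T)=a_0+a_1p^l+\dots+a_np^{nl}$$ for every $l=0,1,\dots,k-1$.
   Context: $\mathcal H_n(\mathbb Z_p)$ is the set of half-integral symmetric $n\times n$ matrices over $\mathbb Z_p$ (for $p$ odd, all symmetric matrices over $\mathbb Z_p$). $H=\begin{pmatrix}0&1/2\\1/2&0\end{pmatrix}$, $H_j=H\perp\dots\perp H$ ($j$ copies; $H_0$ empty), and $T_1\perp T_2=\begin{pmatrix}T_1&0\\0&T_2\end{pmatrix}$. A half-integral matrix $S_0$ over $\mathbb Z_p$ is $\mathbb Z_p$-maximal if it is empty or is a Gram matrix (i.e. $q(x)=S_0[x]={}^txS_0x$) of a maximal integral $\mathbb Z_p$-lattice, i.e. a lattice $M$ with $q(M)\subseteq\mathbb Z_p$ not properly contained in another such lattice on the same space. For $S\in\mathcal H_m(\mathbb Z_p)$ nondegenerate and $T\in\mathcal H_n(\mathbb Z_p)$ the local density is $\alpha_p(S,T)=\lim_{e\to\infty}p^{e(\frac{n(n+1)}2-mn)}\#\{X\in M_{m,n}(\mathbb Z_p)/p^eM_{m,n}(\mathbb Z_p): {}^tXSX-T\in p^e\mathcal H_n(\mathbb Z_p)\}$ (with an extra factor $\frac12$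 if $m=n$).
   Formalization: If det T = 0, the limit defining the local density may diverge (e.g. S = H, T = (0): e-th term e+1−e/p); the identity is therefore asserted for those l for which the limit exists. If det T ≠ 0 there is no extra condition. *)

theory Defs
  imports
    Complex_Main
    "HOL-Computational_Algebra.Polynomial_Factorial"
    "Berlekamp_Zassenhaus.Finite_Field"
    "Jordan_Normal_Form.Determinant"
begin

text \<open>
  The prime \<open>p\<close> is the cardinality of a type \<open>'p\<close> of class \<open>prime_card\<close>.
  The ring of \<open>p\<close>-adic integers is the inverse limit of the rings \<open>\<int>/p\<^sup>n\<int>\<close>,
  the \<open>n\<close>-th component being represented by its residue in \<open>{0..<p\<^sup>n}\<close>.
\<close>

typedef (overloaded) 'p padic_int =
  "{x :: nat \<Rightarrow> int. \<forall>n. x n \<in> {0..<int CARD('p::prime_card) ^ n} \<and>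
      x (Suc n) mod int CARD('p) ^ n = x n}"
proof -
  have "0 < CARD('p)" using prime_gt_0_nat[OF prime_card[where 'a='p]] .
  then show ?thesis by (intro exI[of _ "\<lambda>_. 0"]) auto
qed

setup_lifting type_definition_padic_int

lemma padic_int_seqI:
  fixes f :: "nat \<Rightarrow> int"
  assumes "\<And>n. f (Suc n) mod int CARD('p::prime_card) ^ n = f n mod int CARD('p) ^ n"
  shows "f n mod int CARD('p) ^ n \<in> {0..<int CARD('p) ^ n} \<and>
    f (Suc n) mod int CARD('p) ^ Suc n mod int CARD('p) ^ n = f n mod int CARD('p) ^ n"
proof -
  have p: "0 < CARD('p)" using prime_gt_0_nat[OF prime_card[where 'a='p]] .
  have "f (Suc n) mod int CARD('p) ^ Suc n mod int CARD('p) ^ n = f (Suc n) mod int CARD('p) ^ n"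
    by (rule mod_mod_cancel) simp
  with assms[of n] p show ?thesis by simp
qed

instantiation padic_int :: (prime_card) comm_ring_1
begin

lift_definition zero_padic_int :: "'a padic_int" is "\<lambda>_. 0"
  using prime_gt_0_nat[OF prime_card[where 'a='a]] by auto

lift_definition one_padic_int :: "'a padic_int" is "\<lambda>n. 1 mod int CARD('a) ^ n"
  using padic_int_seqI[where 'p='a and f="\<lambda>_. 1"] by blast

lift_definition plus_padic_int :: "'a padic_int \<Rightarrow> 'a padic_int \<Rightarrow> 'a padic_int"
  is "\<lambda>x y n. (x n + y n) mod int CARD('a) ^ n"
  subgoal for x y
    using padic_int_seqI[where 'p='a and f="\<lambda>n. x n + y n"] by (metis mod_add_eq mod_mod_trivial)
  done

lift_definition uminus_padic_int :: "'a padic_int \<Rightarrow> 'a padic_int"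
  is "\<lambda>x n. (- x n) mod int CARD('a) ^ n"
  subgoal for x
    using padic_int_seqI[where 'p='a and f="\<lambda>n. - x n"] by (metis mod_minus_eq)
  done

lift_definition minus_padic_int :: "'a padic_int \<Rightarrow> 'a padic_int \<Rightarrow> 'a padic_int"
  is "\<lambda>x y n. (x n - y n) mod int CARD('a) ^ n"
  subgoal for x y
    using padic_int_seqI[where 'p='a and f="\<lambda>n. x n - y n"] by (metis mod_diff_eq mod_mod_trivial)
  done

lift_definition times_padic_int :: "'a padic_int \<Rightarrow> 'a padic_int \<Rightarrow> 'a padic_int"
  is "\<lambda>x y n. (x n * y n) mod int CARD('a) ^ n"
  subgoal for x y
    using padic_int_seqI[where 'p='a and f="\<lambda>n. x n * y n"] by (metis mod_mult_eq mod_mod_trivial)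
  done

instance
proof
  fix a b c :: "'a padic_int"
  show "a * b * c = a * (b * c)"
    by transfer (auto simp: fun_eq_iff mod_simps algebra_simps)
  show "a * b = b * a"
    by transfer (auto simp: fun_eq_iff mod_simps algebra_simps)
  show "1 * a = a"
    by transfer (auto simp: fun_eq_iff mod_simps)
  show "a + b + c = a + (b + c)"
    by transfer (auto simp: fun_eq_iff mod_simps algebra_simps)
  show "a + b = b + a"
    by transfer (auto simp: fun_eq_iff algebra_simps)
  show "0 + a = a"
    by transfer (auto simp: fun_eq_iff)
  show "- a + a = 0"
    by transfer (auto simp: fun_eq_iff mod_simps)
  show "a - b = a + - b"
    by transfer (auto simp: fun_eq_iff mod_simps)
  show "(a + b) * c = a * c + b * c"
    by transfer (auto simp: fun_eq_iff mod_simps algebra_simps)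
  have p: "1 < int CARD('a)" using prime_gt_1_nat[OF prime_card[where 'a='a]] by simp
  have "(0::int) \<noteq> 1 mod int CARD('a) ^ 1" using p by simp
  then show "(0::'a padic_int) \<noteq> 1"
    by transfer (metis)
qed

end

lemma padic_int_seq_mod:
  fixes x :: "nat \<Rightarrow> int"
  assumes "\<forall>n. x n \<in> {0..<q ^ n} \<and> x (Suc n) mod q ^ n = x n"
  shows "x (n + d) mod q ^ n = x n"
proof (induction d)
  case 0
  then show ?case using assms by simp
next
  case (Suc d)
  have "x (n + Suc d) mod q ^ n = x (Suc (n + d)) mod q ^ (n + d) mod q ^ n"
    by (simp add: mod_mod_cancel power_add)
  also have "\<dots> = x n" using assms Suc by simp
  finally show ?case .
qed

instance padic_int :: (prime_card) idom
proof
  fix a b :: "'a padic_int"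
  have pr: "prime (int CARD('a))" by (rule prime_card_int)
  show "a \<noteq> 0 \<Longrightarrow> b \<noteq> 0 \<Longrightarrow> a * b \<noteq> 0"
  proof transfer
    fix x y :: "nat \<Rightarrow> int"
    let ?p = "int CARD('a)"
    assume x: "\<forall>n. x n \<in> {0..<?p ^ n} \<and> x (Suc n) mod ?p ^ n = x n"
      and y: "\<forall>n. y n \<in> {0..<?p ^ n} \<and> y (Suc n) mod ?p ^ n = y n"
      and "x \<noteq> (\<lambda>_. 0)" "y \<noteq> (\<lambda>_. 0)"
    then obtain r s where r: "x r \<noteq> 0" and s: "y s \<noteq> 0" by (auto simp: fun_eq_iff)
    have "\<not> ?p ^ r dvd x (r + s)"
      using padic_int_seq_mod[OF x, of r s] r by (simp add: dvd_eq_mod_eq_0)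
    moreover have "\<not> ?p ^ s dvd y (r + s)"
      using padic_int_seq_mod[OF y, of s r] s by (simp add: dvd_eq_mod_eq_0 add.commute)
    ultimately have "\<not> ?p ^ (r + s) dvd x (r + s) * y (r + s)"
      using prime_elem_power_dvd_cases[of ?p "r + s" "x (r + s)" "y (r + s)" "Suc r" s] pr
      by (metis add_Suc dvd_mult_right power_Suc prime_imp_prime_elem)
    then show "(\<lambda>n. x n * y n mod ?p ^ n) \<noteq> (\<lambda>_. 0)"
      by (metis dvd_eq_mod_eq_0)
  qed
qed

type_synonym 'p padic = "'p padic_int fract"

definition Zp :: "'p::prime_card padic set" where
  "Zp = range to_fract"

definition Zp_mat :: "nat \<Rightarrow> nat \<Rightarrow> 'p::prime_card padic mat set" where
  "Zp_mat m n = {X \<in> carrier_mat m n. \<forall>i<m. \<forall>j<n. X $$ (i,j) \<in> Zp}"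

definition half_integral :: "nat \<Rightarrow> 'p::prime_card padic mat set" where
  "half_integral n = {T \<in> carrier_mat n n. transpose_mat T = T \<and>
     (\<forall>i<n. T $$ (i,i) \<in> Zp) \<and> (\<forall>i<n. \<forall>j<n. 2 * T $$ (i,j) \<in> Zp)}"

definition hyp_plane :: "'p::prime_card padic mat" where
  "hyp_plane = mat 2 2 (\<lambda>(i,j). if i = j then 0 else 1 / 2)"

definition hyp :: "nat \<Rightarrow> 'p::prime_card padic mat" where
  "hyp j = diag_block_mat (replicate j hyp_plane)"

definition quad_form :: "'p::prime_card padic mat \<Rightarrow> 'p padic vec \<Rightarrow> 'p padic" where
  "quad_form S x = x \<bullet> (S *\<^sub>v x)"

text \<open>The \<open>\<int>\<^sub>p\<close>-span of the columns of a square matrix \<open>B\<close>.\<close>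

definition Zp_span :: "'p::prime_card padic mat \<Rightarrow> 'p padic vec set" where
  "Zp_span B = {B *\<^sub>v x | x. x \<in> carrier_vec (dim_col B) \<and> (\<forall>i<dim_col B. x $ i \<in> Zp)}"

definition Zp_lattice :: "nat \<Rightarrow> 'p::prime_card padic vec set \<Rightarrow> bool" where
  "Zp_lattice d L \<longleftrightarrow> (\<exists>B \<in> carrier_mat d d. invertible_mat B \<and> L = Zp_span B)"

definition integral_lattice :: "'p::prime_card padic mat \<Rightarrow> 'p padic vec set \<Rightarrow> bool" where
  "integral_lattice S L \<longleftrightarrow> Zp_lattice (dim_row S) L \<and> (\<forall>x\<in>L. quad_form S x \<in> Zp)"

definition maximal_integral_lattice :: "'p::prime_card padic mat \<Rightarrow> 'p padic vec set \<Rightarrow> bool" where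
  "maximal_integral_lattice S L \<longleftrightarrow>
     integral_lattice S L \<and> (\<forall>L'. integral_lattice S L' \<longrightarrow> \<not> L \<subset> L')"

text \<open>
  \<open>S\<close> is the Gram matrix of the standard lattice \<open>\<int>\<^sub>p\<^sup>d\<close> (the span of the columns of the
  identity matrix) in the quadratic space \<open>\<rat>\<^sub>p\<^sup>d\<close> with \<open>q(x) = S[x]\<close>.
\<close>

definition Zp_maximal :: "'p::prime_card padic mat \<Rightarrow> bool" where
  "Zp_maximal S \<longleftrightarrow> S \<in> half_integral (dim_row S) \<and>
     (dim_row S = 0 \<or> maximal_integral_lattice S (Zp_span (1\<^sub>m (dim_row S))))"

text \<open>
  The set of solutions below is a union of classes modulo \<open>p\<^sup>e M\<^sub>m\<^sub>,\<^sub>n(\<int>\<^sub>p)\<close>, so its quotient is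
  the set of classes satisfying the congruence.
\<close>

definition Zp_mat_cong ::
    "nat \<Rightarrow> nat \<Rightarrow> nat \<Rightarrow> ('p::prime_card padic mat \<times> 'p padic mat) set" where
  "Zp_mat_cong m n e = {(X, Y). X \<in> Zp_mat m n \<and> Y \<in> Zp_mat m n \<and>
     (\<exists>Z \<in> Zp_mat m n. X - Y = of_nat CARD('p) ^ e \<cdot>\<^sub>m Z)}"

definition rep_count :: "'p::prime_card padic mat \<Rightarrow> 'p padic mat \<Rightarrow> nat \<Rightarrow> nat" where
  "rep_count S T e = (let m = dim_row S; n = dim_row T in
     card ({X \<in> Zp_mat m n. \<exists>U \<in> half_integral n.
              transpose_mat X * S * X - T = of_nat CARD('p) ^ e \<cdot>\<^sub>m U} // Zp_mat_cong m n e))"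

definition local_density_seq :: "'p::prime_card padic mat \<Rightarrow> 'p padic mat \<Rightarrow> nat \<Rightarrow> real" where
  "local_density_seq S T e = (let m = dim_row S; n = dim_row T in
     (if m = n then 1 / 2 else 1) *
     real CARD('p) powi (int e * (int (n * (n + 1) div 2) - int (m * n))) * real (rep_count S T e))"

text \<open>
  For nondegenerate \<open>S\<close> and \<open>T\<close> the sequence is eventually constant.  For degenerate \<open>T\<close> it may
  diverge: for \<open>S = H\<close> and \<open>T = (0)\<close> its \<open>e\<close>-th term is \<open>e + 1 - e/p\<close>.
  Then \<open>lim\<close> is unspecified.
\<close>

definition local_density :: "'p::prime_card padic mat \<Rightarrow> 'p padic mat \<Rightarrow> real" where
  "local_density S T = lim (local_density_seq S T)"

definition level_form :: "nat \<Rightarrow> nat \<Rightarrow> 'p::prime_card padic mat \<Rightarrow> 'p padic mat" where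
  "level_form k l S\<^sub>0 = diag_block_mat [hyp (k - l - 1), of_nat CARD('p) \<cdot>\<^sub>m hyp l, S\<^sub>0]"

end

theory Submission
  imports Defs
begin

text \<open>
  All counts modulo \<open>p\<^sup>e\<close> are treated as integrals over matrices with entries in \<open>\<int>\<^sub>p\<close>.

  By Fourier inversion the proportion of solutions of \<open>S[X] \<equiv> T\<close> is an average, over
  matrices \<open>y\<close>, of Gauss sums, which are multiplicative in orthogonal sums of \<open>S\<close>.  With
  \<open>Y = y + y\<^sup>t\<close>, the planes \<open>H\<close> and \<open>pH\<close> contribute the volumes of the kernels of \<open>Y\<close> and \<open>pY\<close>
  modulo \<open>p\<^sup>e\<close>, whose ratio is \<open>p\<^sup>r\<close> with \<open>r \<le> n\<close>; so for each \<open>e\<close> the count is a polynomial of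
  degree at most \<open>n\<close> in \<open>p\<^sup>l\<close>.  Lagrange interpolation passes this to the limit and gives rational
  coefficients as soon as the limits are rational.

  If \<open>det T \<noteq> 0\<close>, then \<open>T\<close> is equivalent to every nearby symmetric matrix, so the counts for \<open>T\<close> and
  its perturbations agree and the normalised sequence is eventually constant.  In general,
  averaging over \<open>T[Z]\<close> with \<open>Z \<in> GL\<^sub>n\<close> turns the count into a weighted count of isotropic
  matrices for \<open>S \<perp> -T\<close>.  Splitting units off \<open>Y\<close> (\<open>p\<close> is odd) and rescaling \<open>pY\<close> to level \<open>e - 1\<close>
  shows that it satisfies a linear recurrence in \<open>e\<close> with rational coefficients, and the limit of a
  convergent rational solution of such a recurrence is rational.
\<close>

section \<open>Arithmetic of the \<open>p\<close>-adic integers\<close>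

text \<open>The delicate case is det T = 0: the perturbation argument breaks down, convergence is
  only a hypothesis, and a limit of rationals may be irrational. Rationality then has to come from a
  recurrence in e, and this shapes the middle sections. The induction there is on the size n of the
  Fourier variable y. A unit split off Y makes the phase nondegenerate in one column of X, and
  stationary phase confines that column to p Z_p^m. A weight that depends on X modulo p only becomes
  a weight in the other n - 1 columns, while GL_n-invariance of the weight permits the base change
  that splits off the unit. Replacing x by p x multiplies S[x] by p^2, so the level falls by two;
  hence recurrences in steps of two. Stationary phase needs a nondegenerate form, so the radical of
  S perp -T, nonzero for singular T, is averaged out first. The coefficients of the polynomial in
  p^l depend on e and are not shown to converge; interpolation works with the values at the nodes
  p^l instead, whose limits are known.\<close>

definition pp :: "'p::prime_card padic_int" where
  "pp = of_nat CARD('p)"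

text \<open>Residues stay inside Z_p as canonical integer representatives, so work modulo p^e is
  phrased by divisibility in Z_p and no quotient ring appears.\<close>

definition res :: "nat \<Rightarrow> 'p::prime_card padic_int \<Rightarrow> 'p padic_int" where
  "res e a = of_int (Rep_padic_int a e)"

definition Res :: "nat \<Rightarrow> 'p::prime_card padic_int set" where
  "Res e = of_int ` {0..<int CARD('p) ^ e}"

lemma card_prime_gt_1: "1 < CARD('p::prime_card)"
  using prime_gt_1_nat[OF prime_card[where 'a='p]] .

lemma Rep_padic_range: "Rep_padic_int (x::'p::prime_card padic_int) e \<in> {0..<int CARD('p) ^ e}"
  using Rep_padic_int[of x] by auto

lemma Rep_padic_mod: "Rep_padic_int (x::'p::prime_card padic_int) (n + d) mod int CARD('p) ^ n = Rep_padic_int x n"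
proof -
  have "\<forall>n. Rep_padic_int x n \<in> {0..<int CARD('p) ^ n} \<and>
      Rep_padic_int x (Suc n) mod int CARD('p) ^ n = Rep_padic_int x n"
    using Rep_padic_int[of x] unfolding mem_Collect_eq .
  then show ?thesis by (rule padic_int_seq_mod)
qed

lemma Rep_of_nat: "Rep_padic_int (of_nat k :: 'p::prime_card padic_int) e = int k mod int CARD('p) ^ e"
proof (induction k)
  case (Suc k)
  have "Rep_padic_int (of_nat (Suc k) :: 'p padic_int) e = (1 mod int CARD('p)^e + int k mod int CARD('p)^e) mod int CARD('p)^e"
    unfolding of_nat_Suc plus_padic_int.rep_eq one_padic_int.rep_eq Suc ..
  also have "\<dots> = int (Suc k) mod int CARD('p) ^ e"
    unfolding mod_add_eq of_nat_Suc ..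
  finally show ?case .
qed (simp add: zero_padic_int.rep_eq)

lemma Rep_of_int: "Rep_padic_int (of_int k :: 'p::prime_card padic_int) e = k mod int CARD('p) ^ e"
proof (cases k rule: int_cases)
  case (neg n)
  have "Rep_padic_int (of_int k :: 'p padic_int) e = (- (int (Suc n) mod int CARD('p)^e)) mod int CARD('p)^e"
    unfolding neg by (simp only: of_int_minus of_int_of_nat_eq uminus_padic_int.rep_eq Rep_of_nat)
  then show ?thesis by (simp add: neg mod_minus_eq)
qed (simp add: Rep_of_nat)

lemma pp_pow_of_int: "(pp :: 'p::prime_card padic_int) ^ e = of_int (int CARD('p) ^ e)"
  by (simp add: pp_def)

lemma pp_pow_nz: "(pp :: 'p::prime_card padic_int) ^ e \<noteq> 0"
proof -
  have "Rep_padic_int (of_int (int CARD('p) ^ e) :: 'p padic_int) (Suc e) \<noteq> 0"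
    using card_prime_gt_1[where 'p='p] unfolding Rep_of_int by (simp add: mod_pos_pos_trivial)
  then show ?thesis unfolding pp_pow_of_int
    by (metis zero_padic_int.rep_eq)
qed

lemma pp_nz: "(pp :: 'p::prime_card padic_int) \<noteq> 0"
  using pp_pow_nz[of 1] by simp

lemma padic_eqI: "(\<And>e. Rep_padic_int x e = Rep_padic_int y e) \<Longrightarrow> x = y"
  by (metis Rep_padic_int_inject ext)

lemma pp_dvd_iff: "pp ^ e dvd (a :: 'p::prime_card padic_int) \<longleftrightarrow> Rep_padic_int a e = 0"
proof
  assume "pp ^ e dvd a"
  then obtain b where "a = pp ^ e * b" by blast
  then show "Rep_padic_int a e = 0"
    by (simp add: times_padic_int.rep_eq pp_pow_of_int Rep_of_int del: of_int_power of_int_of_nat_eq)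
next
  let ?p = "int CARD('p)"
  assume a0: "Rep_padic_int a e = 0"
  have p0: "?p ^ n > 0" for n using card_prime_gt_1[where 'p='p] by simp
  have dvd: "?p ^ e dvd Rep_padic_int a (e + n)" for n
    using Rep_padic_mod[of a e n] a0 by auto
  define b where "b n = Rep_padic_int a (e + n) div ?p ^ e" for n
  have ab: "Rep_padic_int a (e + n) = ?p ^ e * b n" for n using dvd[of n] by (simp add: b_def)
  have b_in: "b n \<in> {0..<?p ^ n}" for n
  proof -
    have "0 \<le> ?p ^ e * b n" "?p ^ e * b n < ?p ^ e * ?p ^ n"
      using Rep_padic_range[of a "e + n"] unfolding ab by (auto simp: power_add)
    then show ?thesis using p0[of e] by (simp add: zero_le_mult_iff)
  qed
  have b_mod: "b (Suc n) mod ?p ^ n = b n" for n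
  proof -
    have "?p ^ e * b (Suc n) mod (?p ^ e * ?p ^ n) = ?p ^ e * b n"
      using Rep_padic_mod[of a "e + n" 1] ab[of n] ab[of "Suc n"] by (simp add: power_add)
    then show ?thesis using p0[of e] by simp
  qed
  have Rb: "Rep_padic_int (Abs_padic_int b :: 'p padic_int) = b"
    by (rule Abs_padic_int_inverse) (use b_in b_mod in auto)
  have "a = pp ^ e * Abs_padic_int b"
  proof (rule padic_eqI)
    fix n
    have "Rep_padic_int (pp ^ e * Abs_padic_int b :: 'p padic_int) n = (?p ^ e * b n) mod ?p ^ n"
      by (simp add: times_padic_int.rep_eq pp_pow_of_int Rep_of_int Rb mod_simps del: of_int_power of_int_of_nat_eq)
    also have "\<dots> = Rep_padic_int a (n + e) mod ?p ^ n" using ab[of n] by (simp add: add.commute)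
    also have "\<dots> = Rep_padic_int a n" by (rule Rep_padic_mod)
    finally show "Rep_padic_int a n = Rep_padic_int (pp ^ e * Abs_padic_int b :: 'p padic_int) n" ..
  qed
  then show "pp ^ e dvd a" by simp
qed

lemma Rep_eq_iff: "Rep_padic_int a e = Rep_padic_int b e \<longleftrightarrow> pp ^ e dvd (a - b :: 'p::prime_card padic_int)"
proof -
  have "Rep_padic_int a e = Rep_padic_int b e \<longleftrightarrow>
      Rep_padic_int a e mod int CARD('p) ^ e = Rep_padic_int b e mod int CARD('p) ^ e"
    using Rep_padic_range[of a e] Rep_padic_range[of b e] by simp
  also have "\<dots> \<longleftrightarrow> int CARD('p) ^ e dvd Rep_padic_int a e - Rep_padic_int b e"
    by (rule mod_eq_dvd_iff)
  also have "\<dots> \<longleftrightarrow> pp ^ e dvd (a - b)"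
    unfolding pp_dvd_iff minus_padic_int.rep_eq dvd_eq_mod_eq_0 ..
  finally show ?thesis .
qed

lemma res_cong: "pp ^ e dvd (a - res e a :: 'p::prime_card padic_int)"
proof -
  have "Rep_padic_int (res e a) e = Rep_padic_int a e"
    using Rep_padic_range[of a e] by (simp add: res_def Rep_of_int)
  then show ?thesis using Rep_eq_iff by metis
qed

lemma res_cong': "pp ^ e dvd (res e a - a :: 'p::prime_card padic_int)"
  using res_cong[of e a] by (metis dvd_minus_iff minus_diff_eq)

lemma res_eq_iff: "res e a = res e b \<longleftrightarrow> pp ^ e dvd (a - b :: 'p::prime_card padic_int)"
proof
  assume "res e a = res e b"
  then have "Rep_padic_int (res e a) e = Rep_padic_int (res e b) e" by simp
  then show "pp ^ e dvd a - b"
    using Rep_padic_range[of a e] Rep_padic_range[of b e]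
    by (simp add: res_def Rep_of_int flip: Rep_eq_iff)
qed (simp add: res_def flip: Rep_eq_iff)

lemma res_in_Res [simp]: "res e a \<in> Res e"
  using Rep_padic_range[of a e] by (simp add: res_def Res_def)

lemma res_Res: "a \<in> Res e \<Longrightarrow> res e a = (a :: 'p::prime_card padic_int)"
  by (auto simp: Res_def res_def Rep_of_int)

lemma finite_Res [simp]: "finite (Res e)" by (simp add: Res_def)

lemma card_Res: "card (Res e :: 'p::prime_card padic_int set) = CARD('p) ^ e"
proof -
  have "inj_on (of_int :: int \<Rightarrow> 'p padic_int) {0..<int CARD('p) ^ e}"
    by (rule inj_onI) (metis Rep_of_int atLeastLessThan_iff mod_pos_pos_trivial)
  then have "card (Res e :: 'p padic_int set) = nat (int CARD('p) ^ e)"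
    unfolding Res_def by (simp add: card_image)
  then show ?thesis by (simp add: nat_power_eq)
qed

text \<open>Each component of \<open>a\<close> is prime to p, so it has an inverse modulo p^n;
  uniqueness of that inverse makes the chosen ones compatible, hence a p-adic integer.\<close>

lemma padic_unit_iff: "(a :: 'p::prime_card padic_int) dvd 1 \<longleftrightarrow> \<not> pp dvd a"
proof
  assume "a dvd 1"
  show "\<not> pp dvd a"
  proof
    assume "pp dvd a"
    then have "pp ^ 1 dvd (1 :: 'p padic_int)" using dvd_trans[OF _ \<open>a dvd 1\<close>] by simp
    then show False using card_prime_gt_1[where 'p='p]
      by (simp only: pp_dvd_iff one_padic_int.rep_eq) simp
  qed
next
  let ?p = "int CARD('p)"
  assume na: "\<not> pp dvd a"
  have cop: "coprime (Rep_padic_int a n) (?p ^ n)" for n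
  proof (cases n)
    case (Suc m)
    have "Rep_padic_int a n mod ?p ^ 1 \<noteq> 0"
      using na Rep_padic_mod[of a 1 m] pp_dvd_iff[of 1 a] Suc by simp
    then have "\<not> ?p dvd Rep_padic_int a n" by auto
    then have "coprime ?p (Rep_padic_int a n)"
      using prime_card_int[where 'a='p] prime_imp_coprime by blast
    then show ?thesis by (simp add: coprime_commute)
  qed simp
  have "\<exists>b. Rep_padic_int a n * b mod ?p ^ n = 1 mod ?p ^ n" for n
    using cop[of n] by (metis cong_solve_coprime_int cong_def)
  then obtain b where b: "\<And>n. Rep_padic_int a n * b n mod ?p ^ n = 1 mod ?p ^ n" by metis
  define c where "c n = b n mod ?p ^ n" for n
  have p0: "?p ^ n > 0" for n using card_prime_gt_1[where 'p='p] by simp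
  have ac: "Rep_padic_int a n * c n mod ?p ^ n = 1 mod ?p ^ n" for n
    using b[of n] by (simp add: c_def mod_simps)
  have "c (Suc n) mod ?p ^ n = c n" for n
  proof -
    have d: "?p ^ n dvd ?p ^ Suc n" by simp
    have "Rep_padic_int a (Suc n) * c (Suc n) mod ?p ^ n = 1 mod ?p ^ n"
      using arg_cong[OF ac[of "Suc n"], of "\<lambda>x. x mod ?p ^ n"]
      unfolding mod_mod_cancel[OF d] .
    then have "(Rep_padic_int a (Suc n) mod ?p ^ n) * c (Suc n) mod ?p ^ n = 1 mod ?p ^ n"
      unfolding mod_mult_left_eq .
    then have "Rep_padic_int a n * c (Suc n) mod ?p ^ n = Rep_padic_int a n * c n mod ?p ^ n"
      using Rep_padic_mod[of a n 1] ac[of n] by simp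
    then have "?p ^ n dvd Rep_padic_int a n * (c (Suc n) - c n)"
      by (simp add: mod_eq_dvd_iff right_diff_distrib)
    then have "?p ^ n dvd c (Suc n) - c n"
      using cop[of n] by (metis coprime_commute coprime_dvd_mult_right_iff)
    then have "c (Suc n) mod ?p ^ n = c n mod ?p ^ n" by (simp add: mod_eq_dvd_iff)
    then show ?thesis by (simp add: c_def)
  qed
  then have Rc: "Rep_padic_int (Abs_padic_int c :: 'p padic_int) = c"
    by (intro Abs_padic_int_inverse) (use p0 in \<open>auto simp: c_def\<close>)
  have "a * Abs_padic_int c = 1"
    by (rule padic_eqI) (simp add: times_padic_int.rep_eq one_padic_int.rep_eq Rc ac)
  then show "a dvd 1" by (metis dvd_triv_left)
qed

text \<open>\<open>v\<close> is one less than the least \<open>n\<close> with p^n not dividing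
  \<open>a\<close>; such an \<open>n\<close> exists because a nonzero sequence has a nonzero
  component.\<close>

lemma padic_decomp:
  assumes "(a :: 'p::prime_card padic_int) \<noteq> 0"
  obtains v u where "a = pp ^ v * u" "u dvd 1"
proof -
  have "\<exists>n. Rep_padic_int a n \<noteq> 0"
    using assms padic_eqI[of a 0] by (auto simp: zero_padic_int.rep_eq)
  then have ex: "\<exists>n. \<not> pp ^ n dvd a" by (simp add: pp_dvd_iff)
  define n where "n = (LEAST n. \<not> pp ^ n dvd a)"
  have n: "\<not> pp ^ n dvd a" unfolding n_def by (rule LeastI_ex[OF ex])
  then obtain v where v: "n = Suc v" by (cases n) auto
  have "pp ^ v dvd a" using not_less_Least[of v "\<lambda>n. \<not> pp ^ n dvd a"] v unfolding n_def by auto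
  then obtain u where u: "a = pp ^ v * u" by blast
  have "\<not> pp dvd u"
  proof
    assume "pp dvd u"
    then have "pp ^ v * pp dvd a" unfolding u by (rule mult_dvd_mono[OF dvd_refl])
    then show False using n v by (simp add: mult.commute)
  qed
  then show ?thesis using that u padic_unit_iff by blast
qed

lemma padic_two_unit:
  assumes "odd CARD('p::prime_card)"
  shows "(2 :: 'p padic_int) dvd 1"
proof -
  obtain k where k: "CARD('p) = 2 * k + 1" using assms by (elim oddE)
  have "k > 0" using card_prime_gt_1[where 'p='p] k by simp
  have "Rep_padic_int (of_nat 2 :: 'p padic_int) 1 \<noteq> 0"
    using k \<open>k > 0\<close> unfolding Rep_of_nat by (simp add: mod_pos_pos_trivial)
  then show ?thesis using pp_dvd_iff[of 1 "2 :: 'p padic_int"] by (simp add: padic_unit_iff)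
qed

lemma pp_pow_dvd_unit_mult:
  assumes "(u :: 'p::prime_card padic_int) dvd 1"
  shows "pp ^ e dvd u * a \<longleftrightarrow> pp ^ e dvd a"
  using assms by (metis dvd_mult_unit_iff')

lemma pp_pow_add_dvd: "pp ^ (e + c) dvd pp ^ c * a \<longleftrightarrow> pp ^ e dvd (a :: 'p::prime_card padic_int)"
  using pp_pow_nz[of c, where 'p='p] unfolding power_add by (subst mult.commute) (rule dvd_mult_cancel_left[THEN trans], blast)

section \<open>Averages over matrices\<close>

declare minus_carrier_mat [simp]

definition pdiv :: "nat \<Rightarrow> 'p::prime_card padic_int mat \<Rightarrow> bool" where
  "pdiv e A \<longleftrightarrow> (\<forall>i<dim_row A. \<forall>j<dim_col A. pp ^ e dvd A $$ (i,j))"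

lemma pdiv_add: "A \<in> carrier_mat m n \<Longrightarrow> B \<in> carrier_mat m n \<Longrightarrow> pdiv e A \<Longrightarrow> pdiv e B \<Longrightarrow> pdiv e (A + B)"
  by (auto simp: pdiv_def)

lemma pdiv_uminus [simp]: "pdiv e (- A) \<longleftrightarrow> pdiv e A"
  by (auto simp: pdiv_def)

lemma pdiv_diff: "A \<in> carrier_mat m n \<Longrightarrow> B \<in> carrier_mat m n \<Longrightarrow> pdiv e A \<Longrightarrow> pdiv e B \<Longrightarrow> pdiv e (A - B)"
  by (auto simp: pdiv_def)

lemma pdiv_transpose [simp]: "pdiv e (transpose_mat A) \<longleftrightarrow> pdiv e A"
  by (auto simp: pdiv_def)

lemma pdiv_smult: "pdiv e A \<Longrightarrow> pdiv e (c \<cdot>\<^sub>m A)"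
  by (auto simp: pdiv_def)

lemma pdiv_smult_pp [simp]: "pdiv e (pp ^ e \<cdot>\<^sub>m A)"
  by (auto simp: pdiv_def)

lemma pdiv_zero [simp]: "pdiv e (0\<^sub>m m n)"
  by (auto simp: pdiv_def)

lemma pdiv_0 [simp]: "pdiv 0 A"
  by (auto simp: pdiv_def)

lemma pdiv_mono: "pdiv e A \<Longrightarrow> d \<le> e \<Longrightarrow> pdiv d A"
  unfolding pdiv_def by (meson dvd_trans le_imp_power_dvd)

lemma pdiv_mult_left: "A \<in> carrier_mat m n \<Longrightarrow> B \<in> carrier_mat n k \<Longrightarrow> pdiv e A \<Longrightarrow> pdiv e (A * B)"
  by (auto simp: pdiv_def scalar_prod_def intro!: dvd_sum)

lemma pdiv_mult_right: "A \<in> carrier_mat m n \<Longrightarrow> B \<in> carrier_mat n k \<Longrightarrow> pdiv e B \<Longrightarrow> pdiv e (A * B)"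
  by (auto simp: pdiv_def scalar_prod_def intro!: dvd_sum)

lemma pdiv_sym: "X \<in> carrier_mat m n \<Longrightarrow> Y \<in> carrier_mat m n \<Longrightarrow> pdiv e (X - Y) \<Longrightarrow> pdiv e (Y - X)"
  unfolding pdiv_def by auto (metis dvd_minus_iff minus_diff_eq)

lemma pdiv_diff_iff:
  assumes "X \<in> carrier_mat m n" "Y \<in> carrier_mat m n" "pdiv e (X - Y)"
  shows "pdiv e X \<longleftrightarrow> pdiv e Y"
  using assms unfolding pdiv_def by (auto dest: dvd_add dvd_diff simp: dvd_diff_left_iff dvd_diff_right_iff)

lemma pdivE:
  assumes "pdiv e X" "X \<in> carrier_mat m n"
  obtains Z where "Z \<in> carrier_mat m n" "X = pp ^ e \<cdot>\<^sub>m Z"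
proof -
  from assms have "\<forall>i j. \<exists>z. i < m \<longrightarrow> j < n \<longrightarrow> X $$ (i,j) = pp ^ e * z"
    unfolding pdiv_def dvd_def by (metis carrier_matD)
  then obtain z where z: "\<And>i j. i < m \<Longrightarrow> j < n \<Longrightarrow> X $$ (i,j) = pp ^ e * z i j" by metis
  show ?thesis
    by (rule that[of "mat m n (\<lambda>(i,j). z i j)"]) (use assms z in \<open>auto intro!: eq_matI\<close>)
qed

section \<open>Residue matrices modulo p^e\<close>

definition RM :: "nat \<Rightarrow> nat \<Rightarrow> nat \<Rightarrow> 'p::prime_card padic_int mat set" where
  "RM e m n = {X \<in> carrier_mat m n. \<forall>i<m. \<forall>j<n. X $$ (i,j) \<in> Res e}"

definition redM :: "nat \<Rightarrow> 'p::prime_card padic_int mat \<Rightarrow> 'p padic_int mat" where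
  "redM e X = map_mat (res e) X"

lemma RM_carrier: "X \<in> RM e m n \<Longrightarrow> X \<in> carrier_mat m n"
  by (simp add: RM_def)

lemma redM_RM: "X \<in> carrier_mat m n \<Longrightarrow> redM e X \<in> RM e m n"
  by (auto simp: RM_def redM_def)

lemma redM_carrier [simp]: "X \<in> carrier_mat m n \<Longrightarrow> redM e X \<in> carrier_mat m n"
  by (auto simp: redM_def)

lemma redM_id: "X \<in> RM e m n \<Longrightarrow> redM e X = X"
  by (rule eq_matI) (auto simp: RM_def redM_def res_Res)

lemma redM_cong: "X \<in> carrier_mat m n \<Longrightarrow> pdiv e (redM e X - X)"
  by (auto simp: pdiv_def redM_def res_cong')

lemma redM_eq_iff: "X \<in> carrier_mat m n \<Longrightarrow> Y \<in> carrier_mat m n \<Longrightarrow> redM e X = redM e Y \<longleftrightarrow> pdiv e (X - Y)"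
  by (auto simp: pdiv_def redM_def mat_eq_iff res_eq_iff)

lemma RM_eqI: "X \<in> RM e m n \<Longrightarrow> Y \<in> RM e m n \<Longrightarrow> pdiv e (X - Y) \<Longrightarrow> X = Y"
  by (metis RM_carrier redM_eq_iff redM_id)

lemma RM_bij: "bij_betw (\<lambda>f. mat m n f) ({..<m} \<times> {..<n} \<rightarrow>\<^sub>E Res e) (RM e m n :: 'p::prime_card padic_int mat set)"
proof (rule bij_betw_byWitness[where f'="\<lambda>X. restrict (\<lambda>ij. X $$ ij) ({..<m} \<times> {..<n})"])
  show "\<forall>f\<in>{..<m} \<times> {..<n} \<rightarrow>\<^sub>E (Res e :: 'p padic_int set). restrict (\<lambda>ij. mat m n f $$ ij) ({..<m} \<times> {..<n}) = f"
  proof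
    fix f :: "nat \<times> nat \<Rightarrow> 'p padic_int" assume f: "f \<in> {..<m} \<times> {..<n} \<rightarrow>\<^sub>E Res e"
    show "restrict (\<lambda>ij. mat m n f $$ ij) ({..<m} \<times> {..<n}) = f"
    proof
      fix x show "restrict (\<lambda>ij. mat m n f $$ ij) ({..<m} \<times> {..<n}) x = f x"
        using f by (cases x) (auto simp: restrict_def PiE_def extensional_def)
    qed
  qed
  show "\<forall>X\<in>RM e m n. mat m n (restrict (\<lambda>ij. X $$ ij) ({..<m} \<times> {..<n})) = (X :: 'p padic_int mat)"
    by (auto simp: RM_def)
qed (auto simp: RM_def PiE_def extensional_def restrict_def Pi_def)

lemma finite_RM [simp]: "finite (RM e m n)"
  using bij_betw_finite[OF RM_bij[of m n e]] by (simp add: finite_PiE)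

lemma card_RM: "card (RM e m n :: 'p::prime_card padic_int mat set) = CARD('p) ^ (e * m * n)"
proof -
  have "card (RM e m n :: 'p padic_int mat set) = card (({..<m} \<times> {..<n}) \<rightarrow>\<^sub>E (Res e :: 'p padic_int set))"
    by (rule bij_betw_same_card[OF RM_bij, symmetric])
  also have "\<dots> = CARD('p) ^ (e * m * n)"
    by (simp add: card_PiE card_Res power_mult mult.assoc)
  finally show ?thesis .
qed

text \<open>
  For a function that is periodic modulo \<open>p\<^sup>e\<close> (\<open>lc e\<close> below) the average \<open>avg e\<close> is its Haar
  integral; being a finite sum it commutes with sums and with other averages unconditionally.
\<close>

definition avg :: "nat \<Rightarrow> nat \<Rightarrow> nat \<Rightarrow> ('p::prime_card padic_int mat \<Rightarrow> complex) \<Rightarrow> complex" where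
  "avg e m n f = (\<Sum>X\<in>RM e m n. f X) / of_nat CARD('p) ^ (e * m * n)"

definition lc :: "nat \<Rightarrow> nat \<Rightarrow> nat \<Rightarrow> ('p::prime_card padic_int mat \<Rightarrow> complex) \<Rightarrow> bool" where
  "lc e m n f \<longleftrightarrow> (\<forall>X\<in>carrier_mat m n. \<forall>Y\<in>carrier_mat m n. pdiv e (X - Y) \<longrightarrow> f X = f Y)"

lemma lcI: "(\<And>X Y. X \<in> carrier_mat m n \<Longrightarrow> Y \<in> carrier_mat m n \<Longrightarrow> pdiv e (X - Y) \<Longrightarrow> f X = f Y) \<Longrightarrow> lc e m n f"
  unfolding lc_def by blast

lemma lcD: "lc e m n f \<Longrightarrow> X \<in> carrier_mat m n \<Longrightarrow> Y \<in> carrier_mat m n \<Longrightarrow> pdiv e (X - Y) \<Longrightarrow> f X = f Y"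
  unfolding lc_def by blast

lemma lc_mono: "lc d m n f \<Longrightarrow> d \<le> e \<Longrightarrow> lc e m n f"
  unfolding lc_def using pdiv_mono by blast

lemma lc_mult: "lc e m n f \<Longrightarrow> lc e m n g \<Longrightarrow> lc e m n (\<lambda>X. f X * g X)"
  unfolding lc_def by metis

lemma avg_cong:
  assumes "\<And>X. X \<in> carrier_mat m n \<Longrightarrow> f X = g X"
  shows "avg e m n f = avg e m n g"
  unfolding avg_def using assms by (simp add: RM_carrier cong: sum.cong)

lemma card_pow_nz [simp]: "(of_nat CARD('p::prime_card) :: complex) ^ k \<noteq> 0"
  using card_prime_gt_1[where 'p='p] by simp

lemma avg_const [simp]: "avg e m n (\<lambda>X::'p::prime_card padic_int mat. c) = c"
  by (simp add: avg_def card_RM)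

lemma avg_cmult: "avg e m n (\<lambda>X. c * f X) = c * avg e m n f"
  by (simp add: avg_def sum_distrib_left)

lemma avg_cmult_right: "avg e m n (\<lambda>X. f X * c) = avg e m n f * c"
  by (simp add: avg_def sum_distrib_right)

lemma avg_sum: "avg e m n (\<lambda>X. \<Sum>i\<in>I. f i X) = (\<Sum>i\<in>I. avg e m n (f i))"
  unfolding avg_def by (subst sum.swap) (simp add: sum_divide_distrib)

lemma avg_swap: 
  "avg e m n (\<lambda>X::'p::prime_card padic_int mat. avg d k l (\<lambda>Y::'p padic_int mat. f X Y)) = avg d k l (\<lambda>Y. avg e m n (\<lambda>X. f X Y))"
  unfolding avg_def sum_divide_distrib[symmetric]
  by (subst sum.swap) (simp add: mult.commute)

text \<open>Both maps respect congruence modulo p^e, so after reduction they are mutually inverse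
  permutations of the residue matrices. This covers translations, multiplication by invertible
  matrices and the action \<open>conj_mat\<close> alike.\<close>

lemma avg_transform:
  fixes f :: "'p::prime_card padic_int mat \<Rightarrow> complex" and \<phi> \<chi> :: "'p padic_int mat \<Rightarrow> 'p padic_int mat"
  assumes f: "lc e m n f"
    and \<phi>: "\<And>X. X \<in> carrier_mat m n \<Longrightarrow> \<phi> X \<in> carrier_mat m n"
    and \<chi>: "\<And>X. X \<in> carrier_mat m n \<Longrightarrow> \<chi> X \<in> carrier_mat m n"
    and \<phi>c: "\<And>X Y. X \<in> carrier_mat m n \<Longrightarrow> Y \<in> carrier_mat m n \<Longrightarrow> pdiv e (X - Y) \<Longrightarrow> pdiv e (\<phi> X - \<phi> Y)"
    and \<chi>c: "\<And>X Y. X \<in> carrier_mat m n \<Longrightarrow> Y \<in> carrier_mat m n \<Longrightarrow> pdiv e (X - Y) \<Longrightarrow> pdiv e (\<chi> X - \<chi> Y)"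
    and inv: "\<And>X. X \<in> carrier_mat m n \<Longrightarrow> \<chi> (\<phi> X) = X" "\<And>X. X \<in> carrier_mat m n \<Longrightarrow> \<phi> (\<chi> X) = X"
  shows "avg e m n (\<lambda>X. f (\<phi> X)) = avg e m n f"
proof -
  have "(\<Sum>X\<in>RM e m n. f (\<phi> X)) = (\<Sum>X\<in>RM e m n. f X)"
  proof (rule sum.reindex_bij_witness[where i="\<lambda>X. redM e (\<chi> X)" and j="\<lambda>X. redM e (\<phi> X)"])
    fix X :: "'p padic_int mat" assume X: "X \<in> RM e m n"
    note Xc = RM_carrier[OF X]
    show "redM e (\<phi> X) \<in> RM e m n" "redM e (\<chi> X) \<in> RM e m n"
      using \<phi>[OF Xc] \<chi>[OF Xc] redM_RM by blast+
    show "redM e (\<chi> (redM e (\<phi> X))) = X"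
      using \<chi>c[OF _ _ redM_cong[OF \<phi>[OF Xc]]] inv(1)[OF Xc] redM_id[OF X] \<phi>[OF Xc] \<chi> Xc redM_carrier
      by (metis redM_eq_iff)
    show "redM e (\<phi> (redM e (\<chi> X))) = X"
      using \<phi>c[OF _ _ redM_cong[OF \<chi>[OF Xc]]] inv(2)[OF Xc] redM_id[OF X] \<phi> \<chi>[OF Xc] Xc redM_carrier
      by (metis redM_eq_iff)
    show "f (redM e (\<phi> X)) = f (\<phi> X)"
      using lcD[OF f _ _ redM_cong[OF \<phi>[OF Xc]]] \<phi>[OF Xc] by simp
  qed
  then show ?thesis by (simp add: avg_def)
qed

lemma avg_translate:
  assumes f: "lc e m n f" and B: "B \<in> carrier_mat m n"
  shows "avg e m n (\<lambda>X. f (X + B)) = avg e m n f"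
proof (rule avg_transform[OF f, where \<chi>="\<lambda>X. X - B"])
  fix X Y :: "'a padic_int mat" assume XY: "X \<in> carrier_mat m n" "Y \<in> carrier_mat m n"
  have "X + B - (Y + B) = X - Y" "X - B - (Y - B) = X - Y"
    using XY B by (auto intro!: eq_matI)
  then show "pdiv e (X - Y) \<Longrightarrow> pdiv e (X + B - (Y + B))" "pdiv e (X - Y) \<Longrightarrow> pdiv e (X - B - (Y - B))"
    by simp_all
qed (use B in \<open>auto intro!: eq_matI\<close>)

lemma avg_mult_right:
  assumes f: "lc e m n f" and V: "V \<in> carrier_mat n n" "W \<in> carrier_mat n n" "V * W = 1\<^sub>m n" "W * V = 1\<^sub>m n"
  shows "avg e m n (\<lambda>X. f (X * V)) = avg e m n f"
proof (rule avg_transform[OF f, where \<chi>="\<lambda>X. X * W"])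
  fix X Y :: "'a padic_int mat" assume XY: "X \<in> carrier_mat m n" "Y \<in> carrier_mat m n"
  have "X * V - Y * V = (X - Y) * V" "X * W - Y * W = (X - Y) * W"
    using XY V by (simp_all add: minus_mult_distrib_mat)
  then show "pdiv e (X - Y) \<Longrightarrow> pdiv e (X * V - Y * V)" "pdiv e (X - Y) \<Longrightarrow> pdiv e (X * W - Y * W)"
    using V XY by (auto intro!: pdiv_mult_left[of _ m n _ n] minus_carrier_mat)
next
  fix X :: "'a padic_int mat" assume X: "X \<in> carrier_mat m n"
  show "X * V * W = X" "X * W * V = X"
    using assoc_mult_mat[OF X V(1,2)] assoc_mult_mat[OF X V(2,1)] V X by simp_all
qed (use V in auto)

lemma avg_mult_left:
  assumes f: "lc e m n f" and V: "V \<in> carrier_mat m m" "W \<in> carrier_mat m m" "V * W = 1\<^sub>m m" "W * V = 1\<^sub>m m"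
  shows "avg e m n (\<lambda>X. f (V * X)) = avg e m n f"
proof (rule avg_transform[OF f, where \<chi>="\<lambda>X. W * X"])
  fix X Y :: "'a padic_int mat" assume XY: "X \<in> carrier_mat m n" "Y \<in> carrier_mat m n"
  have "V * X - V * Y = V * (X - Y)" "W * X - W * Y = W * (X - Y)"
    using XY V by (simp_all add: mult_minus_distrib_mat)
  then show "pdiv e (X - Y) \<Longrightarrow> pdiv e (V * X - V * Y)" "pdiv e (X - Y) \<Longrightarrow> pdiv e (W * X - W * Y)"
    using V XY by (auto intro!: pdiv_mult_right[of _ m m _ n] minus_carrier_mat)
next
  fix X :: "'a padic_int mat" assume X: "X \<in> carrier_mat m n"
  show "W * (V * X) = X" "V * (W * X) = X"
    using assoc_mult_mat[OF V(1,2) X] assoc_mult_mat[OF V(2,1) X] V X by simp_all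
qed (use V in auto)

text \<open>Digit expansion: modulo p^(a+b) every matrix is A + p^a B for exactly one pair of
  residue matrices A modulo p^a and B modulo p^b.\<close>

lemma avg_split:
  fixes f :: "'a::prime_card padic_int mat \<Rightarrow> complex"
  assumes f: "lc (a + b) m n f"
  shows "avg (a + b) m n f = avg a m n (\<lambda>A. avg b m n (\<lambda>B. f (A + pp ^ a \<cdot>\<^sub>m B)))"
proof -
  let ?g = "\<lambda>(A, B). redM (a + b) (A + pp ^ a \<cdot>\<^sub>m B) :: 'a padic_int mat"
  let ?S = "(RM a m n :: 'a padic_int mat set) \<times> (RM b m n :: 'a padic_int mat set)"
  have inj: "inj_on ?g ?S"
  proof (rule inj_onI)
    fix x y assume xy: "x \<in> ?S" "y \<in> ?S" "?g x = ?g y"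
    obtain A B A' B' where ab: "x = (A, B)" "y = (A', B')" by fastforce
    then have mem: "A \<in> RM a m n" "B \<in> RM b m n" "A' \<in> RM a m n" "B' \<in> RM b m n"
      and eq: "redM (a + b) (A + pp ^ a \<cdot>\<^sub>m B) = redM (a + b) (A' + pp ^ a \<cdot>\<^sub>m B')"
      using xy by auto
    note c = mem[THEN RM_carrier]
    from eq have d: "pdiv (a + b) (A + pp ^ a \<cdot>\<^sub>m B - (A' + pp ^ a \<cdot>\<^sub>m B'))"
      using redM_eq_iff[of "A + pp ^ a \<cdot>\<^sub>m B" m n "A' + pp ^ a \<cdot>\<^sub>m B'"] c by simp
    have "A - A' = (A + pp ^ a \<cdot>\<^sub>m B - (A' + pp ^ a \<cdot>\<^sub>m B')) - pp ^ a \<cdot>\<^sub>m (B - B')"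
      using c by (auto intro!: eq_matI simp: algebra_simps)
    then have "pdiv a (A - A')"
      using pdiv_diff[OF _ _ pdiv_mono[OF d, of a] pdiv_smult_pp[of a "B - B'"], of m n] c by simp
    then have A: "A = A'" using RM_eqI mem by blast
    have "A + pp ^ a \<cdot>\<^sub>m B - (A' + pp ^ a \<cdot>\<^sub>m B') = pp ^ a \<cdot>\<^sub>m (B - B')"
      unfolding A using c by (auto intro!: eq_matI simp: algebra_simps)
    with d have "pdiv (b + a) (pp ^ a \<cdot>\<^sub>m (B - B'))" by (simp add: add.commute)
    then have "pdiv b (B - B')" using c by (auto simp: pdiv_def pp_pow_add_dvd)
    then have "B = B'" using RM_eqI mem by blast
    then show "x = y" using A ab by simp
  qed
  have sub: "?g ` ?S \<subseteq> RM (a + b) m n"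
    using RM_carrier by (fastforce intro!: redM_RM)
  \<comment> \<open>Surjectivity by counting: both sides have p^((a+b)mn) elements.\<close>
  have "card (?g ` ?S) = card (RM (a + b) m n :: 'a padic_int mat set)"
    by (simp add: card_image[OF inj] card_cartesian_product card_RM power_add algebra_simps)
  then have im: "?g ` ?S = RM (a + b) m n"
    using sub by (intro card_subset_eq) auto
  have "(\<Sum>X\<in>RM (a + b) m n. f X) = (\<Sum>AB\<in>?S. f (?g AB))"
    unfolding im[symmetric] by (rule sum.reindex[OF inj, unfolded o_def])
  also have "\<dots> = (\<Sum>AB\<in>?S. f (fst AB + pp ^ a \<cdot>\<^sub>m snd AB))"
  proof (rule sum.cong)
    fix AB assume "AB \<in> ?S"
    then have c: "fst AB + pp ^ a \<cdot>\<^sub>m snd AB \<in> carrier_mat m n" by (auto simp: RM_carrier)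
    show "f (?g AB) = f (fst AB + pp ^ a \<cdot>\<^sub>m snd AB)"
      using lcD[OF f _ _ redM_cong[OF c]] c by (simp add: case_prod_beta')
  qed simp
  also have "\<dots> = (\<Sum>A\<in>RM a m n. \<Sum>B\<in>RM b m n. f (A + pp ^ a \<cdot>\<^sub>m B))"
    by (simp add: sum.cartesian_product case_prod_beta')
  finally show ?thesis
    unfolding avg_def sum_divide_distrib[symmetric]
    by (simp add: power_add[symmetric] algebra_simps)
qed

text \<open>The digits beyond \<open>e\<close> are averaged over a constant. This makes averages
  taken at different levels comparable, as the recurrences in \<open>e\<close> require.\<close>

lemma avg_level:
  assumes f: "lc e m n f" and "e \<le> d"
  shows "avg d m n f = avg e m n f"
proof -
  obtain b where d: "d = e + b" using \<open>e \<le> d\<close> le_Suc_ex by blast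
  have "avg d m n f = avg e m n (\<lambda>A. avg b m n (\<lambda>B. f (A + pp ^ e \<cdot>\<^sub>m B)))"
    unfolding d by (rule avg_split) (rule lc_mono[OF f], simp)
  also have "\<dots> = avg e m n (\<lambda>A. avg b m n (\<lambda>B :: 'a padic_int mat. f A))"
  proof (intro avg_cong)
    fix A B :: "'a padic_int mat" assume c: "A \<in> carrier_mat m n" "B \<in> carrier_mat m n"
    then have "A + pp ^ e \<cdot>\<^sub>m B - A = pp ^ e \<cdot>\<^sub>m B" by (auto intro!: eq_matI)
    then show "f (A + pp ^ e \<cdot>\<^sub>m B) = f A" using c by (intro lcD[OF f]) auto
  qed
  finally show ?thesis by simp
qed

text \<open>The class of \<open>Y\<close> modulo p has volume p^(-mn), and in the coordinate (X - Y)
  / p a function of level e + 1 has level e.\<close>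

lemma avg_box:
  fixes f :: "'p::prime_card padic_int mat \<Rightarrow> complex"
  assumes f: "lc (Suc e) m n f" and Y: "Y \<in> carrier_mat m n"
  shows "avg (Suc e) m n (\<lambda>X. if pdiv 1 (X - Y) then f X else 0) =
    avg e m n (\<lambda>X. f (Y + pp \<cdot>\<^sub>m X)) / of_nat CARD('p) ^ (m * n)"
proof -
  let ?h = "\<lambda>X :: 'p padic_int mat. if pdiv 1 X then f (X + Y) else 0"
  have lch: "lc (Suc e) m n ?h"
  proof (rule lcI)
    fix X Z :: "'p padic_int mat" assume c: "X \<in> carrier_mat m n" "Z \<in> carrier_mat m n" and d: "pdiv (Suc e) (X - Z)"
    have "X + Y - (Z + Y) = X - Z" using c Y by (auto intro!: eq_matI)
    with d have "f (X + Y) = f (Z + Y)" using c Y by (intro lcD[OF f]) auto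
    moreover have "pdiv 1 X \<longleftrightarrow> pdiv 1 Z" using c pdiv_mono[OF d, of 1] by (intro pdiv_diff_iff) auto
    ultimately show "?h X = ?h Z" by simp
  qed
  have lcg: "lc (Suc e) m n (\<lambda>X. if pdiv 1 (X - Y) then f X else 0)"
  proof (rule lcI)
    fix X Z :: "'p padic_int mat" assume c: "X \<in> carrier_mat m n" "Z \<in> carrier_mat m n" and d: "pdiv (Suc e) (X - Z)"
    have e: "X - Y - (Z - Y) = X - Z" using c Y by (auto intro!: eq_matI)
    have "pdiv 1 (X - Y) \<longleftrightarrow> pdiv 1 (Z - Y)"
      by (rule pdiv_diff_iff[of _ m n]) (use c Y pdiv_mono[OF d, of 1] e in auto)
    moreover have "f X = f Z" using c d by (intro lcD[OF f]) auto
    ultimately show "(if pdiv 1 (X - Y) then f X else 0) = (if pdiv 1 (Z - Y) then f Z else 0)" by simp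
  qed
  have "avg (Suc e) m n (\<lambda>X. if pdiv 1 (X - Y) then f X else 0) = 
     avg (Suc e) m n (\<lambda>X. if pdiv 1 (X + Y - Y) then f (X + Y) else 0)"
    by (rule avg_translate[OF lcg Y, symmetric])
  also have "\<dots> = avg (Suc e) m n ?h"
  proof (rule avg_cong)
    fix X :: "'p padic_int mat" assume "X \<in> carrier_mat m n"
    then have "X + Y - Y = X" using Y by (auto intro!: eq_matI)
    then show "(if pdiv 1 (X + Y - Y) then f (X + Y) else 0) = ?h X" by simp
  qed
  also have "\<dots> = avg 1 m n (\<lambda>A. avg e m n (\<lambda>B. ?h (A + pp ^ 1 \<cdot>\<^sub>m B)))"
    using avg_split[of 1 e m n ?h] lch by simp
  also have "\<dots> = avg 1 m n (\<lambda>A. if pdiv 1 A then avg e m n (\<lambda>B. f (A + pp \<cdot>\<^sub>m B + Y)) else 0)"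
  proof (rule avg_cong)
    fix A :: "'p padic_int mat" assume A: "A \<in> carrier_mat m n"
    have "avg e m n (\<lambda>B. ?h (A + pp ^ 1 \<cdot>\<^sub>m B)) = avg e m n (\<lambda>B. if pdiv 1 A then f (A + pp \<cdot>\<^sub>m B + Y) else 0)"
    proof (rule avg_cong)
      fix B :: "'p padic_int mat" assume B: "B \<in> carrier_mat m n"
      have "pdiv 1 (A + pp ^ 1 \<cdot>\<^sub>m B) \<longleftrightarrow> pdiv 1 A"
      proof (rule pdiv_diff_iff)
        have "A + pp ^ 1 \<cdot>\<^sub>m B - A = pp ^ 1 \<cdot>\<^sub>m B" using A B by (auto intro!: eq_matI)
        then show "pdiv 1 (A + pp ^ 1 \<cdot>\<^sub>m B - A)" by (simp only: pdiv_smult_pp)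
      qed (use A B in auto)
      then show "?h (A + pp ^ 1 \<cdot>\<^sub>m B) = (if pdiv 1 A then f (A + pp \<cdot>\<^sub>m B + Y) else 0)" by simp
    qed
    then show "avg e m n (\<lambda>B. ?h (A + pp ^ 1 \<cdot>\<^sub>m B)) = (if pdiv 1 A then avg e m n (\<lambda>B. f (A + pp \<cdot>\<^sub>m B + Y)) else 0)"
      by auto
  qed
  also have "\<dots> = (\<Sum>A\<in>{0\<^sub>m m n}. avg e m n (\<lambda>B. f (A + pp \<cdot>\<^sub>m B + Y))) / of_nat CARD('p) ^ (m * n)"
  proof -
    have z: "(0\<^sub>m m n :: 'p padic_int mat) \<in> RM 1 m n"
      using card_prime_gt_1[where 'p='p] by (auto simp: RM_def Res_def intro!: image_eqI[of _ _ 0])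
    have "pdiv 1 A \<longleftrightarrow> A = 0\<^sub>m m n" if "A \<in> RM 1 m n" for A :: "'p padic_int mat"
    proof
      assume p: "pdiv 1 A"
      have "A - 0\<^sub>m m n = A" using RM_carrier[OF that] by auto
      with p show "A = 0\<^sub>m m n" using RM_eqI[OF that z] by simp
    qed simp
    then have "(\<Sum>A\<in>RM 1 m n. if pdiv 1 A then avg e m n (\<lambda>B. f (A + pp \<cdot>\<^sub>m B + Y)) else 0) =
       (\<Sum>A\<in>RM 1 m n. if A = 0\<^sub>m m n then avg e m n (\<lambda>B. f (A + pp \<cdot>\<^sub>m B + Y)) else 0)"
      by (intro sum.cong) auto
    also have "\<dots> = avg e m n (\<lambda>B. f (0\<^sub>m m n + pp \<cdot>\<^sub>m B + Y))"
      by (subst sum.delta) (use z in simp_all)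
    finally show ?thesis by (simp add: avg_def)
  qed
  also have "\<dots> = avg e m n (\<lambda>B. f (0\<^sub>m m n + pp \<cdot>\<^sub>m B + Y)) / of_nat CARD('p) ^ (m * n)" by simp
  also have "avg e m n (\<lambda>B. f (0\<^sub>m m n + pp \<cdot>\<^sub>m B + Y)) = avg e m n (\<lambda>X. f (Y + pp \<cdot>\<^sub>m X))"
  proof (rule avg_cong)
    fix B :: "'p padic_int mat" assume "B \<in> carrier_mat m n"
    then have "0\<^sub>m m n + pp \<cdot>\<^sub>m B + Y = Y + pp \<cdot>\<^sub>m B" using Y by (auto intro!: eq_matI)
    then show "f (0\<^sub>m m n + pp \<cdot>\<^sub>m B + Y) = f (Y + pp \<cdot>\<^sub>m B)" by simp
  qed
  finally show ?thesis .
qed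

lemma avg_classes:
  assumes f: "lc (Suc e) m n f"
  shows "avg (Suc e) m n f = (\<Sum>Y\<in>RM 1 m n. avg (Suc e) m n (\<lambda>X. if pdiv 1 (X - Y) then f X else 0))"
proof -
  have "f X = (\<Sum>Y\<in>RM 1 m n. if pdiv 1 (X - Y) then f X else 0)" if X: "X \<in> carrier_mat m n" for X
  proof -
    have "pdiv 1 (X - Y) \<longleftrightarrow> Y = redM 1 X" if "Y \<in> RM 1 m n" for Y
      using redM_eq_iff[OF X RM_carrier[OF that], of 1] redM_id[OF that] by metis
    then have "(\<Sum>Y\<in>RM 1 m n. if pdiv 1 (X - Y) then f X else 0) = (\<Sum>Y\<in>RM 1 m n. if Y = redM 1 X then f X else 0)"
      by (intro sum.cong) auto
    then show ?thesis using redM_RM[OF X, of 1] by simp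
  qed
  then have "avg (Suc e) m n f = avg (Suc e) m n (\<lambda>X. \<Sum>Y\<in>RM 1 m n. if pdiv 1 (X - Y) then f X else 0)"
    by (rule avg_cong)
  then show ?thesis by (simp only: avg_sum)
qed

text \<open>The column counterpart of \<open>@\<^sub>r\<close>; the empty lower blocks make the
  multiplication rules for four-block matrices applicable.\<close>

definition append_cols :: "'a :: zero mat \<Rightarrow> 'a mat \<Rightarrow> 'a mat" (infixr \<open>@\<^sub>c\<close> 65) where
  "A @\<^sub>c B = four_block_mat A B (0\<^sub>m 0 (dim_col A)) (0\<^sub>m 0 (dim_col B))"

lemma carrier_append_cols [simp,intro]: "A \<in> carrier_mat m n1 \<Longrightarrow> B \<in> carrier_mat m n2 \<Longrightarrow>
  A @\<^sub>c B \<in> carrier_mat m (n1 + n2)"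
  unfolding append_cols_def by auto

lemma avg_rows:
  "avg e (m1 + m2) n f = avg e m1 n (\<lambda>A. avg e m2 n (\<lambda>B. f (A @\<^sub>r B)))"
proof -
  have "(\<Sum>X\<in>RM e (m1 + m2) n. f X) = (\<Sum>AB\<in>RM e m1 n \<times> RM e m2 n. f (fst AB @\<^sub>r snd AB))"
    by (rule sum.reindex_bij_witness[where i="\<lambda>AB. fst AB @\<^sub>r snd AB" and
        j="\<lambda>X. (mat m1 n (\<lambda>(i,j). X $$ (i,j)), mat m2 n (\<lambda>(i,j). X $$ (i + m1,j)))"])
      (auto simp: RM_def append_rows_def intro!: eq_matI arg_cong[where f=f])
  also have "\<dots> = (\<Sum>A\<in>RM e m1 n. \<Sum>B\<in>RM e m2 n. f (A @\<^sub>r B))"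
    by (simp add: sum.cartesian_product case_prod_beta')
  finally show ?thesis
    unfolding avg_def sum_divide_distrib[symmetric]
    by (simp add: power_add add_mult_distrib add_mult_distrib2 mult.commute)
qed

lemma avg_cols:
  "avg e m (n1 + n2) f = avg e m n1 (\<lambda>A. avg e m n2 (\<lambda>B. f (A @\<^sub>c B)))"
proof -
  have "(\<Sum>X\<in>RM e m (n1 + n2). f X) = (\<Sum>AB\<in>RM e m n1 \<times> RM e m n2. f (fst AB @\<^sub>c snd AB))"
    by (rule sum.reindex_bij_witness[where i="\<lambda>AB. fst AB @\<^sub>c snd AB" and
        j="\<lambda>X. (mat m n1 (\<lambda>(i,j). X $$ (i,j)), mat m n2 (\<lambda>(i,j). X $$ (i,j + n1)))"])
      (auto simp: RM_def append_cols_def intro!: eq_matI arg_cong[where f=f])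
  also have "\<dots> = (\<Sum>A\<in>RM e m n1. \<Sum>B\<in>RM e m n2. f (A @\<^sub>c B))"
    by (simp add: sum.cartesian_product case_prod_beta')
  finally show ?thesis
    unfolding avg_def sum_divide_distrib[symmetric]
    by (simp add: power_add add_mult_distrib add_mult_distrib2 mult.commute)
qed

lemma avg_blocks:
  fixes f :: "'a::prime_card padic_int mat \<Rightarrow> complex"
  shows "avg e (m1 + m2) (n1 + n2) f = avg e m1 n1 (\<lambda>A. avg e m1 n2 (\<lambda>B. avg e m2 n1 (\<lambda>C. avg e m2 n2 (\<lambda>D. 
     f (four_block_mat A B C D)))))"
  unfolding avg_rows unfolding avg_cols
proof (intro avg_cong)
  fix A B C D :: "'a padic_int mat" 
  assume "A \<in> carrier_mat m1 n1" "B \<in> carrier_mat m1 n2" "C \<in> carrier_mat m2 n1" "D \<in> carrier_mat m2 n2"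
  then show "f ((A @\<^sub>c B) @\<^sub>r (C @\<^sub>c D)) = f (four_block_mat A B C D)"
    by (auto simp: append_rows_def append_cols_def intro!: eq_matI arg_cong[where f=f])
qed

section \<open>Additive characters and the trace pairing\<close>

lemma mult_assoc_dim: "dim_col A = dim_row B \<Longrightarrow> dim_col B = dim_row C \<Longrightarrow> A * B * C = A * (B * C :: 'a::semiring_0 mat)"
  by (rule assoc_mult_mat[of _ "dim_row A" "dim_col A" _ "dim_col B" _ "dim_col C"]) auto

lemma transpose_mult_dim: "dim_col A = dim_row B \<Longrightarrow> transpose_mat (A * B) = transpose_mat B * transpose_mat (A :: 'a::comm_semiring_0 mat)"
  by (rule transpose_mult[of _ "dim_row A" "dim_col A" _ "dim_col B"]) auto

text \<open>The additive character a -> exp(2 pi i a / p^e) of Z_p, trivial exactly on p^e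
  Z_p.\<close>

definition psi :: "nat \<Rightarrow> 'p::prime_card padic_int \<Rightarrow> complex" where
  "psi e a = cis (2 * pi * (real_of_int (Rep_padic_int a e) / real CARD('p) ^ e))"

lemma cis_mod:
  assumes "N > 0"
  shows "cis (2 * pi * (real_of_int (k mod int N) / real N)) = cis (2 * pi * (real_of_int k / real N))"
proof -
  have "real_of_int k = real_of_int (k mod int N) + real N * real_of_int (k div int N)"
    using arg_cong[OF mod_mult_div_eq[of k "int N"], of real_of_int] unfolding of_int_add of_int_mult by simp
  then have "2 * pi * (real_of_int k / real N) = 2 * pi * (real_of_int (k mod int N) / real N) + 2 * pi * real_of_int (k div int N)"
    using assms by (simp add: field_simps)
  then show ?thesis by (simp only: cis_mult[symmetric]) (simp add: cis_multiple_2pi)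
qed

lemma psi_add: "psi e (a + b) = psi e a * psi e (b :: 'p::prime_card padic_int)"
proof -
  have N: "CARD('p) ^ e > 0" by simp
  have "Rep_padic_int (a + b) e = (Rep_padic_int a e + Rep_padic_int b e) mod int (CARD('p) ^ e)"
    by (simp add: plus_padic_int.rep_eq)
  then have "psi e (a + b) = cis (2 * pi * (real_of_int (Rep_padic_int a e + Rep_padic_int b e) / real (CARD('p) ^ e)))"
    unfolding psi_def using cis_mod[OF N] by simp
  also have "\<dots> = psi e a * psi e b"
    unfolding psi_def by (simp add: cis_mult add_divide_distrib distrib_left)
  finally show ?thesis .
qed

lemma psi_cong: "pp ^ e dvd a - b \<Longrightarrow> psi e a = psi e b"
  unfolding psi_def by (simp flip: Rep_eq_iff)

lemma psi_0 [simp]: "psi e 0 = 1"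
  by (simp add: psi_def zero_padic_int.rep_eq)

lemma psi_eq_1: "pp ^ e dvd a \<Longrightarrow> psi e a = 1"
  using psi_cong[of e a 0] by simp

lemma psi_eq_1_iff: "psi e a = 1 \<longleftrightarrow> pp ^ e dvd (a :: 'p::prime_card padic_int)"
proof
  assume "psi e a = 1"
  then have "cos (2 * pi * (real_of_int (Rep_padic_int a e) / real CARD('p) ^ e)) = 1"
    unfolding psi_def by (metis cis.simps(1) one_complex.simps(1))
  then obtain x where x: "2 * pi * (real_of_int (Rep_padic_int a e) / real CARD('p) ^ e) = real_of_int x * 2 * pi"
    using cos_one_2pi_int by blast
  have p: "real CARD('p) ^ e > 0" by simp
  from x have "2 * pi * (real_of_int (Rep_padic_int a e) / real CARD('p) ^ e) = 2 * pi * real_of_int x" by simp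
  then have "real_of_int (Rep_padic_int a e) / real CARD('p) ^ e = real_of_int x"
    unfolding mult_cancel_left by simp
  then have "real_of_int (Rep_padic_int a e) = real_of_int (x * int CARD('p) ^ e)" using p by (simp add: field_simps)
  then have "Rep_padic_int a e = x * int CARD('p) ^ e" by (simp only: of_int_eq_iff)
  then have "Rep_padic_int a e mod int CARD('p) ^ e = 0" by simp
  then have "Rep_padic_int a e = 0" using Rep_padic_range[of a e] by simp
  then show "pp ^ e dvd a" by (simp add: pp_dvd_iff)
qed (rule psi_eq_1)

text \<open>A factor p in the phase lowers the level by one: p a / p^(e+1) = a / p^e. It is applied
  once for a Fourier variable p y and twice for the Gram matrix of p x.\<close>

lemma psi_pp: "psi (Suc e) (pp * a) = psi e (a :: 'p::prime_card padic_int)"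
proof -
  let ?p = "int CARD('p)"
  have "Rep_padic_int (pp * a) (Suc e) = (?p mod ?p ^ Suc e) * Rep_padic_int a (Suc e) mod ?p ^ Suc e"
    unfolding times_padic_int.rep_eq pp_def Rep_of_nat ..
  also have "\<dots> = ?p * Rep_padic_int a (Suc e) mod (?p * ?p ^ e)"
    unfolding mod_mult_left_eq power_Suc ..
  also have "\<dots> = ?p * (Rep_padic_int a (Suc e) mod ?p ^ e)" by (rule mult_mod_right[symmetric])
  also have "\<dots> = ?p * Rep_padic_int a e" using Rep_padic_mod[of a e 1] by simp
  finally show ?thesis using card_prime_gt_1[where 'p='p] unfolding psi_def by simp
qed

text \<open>The trace pairing tr(y^t A), written entrywise.\<close>

definition pr :: "'p::prime_card padic_int mat \<Rightarrow> 'p padic_int mat \<Rightarrow> 'p padic_int" where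
  "pr y A = (\<Sum>i<dim_row A. \<Sum>j<dim_col A. y $$ (i,j) * A $$ (i,j))"

lemma pr_add_left: "y \<in> carrier_mat m n \<Longrightarrow> z \<in> carrier_mat m n \<Longrightarrow> A \<in> carrier_mat m n \<Longrightarrow> pr (y + z) A = pr y A + pr z A"
  by (simp add: pr_def algebra_simps sum.distrib)

lemma pr_add_right: "y \<in> carrier_mat m n \<Longrightarrow> A \<in> carrier_mat m n \<Longrightarrow> B \<in> carrier_mat m n \<Longrightarrow> pr y (A + B) = pr y A + pr y B"
  by (simp add: pr_def algebra_simps sum.distrib)

lemma pr_diff_right: "y \<in> carrier_mat m n \<Longrightarrow> A \<in> carrier_mat m n \<Longrightarrow> B \<in> carrier_mat m n \<Longrightarrow> pr y (A - B) = pr y A - pr y B"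
  by (simp add: pr_def algebra_simps sum_subtractf)

lemma pr_diff_left: "y \<in> carrier_mat m n \<Longrightarrow> z \<in> carrier_mat m n \<Longrightarrow> A \<in> carrier_mat m n \<Longrightarrow> pr (y - z) A = pr y A - pr z A"
  by (simp add: pr_def algebra_simps sum_subtractf)

lemma pr_smult_left: "y \<in> carrier_mat m n \<Longrightarrow> A \<in> carrier_mat m n \<Longrightarrow> pr (c \<cdot>\<^sub>m y) A = c * pr y A"
  by (simp add: pr_def sum_distrib_left mult.assoc)

lemma pr_smult_right: "y \<in> carrier_mat m n \<Longrightarrow> A \<in> carrier_mat m n \<Longrightarrow> pr y (c \<cdot>\<^sub>m A) = c * pr y A"
  by (simp add: pr_def sum_distrib_left mult.left_commute)

lemma pr_transpose: "y \<in> carrier_mat m n \<Longrightarrow> A \<in> carrier_mat m n \<Longrightarrow> pr (transpose_mat y) (transpose_mat A) = pr y A"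
  unfolding pr_def by (simp, subst sum.swap, auto intro!: sum.cong)

lemma pr_commute: "y \<in> carrier_mat m n \<Longrightarrow> A \<in> carrier_mat m n \<Longrightarrow> pr y A = pr A y"
  by (simp add: pr_def mult.commute)

lemma pr_mult_right1:
  assumes "y \<in> carrier_mat m n" "B \<in> carrier_mat m k" "C \<in> carrier_mat k n"
  shows "pr y (B * C) = pr (transpose_mat B * y) C"
proof -
  have "pr y (B * C) = (\<Sum>i<m. \<Sum>j<n. \<Sum>l<k. y $$ (i,j) * (B $$ (i,l) * C $$ (l,j)))"
    using assms by (simp add: pr_def scalar_prod_def sum_distrib_left atLeast0LessThan)
  also have "\<dots> = (\<Sum>i<m. \<Sum>l<k. \<Sum>j<n. y $$ (i,j) * (B $$ (i,l) * C $$ (l,j)))"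
    by (intro sum.cong refl sum.swap)
  also have "\<dots> = (\<Sum>l<k. \<Sum>i<m. \<Sum>j<n. y $$ (i,j) * (B $$ (i,l) * C $$ (l,j)))"
    by (rule sum.swap)
  also have "\<dots> = (\<Sum>l<k. \<Sum>j<n. \<Sum>i<m. y $$ (i,j) * (B $$ (i,l) * C $$ (l,j)))"
    by (intro sum.cong refl sum.swap)
  also have "\<dots> = pr (transpose_mat B * y) C"
    using assms by (simp add: pr_def scalar_prod_def sum_distrib_right sum_distrib_left atLeast0LessThan mult_ac)
  finally show ?thesis .
qed

lemma pr_mult_right2:
  assumes "y \<in> carrier_mat m n" "B \<in> carrier_mat m k" "C \<in> carrier_mat k n"
  shows "pr y (B * C) = pr (y * transpose_mat C) B"
proof -
  have "pr y (B * C) = pr (transpose_mat y) (transpose_mat C * transpose_mat B)"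
    using assms pr_transpose[of y m n "B * C"] by (simp add: transpose_mult[of B m k C n])
  also have "\<dots> = pr (C * transpose_mat y) (transpose_mat B)"
    using assms by (subst pr_mult_right1[of _ n m _ k]) auto
  also have "\<dots> = pr (transpose_mat (C * transpose_mat y)) B"
    using assms by (subst pr_transpose[symmetric, of _ k m]) auto
  also have "transpose_mat (C * transpose_mat y) = y * transpose_mat C"
    using assms by (subst transpose_mult) auto
  finally show ?thesis .
qed

text \<open>Adjointness of the trace pairing: a base change X -> X V of Gram matrices becomes the
  action \<open>conj_mat V\<close> on the Fourier variable.\<close>

lemma pr_conj:
  assumes "y \<in> carrier_mat n n" "V \<in> carrier_mat k n" "A \<in> carrier_mat k k"
  shows "pr y (transpose_mat V * A * V) = pr (V * y * transpose_mat V) A"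
proof -
  have "pr y (transpose_mat V * A * V) = pr (y * transpose_mat V) (transpose_mat V * A)"
    using assms by (intro pr_mult_right2) auto
  also have "\<dots> = pr (transpose_mat (transpose_mat V) * (y * transpose_mat V)) A"
    using assms by (intro pr_mult_right1[of _ n k]) auto
  finally show ?thesis using assms by simp
qed

lemma pr_dvd_left: "y \<in> carrier_mat m n \<Longrightarrow> A \<in> carrier_mat m n \<Longrightarrow> pdiv e y \<Longrightarrow> pp ^ e dvd pr y A"
  by (auto simp: pdiv_def pr_def intro!: dvd_sum)

lemma pr_dvd_right: "y \<in> carrier_mat m n \<Longrightarrow> A \<in> carrier_mat m n \<Longrightarrow> pdiv e A \<Longrightarrow> pp ^ e dvd pr y A"
  by (auto simp: pdiv_def pr_def intro!: dvd_sum)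

lemma psi_pr_cong_left:
  assumes "y \<in> carrier_mat m n" "z \<in> carrier_mat m n" "A \<in> carrier_mat m n" "pdiv e (y - z)"
  shows "psi e (pr y A) = psi e (pr z A)"
  using assms pr_dvd_left[of "y - z" m n A e] by (intro psi_cong) (simp add: pr_diff_left)

lemma psi_pr_cong_right:
  assumes "y \<in> carrier_mat m n" "A \<in> carrier_mat m n" "B \<in> carrier_mat m n" "pdiv e (A - B)"
  shows "psi e (pr y A) = psi e (pr y B)"
  using assms pr_dvd_right[of y m n "A - B" e] by (intro psi_cong) (simp add: pr_diff_right)

lemma lc_psi_pr: "A \<in> carrier_mat m n \<Longrightarrow> lc e m n (\<lambda>y. psi e (pr y A))"
  by (rule lcI) (rule psi_pr_cong_left)

text \<open>Orthogonality of characters. If the entry (i,j) of \<open>A\<close> is not divisible by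
  p^e, translating \<open>y\<close> by the matrix unit at (i,j) multiplies the average by a number
  other than 1, so the average vanishes.\<close>

lemma avg_psi:
  assumes A: "A \<in> carrier_mat m n"
  shows "avg e m n (\<lambda>y. psi e (pr y A)) = (if pdiv e A then 1 else 0)"
proof (cases "pdiv e A")
  case True
  then have "avg e m n (\<lambda>y. psi e (pr y A)) = avg e m n (\<lambda>y::'a padic_int mat. 1)"
    using A by (intro avg_cong psi_eq_1 pr_dvd_right)
  then show ?thesis using True by simp
next
  case False
  then obtain i j where ij: "i < m" "j < n" and nd: "\<not> pp ^ e dvd A $$ (i,j)"
    using A by (auto simp: pdiv_def)
  define E :: "'a padic_int mat" where "E = mat m n (\<lambda>x. if x = (i,j) then 1 else 0)"
  have E: "E \<in> carrier_mat m n" by (simp add: E_def)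
  have "pr E A = (\<Sum>k<m. \<Sum>l<n. (if (k,l) = (i,j) then 1 else 0) * A $$ (k,l))"
    using A unfolding pr_def E_def by simp
  also have "\<dots> = (\<Sum>k<m. \<Sum>l<n. if l = j then (if k = i then A $$ (k,l) else 0) else 0)"
    by (intro sum.cong refl) auto
  also have "\<dots> = (\<Sum>k<m. if k = i then A $$ (k,j) else 0)"
    using ij by (intro sum.cong refl, subst sum.delta) auto
  also have "\<dots> = A $$ (i,j)" using ij by (subst sum.delta) auto
  finally have EA: "pr E A = A $$ (i,j)" .
  have "avg e m n (\<lambda>y. psi e (pr y A)) = avg e m n (\<lambda>y. psi e (pr (y + E) A))"
    by (rule avg_translate[OF lc_psi_pr[OF A] E, symmetric])
  also have "\<dots> = avg e m n (\<lambda>y. psi e (pr y A) * psi e (A $$ (i,j)))"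
    using A E EA by (intro avg_cong) (simp add: pr_add_left psi_add)
  also have "\<dots> = avg e m n (\<lambda>y. psi e (pr y A)) * psi e (A $$ (i,j))" by (rule avg_cmult_right)
  finally have "avg e m n (\<lambda>y. psi e (pr y A)) * (1 - psi e (A $$ (i,j))) = 0" by (simp add: algebra_simps)
  then show ?thesis using False nd psi_eq_1_iff by auto
qed

section \<open>Gram matrices S[X] and their Gauss sums\<close>

definition gram :: "'a::comm_ring_1 mat \<Rightarrow> 'a mat \<Rightarrow> 'a mat" where
  "gram S X = transpose_mat X * S * X"

lemma gram_carrier [simp]: "S \<in> carrier_mat m m \<Longrightarrow> X \<in> carrier_mat m n \<Longrightarrow> gram S X \<in> carrier_mat n n"
  by (simp add: gram_def)

lemma gram_mult:
  assumes "S \<in> carrier_mat m m" "X \<in> carrier_mat m n" "V \<in> carrier_mat n k"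
  shows "gram S (X * V) = transpose_mat V * gram S X * V"
  using assms by (simp add: gram_def transpose_mult_dim mult_assoc_dim)

lemma gram_gram:
  assumes "S \<in> carrier_mat m m" "V \<in> carrier_mat m k" "X \<in> carrier_mat k n"
  shows "gram (gram S V) X = gram S (V * X)"
  using gram_mult[OF assms] by (simp add: gram_def)

lemma transpose_gram:
  assumes "S \<in> carrier_mat m m" "transpose_mat S = S" "X \<in> carrier_mat m n"
  shows "transpose_mat (gram S X) = gram S X"
  using assms by (simp add: gram_def transpose_mult_dim mult_assoc_dim)

lemma gram_add:
  assumes "S \<in> carrier_mat m m" "transpose_mat S = S" "X \<in> carrier_mat m n" "Z \<in> carrier_mat m n"
  shows "gram S (X + Z) = gram S X + (transpose_mat X * S * Z + transpose_mat (transpose_mat X * S * Z)) + gram S Z"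
proof -
  have t: "transpose_mat (transpose_mat X * S * Z) = transpose_mat Z * S * X"
    using assms by (simp add: transpose_mult_dim mult_assoc_dim)
  have "transpose_mat (X + Z) * S * (X + Z) = 
     (transpose_mat X * S * X + transpose_mat Z * S * X) + (transpose_mat X * S * Z + transpose_mat Z * S * Z)"
    using assms by (simp add: transpose_add add_mult_distrib_mat[of _ n m] mult_add_distrib_mat[of _ n m])
  also have "\<dots> = transpose_mat X * S * X + (transpose_mat X * S * Z + transpose_mat Z * S * X) + transpose_mat Z * S * Z"
    using assms by (intro eq_matI) (auto simp: algebra_simps)
  finally show ?thesis by (simp add: gram_def t)
qed

lemma gram_diff:
  assumes "S \<in> carrier_mat m m" "X \<in> carrier_mat m n" "Y \<in> carrier_mat m n"
  shows "gram S X - gram S Y = transpose_mat X * S * (X - Y) + transpose_mat (X - Y) * S * Y"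
proof -
  have 1: "transpose_mat X * S * (X - Y) = transpose_mat X * S * X - transpose_mat X * S * Y"
    using assms by (intro mult_minus_distrib_mat) auto
  have "transpose_mat (X - Y) = transpose_mat X - transpose_mat Y" using assms by (intro eq_matI) auto
  then have "transpose_mat (X - Y) * S * Y = (transpose_mat X * S - transpose_mat Y * S) * Y"
    using assms by (simp add: minus_mult_distrib_mat[of _ n m])
  also have "\<dots> = transpose_mat X * S * Y - transpose_mat Y * S * Y"
    using assms by (intro minus_mult_distrib_mat) auto
  finally show ?thesis unfolding 1 gram_def using assms by (intro eq_matI) (auto simp: algebra_simps)
qed

lemma gram_cong:
  assumes "S \<in> carrier_mat m m" "X \<in> carrier_mat m n" "Y \<in> carrier_mat m n" "pdiv e (X - Y)"
  shows "pdiv e (gram S X - gram S Y)"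
  unfolding gram_diff[OF assms(1-3)]
proof (rule pdiv_add)
  show "pdiv e (transpose_mat X * S * (X - Y))"
    using assms by (intro pdiv_mult_right[of _ n m _ n]) auto
  show "pdiv e (transpose_mat (X - Y) * S * Y)"
    using assms by (intro pdiv_mult_left[of _ n m _ n] pdiv_mult_left[of _ n m _ m]) auto
qed (use assms in auto)

lemma gram_smult: "S \<in> carrier_mat m m \<Longrightarrow> X \<in> carrier_mat m n \<Longrightarrow> gram S (c \<cdot>\<^sub>m X) = (c * c) \<cdot>\<^sub>m gram S X"
proof -
  assume S: "S \<in> carrier_mat m m" and X: "X \<in> carrier_mat m n"
  have "transpose_mat (c \<cdot>\<^sub>m X) * S * (c \<cdot>\<^sub>m X) = c \<cdot>\<^sub>m (c \<cdot>\<^sub>m (transpose_mat X * S)) * X"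
  proof -
    have t: "transpose_mat (c \<cdot>\<^sub>m X) = c \<cdot>\<^sub>m transpose_mat X" by (intro eq_matI) auto
    have "c \<cdot>\<^sub>m transpose_mat X * S = c \<cdot>\<^sub>m (transpose_mat X * S)"
      using S X by (intro mult_smult_assoc_mat[of _ n m _ m]) auto
    then show ?thesis unfolding t
      using S X by (simp add: mult_smult_distrib[of _ n m _ n] mult_smult_assoc_mat[of _ n m _ n])
  qed
  also have "\<dots> = (c * c) \<cdot>\<^sub>m (transpose_mat X * S * X)"
    using S X by (subst mult_smult_assoc_mat[of _ n m _ n], simp, simp, subst mult_smult_assoc_mat[of _ n m _ n], simp, simp)
      (intro eq_matI, auto simp: mult.assoc)
  finally show ?thesis by (simp add: gram_def)
qed

lemma gram_rows:
  assumes "S1 \<in> carrier_mat m1 m1" "S2 \<in> carrier_mat m2 m2" "A \<in> carrier_mat m1 n" "B \<in> carrier_mat m2 n"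
  shows "gram (four_block_mat S1 (0\<^sub>m m1 m2) (0\<^sub>m m2 m1) S2) (A @\<^sub>r B) = gram S1 A + gram S2 B"
proof -
  let ?D = "four_block_mat S1 (0\<^sub>m m1 m2) (0\<^sub>m m2 m1) S2"
  let ?F = "four_block_mat A (0\<^sub>m m1 0) B (0\<^sub>m m2 0)"
  have t: "transpose_mat ?F = four_block_mat (transpose_mat A) (transpose_mat B) (0\<^sub>m 0 m1) (0\<^sub>m 0 m2)"
    using assms by (subst transpose_four_block_mat) auto
  have "transpose_mat ?F * ?D = four_block_mat (transpose_mat A * S1) (transpose_mat B * S2) (0\<^sub>m 0 m1) (0\<^sub>m 0 m2)"
    unfolding t using assms by (subst mult_four_block_mat[of _ n m1 _ m2 _ 0]) auto
  then have "transpose_mat ?F * ?D * ?F = four_block_mat (transpose_mat A * S1 * A + transpose_mat B * S2 * B) (0\<^sub>m n 0) (0\<^sub>m 0 n) (0\<^sub>m 0 0)"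
    using assms by (simp, subst mult_four_block_mat[of _ n m1 _ m2 _ 0]) auto
  also have "\<dots> = transpose_mat A * S1 * A + transpose_mat B * S2 * B"
    using assms by (intro eq_matI) auto
  finally show ?thesis using assms by (simp add: gram_def append_rows_def)
qed

lemma mult_cols:
  fixes x :: "'a::semiring_1 mat"
  assumes "x \<in> carrier_mat m a" "X \<in> carrier_mat m b" "G \<in> carrier_mat b b"
  shows "(x @\<^sub>c X) * four_block_mat (1\<^sub>m a) (0\<^sub>m a b) (0\<^sub>m b a) G = x @\<^sub>c (X * G)"
  unfolding append_cols_def using assms by (subst mult_four_block_mat[of _ m a _ b _ 0]) (auto simp: right_mult_one_mat[OF assms(1)])

lemma gram_cols:
  assumes S: "S \<in> carrier_mat m m" and "x \<in> carrier_mat m a" "X \<in> carrier_mat m b"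
  shows "gram S (x @\<^sub>c X) = four_block_mat (gram S x) (transpose_mat x * S * X) (transpose_mat X * S * x) (gram S X)"
proof -
  let ?F = "four_block_mat x X (0\<^sub>m 0 a) (0\<^sub>m 0 b)"
  have t: "transpose_mat ?F = four_block_mat (transpose_mat x) (0\<^sub>m a 0) (transpose_mat X) (0\<^sub>m b 0)"
    using assms by (subst transpose_four_block_mat) auto
  have s: "S = four_block_mat S (0\<^sub>m m 0) (0\<^sub>m 0 m) (0\<^sub>m 0 0)" using S by (intro eq_matI) auto
  have "transpose_mat ?F * S = four_block_mat (transpose_mat x * S) (0\<^sub>m a 0) (transpose_mat X * S) (0\<^sub>m b 0)"
    unfolding t by (subst s, subst mult_four_block_mat[of _ a m _ 0 _ b]) (use assms in auto)
  then have "transpose_mat ?F * S * ?F = four_block_mat (transpose_mat x * S * x) (transpose_mat x * S * X) (transpose_mat X * S * x) (transpose_mat X * S * X)"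
    using assms by (simp, subst mult_four_block_mat[of _ a m _ 0 _ b]) auto
  then show ?thesis using assms by (simp add: gram_def append_cols_def)
qed

lemma pr_four_block:
  assumes "a \<in> carrier_mat m1 n1" "b \<in> carrier_mat m1 n2" "c \<in> carrier_mat m2 n1" "d \<in> carrier_mat m2 n2"
    "A \<in> carrier_mat m1 n1" "B \<in> carrier_mat m1 n2" "C \<in> carrier_mat m2 n1" "D \<in> carrier_mat m2 n2"
  shows "pr (four_block_mat a b c d) (four_block_mat A B C D) = pr a A + pr b B + pr c C + pr d D"
proof -
  have split: "(\<Sum>i<k + l. f i) = (\<Sum>i<k. f i) + (\<Sum>i<l. f (k + i))" for k l :: nat and f :: "nat \<Rightarrow> 'a padic_int"
    by (induction l) (auto simp: add.assoc)
  show ?thesis using assms unfolding pr_def by (simp add: split sum.distrib)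
qed

text \<open>The normalised matrix Gauss sum, i.e. the Fourier transform at \<open>y\<close> of the
  distribution of S[X] modulo p^e.\<close>

definition gs :: "nat \<Rightarrow> 'p::prime_card padic_int mat \<Rightarrow> nat \<Rightarrow> 'p padic_int mat \<Rightarrow> complex" where
  "gs e S n y = avg e (dim_row S) n (\<lambda>X. psi e (pr y (gram S X)))"

definition vol :: "nat \<Rightarrow> 'p::prime_card padic_int mat \<Rightarrow> 'p padic_int mat \<Rightarrow> complex" where
  "vol e S T = avg e (dim_row S) (dim_row T) (\<lambda>X. if pdiv e (gram S X - T) then 1 else 0)"

text \<open>
  Here \<open>y\<close> runs over all \<open>n \<times> n\<close> matrices, not only the symmetric ones: this detects the congruence
  just as well and avoids a parametrisation of symmetric matrices.
\<close>

lemma vol_fourier: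
  assumes S: "S \<in> carrier_mat m m" and T: "T \<in> carrier_mat n n"
  shows "vol e S T = avg e n n (\<lambda>y. psi e (- pr y T) * gs e S n y)"
proof -
  have "vol e S T = avg e m n (\<lambda>X. avg e n n (\<lambda>y. psi e (pr y (gram S X - T))))"
    unfolding vol_def using S T by (simp, intro avg_cong) (simp add: avg_psi)
  also have "\<dots> = avg e m n (\<lambda>X. avg e n n (\<lambda>y. psi e (- pr y T) * psi e (pr y (gram S X))))"
    using S T by (intro avg_cong) (simp add: pr_diff_right[of _ n n] psi_add[symmetric])
  also have "\<dots> = avg e n n (\<lambda>y. psi e (- pr y T) * gs e S n y)"
    unfolding gs_def using S by (subst avg_swap) (simp add: avg_cmult)
  finally show ?thesis .
qed

lemma gs_block:
  assumes "S1 \<in> carrier_mat m1 m1" "S2 \<in> carrier_mat m2 m2" "y \<in> carrier_mat n n"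
  shows "gs e (four_block_mat S1 (0\<^sub>m m1 m2) (0\<^sub>m m2 m1) S2) n y = gs e S1 n y * gs e S2 n y"
proof -
  have "gs e (four_block_mat S1 (0\<^sub>m m1 m2) (0\<^sub>m m2 m1) S2) n y = 
     avg e m1 n (\<lambda>A. avg e m2 n (\<lambda>B. psi e (pr y (gram S1 A)) * psi e (pr y (gram S2 B))))"
    unfolding gs_def using assms by (simp add: avg_rows, intro avg_cong) 
      (simp add: gram_rows pr_add_right[of _ n n] psi_add)
  then show ?thesis unfolding gs_def using assms by (simp add: avg_cmult avg_cmult_right)
qed

section \<open>Linear recurrences of step two\<close>

text \<open>With \<open>E\<close> the shift, \<open>ann ls f\<close> says that the product of the \<open>E\<^sup>2 - l\<close>, \<open>l\<close> in \<open>ls\<close>, kills \<open>f\<close> from some index on.\<close>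

fun ann :: "rat list \<Rightarrow> (nat \<Rightarrow> complex) \<Rightarrow> bool" where
  "ann [] f \<longleftrightarrow> (\<exists>e0. \<forall>e\<ge>e0. f e = 0)"
| "ann (l # ls) f \<longleftrightarrow> ann ls (\<lambda>e. f (e + 2) - of_rat l * f e)"

text \<open>\<open>ann\<close> only concerns large indices, so eventual equality is enough; the
  level formulas to which it is applied hold from some e on.\<close>

lemma ann_cong: "ann ls f \<Longrightarrow> (\<And>e. e \<ge> e0 \<Longrightarrow> f e = g e) \<Longrightarrow> ann ls g"
proof (induction ls arbitrary: f g e0)
  case Nil
  then obtain e1 where "\<forall>e\<ge>e1. f e = 0" by auto
  with Nil(2) have "\<forall>e\<ge>max e0 e1. g e = 0" by (metis max.bounded_iff)
  then show ?case by (simp only: ann.simps) blast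
next
  case (Cons l ls)
  have "ann ls (\<lambda>e. f (e + 2) - of_rat l * f e)" using Cons.prems(1) by simp
  from Cons.IH[OF this, of e0 "\<lambda>e. g (e + 2) - of_rat l * g e"] Cons.prems(2) show ?case by simp
qed

lemma ann_add: "ann ls f \<Longrightarrow> ann ls g \<Longrightarrow> ann ls (\<lambda>e. f e + g e)"
proof (induction ls arbitrary: f g)
  case Nil
  then obtain e1 e2 where "\<forall>e\<ge>e1. f e = 0" "\<forall>e\<ge>e2. g e = 0" by auto
  then have "\<forall>e\<ge>max e1 e2. f e + g e = 0" by simp
  then show ?case by (simp only: ann.simps) blast
next
  case (Cons l ls)
  then have "ann ls (\<lambda>e. (f (e + 2) - of_rat l * f e) + (g (e + 2) - of_rat l * g e))" by simp
  then show ?case by (simp add: algebra_simps)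
qed

lemma ann_cmult: "ann ls f \<Longrightarrow> ann ls (\<lambda>e. c * f e)"
proof (induction ls arbitrary: f)
  case (Cons l ls)
  then have "ann ls (\<lambda>e. c * (f (e + 2) - of_rat l * f e))" by simp
  then show ?case by (simp add: algebra_simps)
qed auto

lemma ann_shift: "ann ls f \<Longrightarrow> ann ls (\<lambda>e. f (e + d))"
proof (induction ls arbitrary: f)
  case Nil
  then show ?case by (auto intro: exI trans_le_add1)
next
  case (Cons l ls)
  then have "ann ls (\<lambda>e. f (e + d + 2) - of_rat l * f (e + d))" by simp
  then show ?case by (simp add: add.commute add.left_commute)
qed

lemma ann_Cons:
  assumes "ann ls f"
  shows "ann (l # ls) f"
  using ann_add[OF ann_shift[OF assms, of 2] ann_cmult[OF assms, of "- of_rat l"]] by simp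

lemma ann_prepend: "ann ls f \<Longrightarrow> ann (ms @ ls) f"
  by (induction ms arbitrary: f) (auto intro: ann_Cons simp del: ann.simps)

lemma ann_zero: "(\<And>e. e \<ge> e0 \<Longrightarrow> f e = 0) \<Longrightarrow> ann ls f"
  using ann_prepend[of "[]" f ls] by auto

lemma ann_append: "ann ls f \<Longrightarrow> ann (ls @ ms) f"
  by (induction ls arbitrary: f) (auto intro: ann_zero)

lemma ann_plus: "ann ls f \<Longrightarrow> ann ms g \<Longrightarrow> ann (ls @ ms) (\<lambda>e. f e + g e)"
  by (intro ann_add ann_append ann_prepend)

lemma ann_sum:
  assumes "finite I" "\<And>i. i \<in> I \<Longrightarrow> \<exists>ls. ann ls (f i)"
  shows "\<exists>ls. ann ls (\<lambda>e. \<Sum>i\<in>I. f i e)"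
  using assms
proof (induction I rule: finite_induct)
  case empty
  then show ?case by (auto intro: ann_zero)
next
  case (insert i I)
  obtain ls where "ann ls (f i)" using insert.prems by blast
  moreover obtain ms where "ann ms (\<lambda>e. \<Sum>i\<in>I. f i e)" using insert by auto
  ultimately have "ann (ls @ ms) (\<lambda>e. f i e + (\<Sum>i\<in>I. f i e))" by (rule ann_plus)
  then show ?case using insert.hyps by auto
qed

text \<open>A factor that is geometric in steps of two multiplies each root by its ratio: applying
  E^2 - mu l to a f gives mu a times E^2 - l applied to f.\<close>

lemma ann_geometric:
  assumes "\<And>e. e \<ge> e0 \<Longrightarrow> a (e + 2) = of_rat \<mu> * a e"
  shows "ann ls f \<Longrightarrow> ann (map ((*) \<mu>) ls) (\<lambda>e. a e * f e)"
proof (induction ls arbitrary: f)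
  case Nil
  then show ?case by auto
next
  case (Cons l ls)
  then have "ann (map ((*) \<mu>) ls) (\<lambda>e. a e * (f (e + 2) - of_rat l * f e))" by simp
  from ann_cmult[OF this, of "of_rat \<mu>"]
  have "ann (map ((*) \<mu>) ls) (\<lambda>e. of_rat \<mu> * (a e * (f (e + 2) - of_rat l * f e)))" .
  then have "ann (map ((*) \<mu>) ls) (\<lambda>e. a (e + 2) * f (e + 2) - of_rat (\<mu> * l) * (a e * f e))"
  proof (rule ann_cong[of _ _ e0])
    fix e assume "e \<ge> e0"
    then have "a (e + 2) = of_rat \<mu> * a e" by (rule assms)
    then show "of_rat \<mu> * (a e * (f (e + 2) - of_rat l * f e)) = a (e + 2) * f (e + 2) - of_rat (\<mu> * l) * (a e * f e)"
      by (simp only: of_rat_mult) (simp add: algebra_simps)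
  qed
  then show ?case by simp
qed

lemma ann_move: "ann (xs @ l # ys) f \<longleftrightarrow> ann (l # xs @ ys) f"
proof (induction xs arbitrary: f)
  case (Cons x xs)
  have "(\<lambda>e. f (e + 2 + 2) - of_rat x * f (e + 2) - of_rat l * (f (e + 2) - of_rat x * f e)) =
    (\<lambda>e. f (e + 2 + 2) - of_rat l * f (e + 2) - of_rat x * (f (e + 2) - of_rat l * f e))"
    by (auto simp: algebra_simps)
  then show ?case using Cons by simp
qed simp

lemma ann_partition: "ann ls f \<Longrightarrow> ann (filter (\<lambda>l. l \<noteq> 1) ls @ filter (\<lambda>l. l = 1) ls) f"
proof (induction ls arbitrary: f)
  case (Cons l ls)
  then have 1: "ann (filter (\<lambda>l. l \<noteq> 1) ls @ filter (\<lambda>l. l = 1) ls) (\<lambda>e. f (e + 2) - of_rat l * f e)"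
    by (metis ann.simps(2))
  show ?case
  proof (cases "l = 1")
    case True
    have "ann (filter (\<lambda>l. l \<noteq> 1) ls @ l # filter (\<lambda>l. l = 1) ls) f"
      unfolding ann_move using 1 by simp
    then show ?thesis using True by simp
  next
    case False
    then show ?thesis using 1 by simp
  qed
qed simp

text \<open>Induction on the multiplicity of the root 1. The difference f(e+2) - f(e) has a shorter
  annihilator and tends to 0; being eventually 2-periodic by induction, it is eventually 0.\<close>

lemma ann_ones_convergent:
  assumes "ann ls f" "\<And>l. l \<in> set ls \<Longrightarrow> l = 1" "f \<longlonglongrightarrow> L"
  shows "\<exists>e0. \<forall>e\<ge>e0. f (e + 2) = f e"
  using assms
proof (induction ls arbitrary: f L)
  case Nil
  then obtain e0 where "\<forall>e\<ge>e0. f e = 0" by auto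
  then have "\<forall>e\<ge>e0. f (e + 2) = f e" by simp
  then show ?case by blast
next
  case (Cons l ls)
  let ?g = "\<lambda>e. f (e + 2) - f e"
  have "l = 1" using Cons.prems by simp
  then have g: "ann ls ?g" using Cons.prems(1) by simp
  have lim: "?g \<longlonglongrightarrow> 0"
    using tendsto_diff[OF LIMSEQ_ignore_initial_segment[OF Cons.prems(3), of 2] Cons.prems(3)] by simp
  obtain e0 where e0: "\<forall>e\<ge>e0. ?g (e + 2) = ?g e" using Cons.IH[OF g _ lim] Cons.prems(2) by auto
  have "?g e = 0" if "e \<ge> e0" for e
  proof -
    have k: "?g (e + 2 * k) = ?g e" for k
    proof (induction k)
      case (Suc k)
      have "?g (e + 2 * Suc k) = ?g (e + 2 * k + 2)" by (simp add: add.assoc)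
      also have "\<dots> = ?g (e + 2 * k)" using e0 that by (simp only: trans_le_add1)
      finally show ?case using Suc by simp
    qed simp
    have "strict_mono (\<lambda>k. e + 2 * k)" by (auto simp: strict_mono_def)
    from LIMSEQ_subseq_LIMSEQ[OF lim this] have "(\<lambda>k. ?g e) \<longlonglongrightarrow> 0"
      unfolding o_def k .
    then show ?thesis using LIMSEQ_unique tendsto_const by blast
  qed
  then show ?case by (intro exI[of _ e0]) (auto simp: algebra_simps)
qed

text \<open>Applying E^2 - l to a convergent sequence multiplies its limit by 1 - l, a nonzero
  rational when l differs from 1. So these factors can be removed without losing track of whether
  the limit is rational.\<close>

lemma ann_append_operator:
  "ann (ls @ ms) f \<Longrightarrow> (\<And>l. l \<in> set ls \<Longrightarrow> l \<noteq> 1) \<Longrightarrow> f \<longlonglongrightarrow> L \<Longrightarrow> (\<And>e. f e \<in> \<rat>) \<Longrightarrow>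
    \<exists>g c. ann ms g \<and> (\<forall>e. g e \<in> \<rat>) \<and> c \<in> \<rat> \<and> c \<noteq> 0 \<and> g \<longlonglongrightarrow> c * L"
proof (induction ls arbitrary: f L)
  case Nil
  then show ?case by (intro exI[of _ f] exI[of _ 1]) auto
next
  case (Cons l ls)
  let ?g = "\<lambda>e. f (e + 2) - of_rat l * f e"
  have lim: "?g \<longlonglongrightarrow> L - of_rat l * L"
    by (intro tendsto_diff tendsto_mult_left Cons.prems(3) LIMSEQ_ignore_initial_segment)
  obtain g c where gc: "ann ms g" "\<forall>e. g e \<in> \<rat>" "c \<in> \<rat>" "c \<noteq> 0" "g \<longlonglongrightarrow> c * (L - of_rat l * L)"
    using Cons.IH[OF _ _ lim] Cons.prems by (auto simp: Rats_diff Rats_mult)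
  have "l \<noteq> 1" using Cons.prems by simp
  then have "(1 - of_rat l :: complex) \<noteq> 0"
    by (metis of_rat_1 of_rat_eq_iff right_minus_eq)
  moreover have "c * (L - of_rat l * L) = (c * (1 - of_rat l)) * L" by (simp add: algebra_simps)
  moreover have "c * (1 - of_rat l) \<in> \<rat>" using gc by (intro Rats_mult Rats_diff) auto
  ultimately show ?case using gc by (intro exI[of _ g] exI[of _ "c * (1 - of_rat l)"]) (auto simp: mult.assoc)
qed

text \<open>
  Once the factors with root \<open>\<noteq> 1\<close> have been applied, what is left is annihilated by a power of
  \<open>E\<^sup>2 - 1\<close> and convergent, hence eventually periodic and so eventually equal to its limit.
\<close>

lemma ann_limit_rational:
  assumes "ann ls f" "f \<longlonglongrightarrow> L" "\<And>e. f e \<in> \<rat>"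
  shows "L \<in> \<rat>"
proof -
  obtain g c where g: "ann (filter (\<lambda>l. l = 1) ls) g" "\<forall>e. g e \<in> \<rat>" "c \<in> \<rat>" "c \<noteq> 0" "g \<longlonglongrightarrow> c * L"
    using ann_append_operator[OF ann_partition[OF assms(1)] _ assms(2,3)] by auto
  then obtain e0 where e0: "\<forall>e\<ge>e0. g (e + 2) = g e" using ann_ones_convergent[OF g(1) _ g(5)] by auto
  have k: "g (e0 + 2 * k) = g e0" for k
  proof (induction k)
    case (Suc k)
    have "g (e0 + 2 * Suc k) = g (e0 + 2 * k + 2)" by (simp add: add.assoc)
    also have "\<dots> = g (e0 + 2 * k)" using e0 by (simp only: le_add1)
    finally show ?case using Suc by simp
  qed simp
  have "strict_mono (\<lambda>k. e0 + 2 * k)" by (auto simp: strict_mono_def)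
  from LIMSEQ_subseq_LIMSEQ[OF g(5) this] have "(\<lambda>k. g e0) \<longlonglongrightarrow> c * L" unfolding o_def k .
  then have "c * L = g e0" using LIMSEQ_unique tendsto_const by blast
  then have "L = g e0 / c" using g(4) by (simp add: field_simps)
  then show ?thesis using g by (simp add: Rats_divide)
qed

section \<open>Diagonalisation of symmetric matrices\<close>

text \<open>The inverse is carried along as an argument, because the substitution X -> X V in an
  average needs it as a witness.\<close>

definition GLp :: "nat \<Rightarrow> 'a::comm_ring_1 mat \<Rightarrow> 'a mat \<Rightarrow> bool" where
  "GLp n V W \<longleftrightarrow> V \<in> carrier_mat n n \<and> W \<in> carrier_mat n n \<and> V * W = 1\<^sub>m n \<and> W * V = 1\<^sub>m n"

lemma GLp_one: "GLp n (1\<^sub>m n) (1\<^sub>m n)"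
  by (simp add: GLp_def)

lemma GLp_mult:
  assumes "GLp n V W" "GLp n V' W'"
  shows "GLp n (V * V') (W' * W)"
proof -
  from assms have c: "V \<in> carrier_mat n n" "W \<in> carrier_mat n n" "V' \<in> carrier_mat n n" "W' \<in> carrier_mat n n"
    and e: "V * W = 1\<^sub>m n" "W * V = 1\<^sub>m n" "V' * W' = 1\<^sub>m n" "W' * V' = 1\<^sub>m n" by (auto simp: GLp_def)
  have "V * V' * (W' * W) = V * ((V' * W') * W)" using c by (simp add: mult_assoc_dim)
  also have "\<dots> = 1\<^sub>m n" using c e by simp
  finally have 1: "V * V' * (W' * W) = 1\<^sub>m n" .
  have "W' * W * (V * V') = W' * ((W * V) * V')" using c by (simp add: mult_assoc_dim)
  also have "\<dots> = 1\<^sub>m n" using c e by simp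
  finally show ?thesis using 1 c by (simp add: GLp_def)
qed

lemma GLp_transpose: "GLp n V W \<Longrightarrow> GLp n (transpose_mat V) (transpose_mat W)"
  unfolding GLp_def by (auto simp flip: transpose_mult_dim)

lemma GLp_block:
  assumes "GLp a V W" "GLp b V' W'"
  shows "GLp (a + b) (four_block_mat V (0\<^sub>m a b) (0\<^sub>m b a) V') (four_block_mat W (0\<^sub>m a b) (0\<^sub>m b a) W')"
proof -
  from assms have c: "V \<in> carrier_mat a a" "W \<in> carrier_mat a a" "V' \<in> carrier_mat b b" "W' \<in> carrier_mat b b"
    and e: "V * W = 1\<^sub>m a" "W * V = 1\<^sub>m a" "V' * W' = 1\<^sub>m b" "W' * V' = 1\<^sub>m b" by (auto simp: GLp_def)
  have "four_block_mat V (0\<^sub>m a b) (0\<^sub>m b a) V' * four_block_mat W (0\<^sub>m a b) (0\<^sub>m b a) W' = 1\<^sub>m (a + b)"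
    using c e by (subst mult_four_block_mat[of _ a a _ b _ b _ _ a _ b]) (auto intro!: eq_matI)
  moreover have "four_block_mat W (0\<^sub>m a b) (0\<^sub>m b a) W' * four_block_mat V (0\<^sub>m a b) (0\<^sub>m b a) V' = 1\<^sub>m (a + b)"
    using c e by (subst mult_four_block_mat[of _ a a _ b _ b _ _ a _ b]) (auto intro!: eq_matI)
  ultimately show ?thesis using c by (simp add: GLp_def)
qed

lemma GLp_lower:
  assumes "B \<in> carrier_mat b a"
  shows "GLp (a + b) (four_block_mat (1\<^sub>m a) (0\<^sub>m a b) B (1\<^sub>m b)) (four_block_mat (1\<^sub>m a) (0\<^sub>m a b) (- B) (1\<^sub>m b))"
proof -
  have "four_block_mat (1\<^sub>m a) (0\<^sub>m a b) B (1\<^sub>m b) * four_block_mat (1\<^sub>m a) (0\<^sub>m a b) (- B) (1\<^sub>m b) = 1\<^sub>m (a + b)"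
    using assms by (subst mult_four_block_mat[of _ a a _ b _ b _ _ a _ b]) (auto intro!: eq_matI)
  moreover have "four_block_mat (1\<^sub>m a) (0\<^sub>m a b) (- B) (1\<^sub>m b) * four_block_mat (1\<^sub>m a) (0\<^sub>m a b) B (1\<^sub>m b) = 1\<^sub>m (a + b)"
    using assms by (subst mult_four_block_mat[of _ a a _ b _ b _ _ a _ b]) (auto intro!: eq_matI)
  ultimately show ?thesis using assms by (simp add: GLp_def)
qed

text \<open>The action on the Fourier variable dual to X -> X V; see \<open>pr_conj\<close>.\<close>

definition conj_mat :: "'a::comm_ring_1 mat \<Rightarrow> 'a mat \<Rightarrow> 'a mat" where
  "conj_mat V Y = V * Y * transpose_mat V"

lemma conj_mat_carrier [simp]: "V \<in> carrier_mat n n \<Longrightarrow> Y \<in> carrier_mat n n \<Longrightarrow> conj_mat V Y \<in> carrier_mat n n"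
  by (simp add: conj_mat_def)

lemma conj_mat_mult: "V \<in> carrier_mat n n \<Longrightarrow> V' \<in> carrier_mat n n \<Longrightarrow> Y \<in> carrier_mat n n \<Longrightarrow>
  conj_mat V (conj_mat V' Y) = conj_mat (V * V') Y"
  by (simp add: conj_mat_def transpose_mult_dim mult_assoc_dim)

lemma conj_mat_one: "Y \<in> carrier_mat n n \<Longrightarrow> conj_mat (1\<^sub>m n) Y = Y"
  by (simp add: conj_mat_def)

lemma conj_mat_inv: "GLp n V W \<Longrightarrow> Y \<in> carrier_mat n n \<Longrightarrow> conj_mat W (conj_mat V Y) = Y"
  using conj_mat_mult[of W n V Y] conj_mat_one[of Y n] by (auto simp: GLp_def)

lemma conj_mat_transpose: "V \<in> carrier_mat n n \<Longrightarrow> Y \<in> carrier_mat n n \<Longrightarrow> transpose_mat (conj_mat V Y) = conj_mat V (transpose_mat Y)"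
  by (simp add: conj_mat_def transpose_mult_dim mult_assoc_dim)

lemma conj_mat_add: "V \<in> carrier_mat n n \<Longrightarrow> Y \<in> carrier_mat n n \<Longrightarrow> Z \<in> carrier_mat n n \<Longrightarrow>
  conj_mat V (Y + Z) = conj_mat V Y + conj_mat V Z"
  by (simp add: conj_mat_def mult_add_distrib_mat[of _ n n] add_mult_distrib_mat[of _ n n])

lemma conj_mat_diff: "V \<in> carrier_mat n n \<Longrightarrow> Y \<in> carrier_mat n n \<Longrightarrow> Z \<in> carrier_mat n n \<Longrightarrow>
  conj_mat V (Y - Z) = conj_mat V Y - conj_mat V Z"
  by (simp add: conj_mat_def mult_minus_distrib_mat[of _ n n] minus_mult_distrib_mat[of _ n n])

lemma conj_mat_smult: "V \<in> carrier_mat n n \<Longrightarrow> Y \<in> carrier_mat n n \<Longrightarrow> conj_mat V (c \<cdot>\<^sub>m Y) = c \<cdot>\<^sub>m conj_mat V Y"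
  by (simp add: conj_mat_def mult_smult_distrib[of _ n n] mult_smult_assoc_mat[of _ n n])

lemma pdiv_conj: "V \<in> carrier_mat n n \<Longrightarrow> Y \<in> carrier_mat n n \<Longrightarrow> pdiv e Y \<Longrightarrow> pdiv e (conj_mat V Y)"
  unfolding conj_mat_def by (intro pdiv_mult_left[of _ n n _ n] pdiv_mult_right[of _ n n _ n]) auto

lemma pdiv_conj_iff: "GLp n V W \<Longrightarrow> Y \<in> carrier_mat n n \<Longrightarrow> pdiv e (conj_mat V Y) \<longleftrightarrow> pdiv e Y"
  using pdiv_conj[of V n Y e] pdiv_conj[of W n "conj_mat V Y" e] conj_mat_inv[of n V W Y] by (auto simp: GLp_def)

text \<open>The new diagonal entry is the value of the form at e_i + e_j; this is how a unit off the
  diagonal reaches the diagonal.\<close>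

lemma conj_addrow:
  fixes Y :: "'a::comm_ring_1 mat"
  assumes "Y \<in> carrier_mat n n" "i < n" "j < n" "i \<noteq> j"
  shows "\<exists>V W. GLp n V W \<and> conj_mat V Y $$ (i,i) = Y $$ (i,i) + Y $$ (i,j) + Y $$ (j,i) + Y $$ (j,j)"
proof -
  let ?V = "addrow_mat n (1::'a) i j"
  have V: "?V \<in> carrier_mat n n" by simp
  have "GLp n ?V (addrow_mat n (- 1) i j)"
    using addrow_mat_inv[of i n j, where a="1::'a"] addrow_mat_inv[of i n j, where a="-1::'a"] assms by (simp add: GLp_def)
  moreover have "conj_mat ?V Y = transpose_mat (?V * transpose_mat (?V * Y))"
    using assms by (simp add: conj_mat_def transpose_mult_dim mult_assoc_dim)
  moreover have "?V * transpose_mat (?V * Y) = addrow 1 i j (transpose_mat (addrow 1 i j Y))"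
    using addrow_mat[of Y n n j 1 i] addrow_mat[of "transpose_mat (?V * Y)" n n j 1 i] assms
      mult_carrier_mat[OF V assms(1)] by simp
  ultimately show ?thesis using assms by (intro exI[of _ ?V] exI[of _ "addrow_mat n (- 1) i j"]) (auto simp: algebra_simps)
qed

lemma conj_swaprows:
  fixes Y :: "'a::comm_ring_1 mat"
  assumes "Y \<in> carrier_mat n n" "i < n"
  shows "\<exists>V W. GLp n V W \<and> conj_mat V Y $$ (0,0) = Y $$ (i,i)"
proof -
  let ?V = "swaprows_mat n 0 i :: 'a mat"
  have n: "0 < n" using assms by simp
  have "GLp n ?V ?V"
    using swaprows_mat_inv[of 0 n i] assms n by (simp add: GLp_def)
  moreover have "conj_mat ?V Y = transpose_mat (?V * transpose_mat (?V * Y))"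
    using assms by (simp add: conj_mat_def transpose_mult_dim mult_assoc_dim)
  moreover have "?V * transpose_mat (?V * Y) = swaprows 0 i (transpose_mat (swaprows 0 i Y))"
    using swaprows_mat[of Y n n 0 i] swaprows_mat[of "transpose_mat (?V * Y)" n n 0 i] assms n
      mult_carrier_mat[of ?V n n Y n] by simp
  ultimately show ?thesis using assms n by (intro exI[of _ ?V]) auto
qed

lemma conj_block:
  assumes "V \<in> carrier_mat b b" "a \<in> carrier_mat 1 1" "Y \<in> carrier_mat b b"
  shows "conj_mat (four_block_mat (1\<^sub>m 1) (0\<^sub>m 1 b) (0\<^sub>m b 1) V) (four_block_mat a (0\<^sub>m 1 b) (0\<^sub>m b 1) Y) =
    four_block_mat a (0\<^sub>m 1 b) (0\<^sub>m b 1) (conj_mat V Y)"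
proof -
  have t: "transpose_mat (four_block_mat (1\<^sub>m 1) (0\<^sub>m 1 b) (0\<^sub>m b 1) V) = four_block_mat (1\<^sub>m 1) (0\<^sub>m 1 b) (0\<^sub>m b 1) (transpose_mat V)"
    using assms by (subst transpose_four_block_mat) auto
  have "four_block_mat (1\<^sub>m 1) (0\<^sub>m 1 b) (0\<^sub>m b 1) V * four_block_mat a (0\<^sub>m 1 b) (0\<^sub>m b 1) Y =
    four_block_mat a (0\<^sub>m 1 b) (0\<^sub>m b 1) (V * Y)"
    using assms by (subst mult_four_block_mat[of _ 1 1 _ b _ b _ _ 1 _ b]) auto
  then show ?thesis unfolding conj_mat_def t
    using assms by (simp, subst mult_four_block_mat[of _ 1 1 _ b _ b _ _ 1 _ b]) auto
qed

text \<open>Read from right to left this is symmetric elimination: a matrix whose first row and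
  column are multiples of its corner is congruent to a block diagonal one.\<close>

lemma conj_lower:
  assumes "a \<in> carrier_mat 1 1" "D \<in> carrier_mat b b" "B \<in> carrier_mat b 1"
  shows "conj_mat (four_block_mat (1\<^sub>m 1) (0\<^sub>m 1 b) B (1\<^sub>m b)) (four_block_mat a (0\<^sub>m 1 b) (0\<^sub>m b 1) D) =
    four_block_mat a (a * transpose_mat B) (B * a) (B * a * transpose_mat B + D)"
proof -
  have t: "transpose_mat (four_block_mat (1\<^sub>m 1) (0\<^sub>m 1 b) B (1\<^sub>m b)) = four_block_mat (1\<^sub>m 1) (transpose_mat B) (0\<^sub>m b 1) (1\<^sub>m b)"
    using assms by (subst transpose_four_block_mat) auto
  have "four_block_mat (1\<^sub>m 1) (0\<^sub>m 1 b) B (1\<^sub>m b) * four_block_mat a (0\<^sub>m 1 b) (0\<^sub>m b 1) D =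
    four_block_mat a (0\<^sub>m 1 b) (B * a) D"
    using assms by (subst mult_four_block_mat[of _ 1 1 _ b _ b _ _ 1 _ b]) auto
  then show ?thesis unfolding conj_mat_def t
    using assms by (simp, subst mult_four_block_mat[of _ 1 1 _ b _ b _ _ 1 _ b]) auto
qed

lemma mat_1x1_mult: "a \<in> carrier_mat 1 1 \<Longrightarrow> X \<in> carrier_mat 1 n \<Longrightarrow> a * X = a $$ (0,0) \<cdot>\<^sub>m X"
  by (intro eq_matI) (auto simp: scalar_prod_def)

lemma mat_mult_1x1: "a \<in> carrier_mat 1 1 \<Longrightarrow> X \<in> carrier_mat n 1 \<Longrightarrow> X * a = a $$ (0,0) \<cdot>\<^sub>m (X :: 'a::comm_ring_1 mat)"
  by (intro eq_matI) (auto simp: scalar_prod_def mult.commute)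

text \<open>Splits off a unit: this is where \<open>p \<noteq> 2\<close> enters, through \<open>(e\<^sub>i + e\<^sub>j)\<close> representing \<open>2 y\<^sub>i\<^sub>j\<close> modulo \<open>p\<close>.\<close>

lemma symmetric_split_unit:
  fixes Y :: "'p::prime_card padic_int mat"
  assumes odd: "odd CARD('p)" and Y: "Y \<in> carrier_mat (Suc n) (Suc n)" "transpose_mat Y = Y" and nd: "\<not> pdiv 1 Y"
  shows "\<exists>V W a D. GLp (Suc n) V W \<and> a \<in> carrier_mat 1 1 \<and> a $$ (0,0) dvd 1 \<and> D \<in> carrier_mat n n \<and>
    transpose_mat D = D \<and> conj_mat V Y = four_block_mat a (0\<^sub>m 1 n) (0\<^sub>m n 1) D"
proof -
  have sym: "Y $$ (i,j) = Y $$ (j,i)" if "i < Suc n" "j < Suc n" for i j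
    using that Y by (metis carrier_matD index_transpose_mat(1))
  have "\<exists>V W i. GLp (Suc n) V W \<and> i < Suc n \<and> conj_mat V Y $$ (i,i) dvd 1"
  proof (cases "\<exists>i<Suc n. Y $$ (i,i) dvd 1")
    case True
    then show ?thesis using GLp_one[of "Suc n"] conj_mat_one[OF Y(1)] by metis
  next
    case False
    obtain i j where ij: "i < Suc n" "j < Suc n" and u: "\<not> pp dvd Y $$ (i,j)"
      using nd Y by (auto simp: pdiv_def)
    have d: "pp dvd Y $$ (i,i)" "pp dvd Y $$ (j,j)" using False ij padic_unit_iff by blast+
    then have "i \<noteq> j" using u by metis
    obtain V W where VW: "GLp (Suc n) V W" "conj_mat V Y $$ (i,i) = Y $$ (i,i) + Y $$ (i,j) + Y $$ (j,i) + Y $$ (j,j)"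
      using conj_addrow[OF Y(1) ij \<open>i \<noteq> j\<close>] by blast
    have "conj_mat V Y $$ (i,i) = (Y $$ (i,i) + Y $$ (j,j)) + 2 * Y $$ (i,j)"
      using VW(2) sym[OF ij] by (simp add: algebra_simps)
    moreover have "\<not> pp dvd 2 * Y $$ (i,j)"
      using u padic_two_unit[OF odd] pp_pow_dvd_unit_mult[of 2 1 "Y $$ (i,j)"] by simp
    ultimately have "\<not> pp dvd conj_mat V Y $$ (i,i)"
      using d by (metis dvd_add dvd_add_right_iff)
    then show ?thesis using VW(1) ij padic_unit_iff by blast
  qed
  then obtain V1 W1 i where 1: "GLp (Suc n) V1 W1" "i < Suc n" "conj_mat V1 Y $$ (i,i) dvd 1" by blast
  then have c1: "V1 \<in> carrier_mat (Suc n) (Suc n)" by (simp add: GLp_def)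
  obtain V2 W2 where 2: "GLp (Suc n) V2 W2" "conj_mat V2 (conj_mat V1 Y) $$ (0,0) = conj_mat V1 Y $$ (i,i)"
    using conj_swaprows[OF conj_mat_carrier[OF c1 Y(1)] 1(2)] by blast
  then have c2: "V2 \<in> carrier_mat (Suc n) (Suc n)" by (simp add: GLp_def)
  define Z where "Z = conj_mat V2 (conj_mat V1 Y)"
  have Z: "Z \<in> carrier_mat (1 + n) (1 + n)" using c1 c2 Y by (simp add: Z_def)
  have Zt: "transpose_mat Z = Z" unfolding Z_def using c1 c2 Y by (simp add: conj_mat_transpose[of _ "Suc n"])
  have Z0: "Z $$ (0,0) dvd 1" using 1 2 by (simp add: Z_def)
  then obtain v where v: "Z $$ (0,0) * v = 1" by (metis dvdE)
  \<comment> \<open>Elimination with pivot \<open>a\<close>: \<open>B\<close> is the column below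
    the pivot divided by the pivot (\<open>v\<close> is its inverse), and \<open>D\<close> is the
    Schur complement.\<close>
  define a where "a = mat 1 1 (\<lambda>_. Z $$ (0,0))"
  define B where "B = mat n 1 (\<lambda>(i,_). v * Z $$ (Suc i, 0))"
  define D where "D = mat n n (\<lambda>(i,j). Z $$ (Suc i, Suc j)) - B * a * transpose_mat B"
  have c: "a \<in> carrier_mat 1 1" "B \<in> carrier_mat n 1" "D \<in> carrier_mat n n" by (auto simp: a_def B_def D_def)
  have Zsym: "Z $$ (i,j) = Z $$ (j,i)" if "i < 1 + n" "j < 1 + n" for i j
    using that Z Zt by (metis carrier_matD index_transpose_mat(1))
  let ?L = "four_block_mat (1\<^sub>m 1) (0\<^sub>m 1 n) B (1\<^sub>m n)"
  let ?L' = "four_block_mat (1\<^sub>m 1) (0\<^sub>m 1 n) (- B) (1\<^sub>m n)"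
  let ?M = "four_block_mat a (0\<^sub>m 1 n) (0\<^sub>m n 1) D"
  have L: "GLp (Suc n) ?L ?L'" using GLp_lower[OF c(2)] by simp
  have L': "GLp (Suc n) ?L' ?L" using L by (simp add: GLp_def)
  have a00: "a $$ (0,0) = Z $$ (0,0)" by (simp add: a_def)
  have "conj_mat ?L ?M = Z"
  proof -
    have BD: "B * a * transpose_mat B + D = mat n n (\<lambda>(i,j). Z $$ (Suc i, Suc j))"
      unfolding D_def using c by (intro eq_matI) auto
    have Ba: "B * a = mat n 1 (\<lambda>(i,_). Z $$ (Suc i, 0))"
    proof -
      have vx: "Z $$ (0,0) * (v * x) = x" for x using v by (metis mult.assoc mult_1)
      show ?thesis unfolding mat_mult_1x1[OF c(1,2)] a00
        by (rule eq_matI) (simp_all add: B_def vx)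
    qed
    have aB: "a * transpose_mat B = mat 1 n (\<lambda>(_,i). Z $$ (0, Suc i))"
    proof -
      have "a * transpose_mat B = transpose_mat (B * a)"
        using c by (subst transpose_mult_dim) (auto simp: a_def intro!: eq_matI arg_cong2[where f="(*)"])
      also have "\<dots> = mat 1 n (\<lambda>(_,i). Z $$ (0, Suc i))" unfolding Ba using Zsym by (intro eq_matI) auto
      finally show ?thesis .
    qed
    show ?thesis unfolding conj_lower[OF c(1,3,2)] BD unfolding Ba aB
      using Z by (intro eq_matI) (auto simp: a_def)
  qed
  then have M: "conj_mat ?L' Z = ?M"
    using conj_mat_inv[OF L, of ?M] four_block_carrier_mat[OF c(1,3)] by simp
  have cL: "?L' \<in> carrier_mat (Suc n) (Suc n)" using L by (simp add: GLp_def)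
  have Dt: "transpose_mat D = D"
  proof -
    have "transpose_mat (B * a * transpose_mat B) = B * a * transpose_mat B"
    proof -
      have "transpose_mat a = a" by (auto simp: a_def)
      then show ?thesis using c by (simp add: transpose_mult_dim mult_assoc_dim)
    qed
    moreover have "transpose_mat (mat n n (\<lambda>(i,j). Z $$ (Suc i, Suc j))) = mat n n (\<lambda>(i,j). Z $$ (Suc i, Suc j))"
      using Zsym by (intro eq_matI) auto
    ultimately show ?thesis unfolding D_def using c
      by (metis (no_types, lifting) D_def transpose_minus carrier_matI dim_col_mat(1) dim_row_mat(1) mult_carrier_mat transpose_carrier_mat)
  qed
  have "conj_mat (?L' * (V2 * V1)) Y = ?M"
    using M c1 c2 cL Y by (simp add: Z_def conj_mat_mult[of _ "Suc n"])
  then show ?thesis using GLp_mult[OF L' GLp_mult[OF 2(1) 1(1)]] c Dt Z0 a00 by metis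
qed

text \<open>Dividing a nonzero matrix by the largest power of p in all its entries leaves one with a
  unit entry, from which a unit is split off; the process stops at a zero block, the radical.
  \<open>Q\<close> and \<open>c\<close> record nondegeneracy of \<open>S1\<close> in quantitative
  form: p^(f+c) dividing S1 x forces p^f to divide x.\<close>

lemma symmetric_normal_form:
  fixes S :: "'p::prime_card padic_int mat"
  assumes odd: "odd CARD('p)" 
  shows "S \<in> carrier_mat n n \<Longrightarrow> transpose_mat S = S \<Longrightarrow>
    \<exists>s r V W S1 Q c. n = s + r \<and> GLp n V W \<and> S1 \<in> carrier_mat s s \<and> transpose_mat S1 = S1 \<and> Q \<in> carrier_mat s s \<and>
      Q * S1 = pp ^ c \<cdot>\<^sub>m 1\<^sub>m s \<and> conj_mat V S = four_block_mat S1 (0\<^sub>m s r) (0\<^sub>m r s) (0\<^sub>m r r)"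
proof (induction n arbitrary: S)
  case 0
  have "conj_mat (1\<^sub>m 0) S = four_block_mat (0\<^sub>m 0 0) (0\<^sub>m 0 0) (0\<^sub>m 0 0) (0\<^sub>m 0 0)"
    using 0 by (intro eq_matI) (auto simp: conj_mat_def)
  then show ?case using GLp_one[of 0]
    by (intro exI[of _ 0] exI[of _ "1\<^sub>m 0"] exI[of _ "0\<^sub>m 0 0"]) auto
next
  case (Suc n)
  show ?case
  proof (cases "S = 0\<^sub>m (Suc n) (Suc n)")
    case True
    have "conj_mat (1\<^sub>m (Suc n)) S = four_block_mat (0\<^sub>m 0 0) (0\<^sub>m 0 (Suc n)) (0\<^sub>m (Suc n) 0) (0\<^sub>m (Suc n) (Suc n))"
      using True conj_mat_one[OF Suc.prems(1)] by (auto intro!: eq_matI)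
    then show ?thesis using GLp_one[of "Suc n"]
      by (intro exI[of _ 0] exI[of _ "Suc n"] exI[of _ "1\<^sub>m (Suc n)"] exI[of _ "0\<^sub>m 0 0"]) auto
  next
    case False
    then obtain i j where ij: "i < Suc n" "j < Suc n" "S $$ (i,j) \<noteq> 0"
      using Suc.prems(1) by (metis eq_matI carrier_matD index_zero_mat)
    obtain v u where "S $$ (i,j) = pp ^ v * u" "u dvd 1" using padic_decomp[OF ij(3)] by blast
    then have "\<not> pp ^ Suc v dvd S $$ (i,j)"
      using padic_unit_iff[of u] pp_pow_add_dvd[of 1 v u] by simp
    then have "\<not> pdiv (Suc v) S" unfolding pdiv_def using ij Suc.prems(1) by (metis carrier_matD)
    then have ex: "\<exists>f. \<not> pdiv f S" by blast
    \<comment> \<open>The largest \<open>f\<close> with p^f dividing all entries is found as the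
      predecessor of the first failing exponent.\<close>
    define g where "g = (LEAST f. \<not> pdiv f S)"
    have g: "\<not> pdiv g S" unfolding g_def by (rule LeastI_ex[OF ex])
    then obtain f where f: "g = Suc f" by (cases g) auto
    have "pdiv f S" using not_less_Least[of f "\<lambda>f. \<not> pdiv f S"] f unfolding g_def by auto
    then obtain S0 where S0: "S0 \<in> carrier_mat (Suc n) (Suc n)" "S = pp ^ f \<cdot>\<^sub>m S0" using pdivE Suc.prems(1) by blast
    have nd: "\<not> pdiv 1 S0"
    proof
      assume "pdiv 1 S0"
      then have "pdiv g S" unfolding S0(2) f pdiv_def by (auto intro: mult_dvd_mono simp: mult.commute)
      then show False using g by simp
    qed
    have "transpose_mat S0 = S0"
    proof (rule eq_matI)
      fix i j assume "i < dim_row S0" "j < dim_col S0"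
      then have *: "i < Suc n" "j < Suc n" using S0 by auto
      then have "S $$ (j,i) = S $$ (i,j)" using Suc.prems by (metis carrier_matD index_transpose_mat(1))
      then have "pp ^ f * S0 $$ (j,i) = pp ^ f * S0 $$ (i,j)" using * S0 by simp
      then show "transpose_mat S0 $$ (i,j) = S0 $$ (i,j)" using * S0 pp_nz[where 'p='p] by simp
    qed (use S0 in auto)
    then obtain V W a D where VW: "GLp (Suc n) V W" "a \<in> carrier_mat 1 1" "a $$ (0,0) dvd 1" "D \<in> carrier_mat n n"
      "transpose_mat D = D" "conj_mat V S0 = four_block_mat a (0\<^sub>m 1 n) (0\<^sub>m n 1) D"
      using symmetric_split_unit[OF odd S0(1) _ nd] by blast
    have "transpose_mat (pp ^ f \<cdot>\<^sub>m D) = pp ^ f \<cdot>\<^sub>m D"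
    proof -
      have "transpose_mat (pp ^ f \<cdot>\<^sub>m D) = pp ^ f \<cdot>\<^sub>m transpose_mat D" by (intro eq_matI) auto
      then show ?thesis using VW(5) by simp
    qed
    then obtain s r V' W' S1 Q c where IH: "n = s + r" "GLp n V' W'" "S1 \<in> carrier_mat s s" "transpose_mat S1 = S1"
      "Q \<in> carrier_mat s s" "Q * S1 = pp ^ c \<cdot>\<^sub>m 1\<^sub>m s"
      "conj_mat V' (pp ^ f \<cdot>\<^sub>m D) = four_block_mat S1 (0\<^sub>m s r) (0\<^sub>m r s) (0\<^sub>m r r)"
      using Suc.IH[of "pp ^ f \<cdot>\<^sub>m D"] VW(4) by auto
    obtain w where w: "a $$ (0,0) * w = 1" using VW(3) by (metis dvdE)
    define b where "b = pp ^ f \<cdot>\<^sub>m a"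
    have b: "b \<in> carrier_mat 1 1" using VW by (simp add: b_def)
    define S2 where "S2 = four_block_mat b (0\<^sub>m 1 s) (0\<^sub>m s 1) S1"
    \<comment> \<open>The two diagonal blocks must reach the same power p^(c+f): \<open>w\<close>
      inverts the unit in p^f a, which leaves a factor p^c to supply, while \<open>Q\<close> reaches
      p^c and needs p^f.\<close>
    define Q2 where "Q2 = four_block_mat (mat 1 1 (\<lambda>_. w * pp ^ c)) (0\<^sub>m 1 s) (0\<^sub>m s 1) (pp ^ f \<cdot>\<^sub>m Q)"
    let ?V = "four_block_mat (1\<^sub>m 1) (0\<^sub>m 1 n) (0\<^sub>m n 1) V'"
    let ?W = "four_block_mat (1\<^sub>m 1) (0\<^sub>m 1 n) (0\<^sub>m n 1) W'"
    have GV: "GLp (Suc n) ?V ?W" using GLp_block[OF GLp_one[of 1] IH(2)] by simp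
    have cV: "V' \<in> carrier_mat n n" "?V \<in> carrier_mat (Suc n) (Suc n)" "V \<in> carrier_mat (Suc n) (Suc n)"
      using IH(2) GV VW(1) by (auto simp: GLp_def)
    have cf: "conj_mat (?V * V) S = conj_mat ?V (conj_mat V S)"
      using cV Suc.prems(1) by (intro conj_mat_mult[of _ "Suc n", symmetric])
    also have "conj_mat V S = pp ^ f \<cdot>\<^sub>m conj_mat V S0"
      unfolding S0(2) using cV S0 by (intro conj_mat_smult)
    also have "\<dots> = four_block_mat b (0\<^sub>m 1 n) (0\<^sub>m n 1) (pp ^ f \<cdot>\<^sub>m D)"
      unfolding VW(6) b_def using VW by (subst smult_four_block_mat[of _ 1 1 _ n _ n]) auto
    also have "conj_mat ?V \<dots> = four_block_mat b (0\<^sub>m 1 n) (0\<^sub>m n 1) (four_block_mat S1 (0\<^sub>m s r) (0\<^sub>m r s) (0\<^sub>m r r))"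
      using conj_block[OF cV(1) b, of "pp ^ f \<cdot>\<^sub>m D"] VW(4) IH(7) by simp
    also have "\<dots> = four_block_mat S2 (0\<^sub>m (Suc s) r) (0\<^sub>m r (Suc s)) (0\<^sub>m r r)"
      unfolding S2_def using IH(1,3) b by (intro eq_matI) (auto simp: less_Suc_eq_0_disj)
    finally have 1: "conj_mat (?V * V) S = four_block_mat S2 (0\<^sub>m (Suc s) r) (0\<^sub>m r (Suc s)) (0\<^sub>m r r)" .
    have "Q2 * S2 = four_block_mat (mat 1 1 (\<lambda>_. w * pp ^ c) * b) (0\<^sub>m 1 s) (0\<^sub>m s 1) (pp ^ f \<cdot>\<^sub>m (Q * S1))"
      unfolding Q2_def S2_def using b IH(3,5) by (subst mult_four_block_mat[of _ 1 1 _ s _ s _ _ 1 _ s])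
        (auto simp: mult_smult_assoc_mat[of _ s s])
    also have "\<dots> = pp ^ (c + f) \<cdot>\<^sub>m 1\<^sub>m (Suc s)"
    proof -
      have "w * pp ^ c * (pp ^ f * a $$ (0,0)) = pp ^ (c + f) * (a $$ (0,0) * w)"
        by (simp add: power_add mult_ac)
      then have e: "mat 1 1 (\<lambda>_. w * pp ^ c) * b = pp ^ (c + f) \<cdot>\<^sub>m 1\<^sub>m 1"
        using VW(2) w unfolding b_def by (intro eq_matI) (auto simp: scalar_prod_def)
      show ?thesis unfolding e IH(6) by (intro eq_matI) (auto simp: power_add mult.commute)
    qed
    finally have 2: "Q2 * S2 = pp ^ (c + f) \<cdot>\<^sub>m 1\<^sub>m (Suc s)" .
    have "transpose_mat b = b" using b by (intro eq_matI) auto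
    then have 3: "transpose_mat S2 = S2" unfolding S2_def using b IH(3,4) by (subst transpose_four_block_mat[of _ 1 1 _ s _ s]) auto
    have 4: "S2 \<in> carrier_mat (Suc s) (Suc s)" "Q2 \<in> carrier_mat (Suc s) (Suc s)"
      using b IH(3,5) by (auto simp: S2_def Q2_def)
    have "Suc n = Suc s + r" using IH(1) by simp
    with 1 2 3 4 GLp_mult[OF GV VW(1)] show ?thesis by blast
  qed
qed

section \<open>Recurrences for weighted isotropic counts\<close>

text \<open>Invariance of the weight under base change; it lets \<open>y\<close> be moved within its
  \<open>conj_mat\<close> orbit.\<close>

definition right_inv :: "nat \<Rightarrow> nat \<Rightarrow> ('p::prime_card padic_int mat \<Rightarrow> complex) \<Rightarrow> bool" where
  "right_inv m n w \<longleftrightarrow> (\<forall>X\<in>carrier_mat m n. \<forall>V W. GLp n V W \<longrightarrow> w (X * V) = w X)"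

definition wG :: "nat \<Rightarrow> 'p::prime_card padic_int mat \<Rightarrow> nat \<Rightarrow> ('p padic_int mat \<Rightarrow> complex) \<Rightarrow> 'p padic_int mat \<Rightarrow> complex" where
  "wG e S n w y = avg e (dim_row S) n (\<lambda>X. w X * psi e (pr y (gram S X)))"

text \<open>The part of the Fourier integral over one residue class modulo p. Whether y + y^t
  contains a unit depends on that class only, and the two cases obey different recursions.\<close>

definition wsum :: "nat \<Rightarrow> 'p::prime_card padic_int mat \<Rightarrow> nat \<Rightarrow> ('p padic_int mat \<Rightarrow> complex) \<Rightarrow> 'p padic_int mat \<Rightarrow> complex" where
  "wsum e S n w y0 = avg e n n (\<lambda>y. if pdiv 1 (y - y0) then wG e S n w y else 0)"

text \<open>The Gauss sum of a single column. The restriction to multiples of p costs nothing for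
  unit \<open>a\<close> and large \<open>e\<close> by \<open>avg_unit_support\<close>, and it
  removes the weight from this factor.\<close>

definition gam :: "nat \<Rightarrow> 'p::prime_card padic_int mat \<Rightarrow> 'p padic_int mat \<Rightarrow> complex" where
  "gam e S a = avg e (dim_row S) 1 (\<lambda>x. (if pdiv 1 x then 1 else 0) * psi e (pr a (gram S x)))"

definition phi :: "nat \<Rightarrow> 'p::prime_card padic_int mat \<Rightarrow> 'p padic_int mat \<Rightarrow> complex" where
  "phi e S a0 = avg e 1 1 (\<lambda>a. if pdiv 1 (a - a0) then gam e S a else 0)"

lemma lc_if_pdiv:
  assumes "lc e m n f" "d \<le> e" "Y \<in> carrier_mat m n"
  shows "lc e m n (\<lambda>X. if pdiv d (X - Y) then f X else 0)"
proof (rule lcI)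
  fix X Z :: "'a padic_int mat" assume c: "X \<in> carrier_mat m n" "Z \<in> carrier_mat m n" and p: "pdiv e (X - Z)"
  have eq: "X - Y - (Z - Y) = X - Z" using c assms(3) by (intro eq_matI) auto
  have "pdiv d (X - Y) \<longleftrightarrow> pdiv d (Z - Y)"
    by (rule pdiv_diff_iff[of _ m n]) (use c assms pdiv_mono[OF p] eq in auto)
  then show "(if pdiv d (X - Y) then f X else 0) = (if pdiv d (Z - Y) then f Z else 0)"
    using lcD[OF assms(1) c p] by simp
qed

lemma lc_psi_gram:
  assumes "S \<in> carrier_mat m m" "y \<in> carrier_mat n n"
  shows "lc e m n (\<lambda>X. psi e (pr y (gram S X)))"
  by (rule lcI, rule psi_pr_cong_right[of _ n n]) (use assms in \<open>auto intro: gram_cong\<close>)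

lemma lc_indicator: "lc i m n (\<lambda>x. if pdiv i x then 1 else 0)"
proof (rule lcI)
  fix X Y :: "'a padic_int mat" assume "X \<in> carrier_mat m n" "Y \<in> carrier_mat m n" "pdiv i (X - Y)"
  then have "pdiv i X \<longleftrightarrow> pdiv i Y" by (rule pdiv_diff_iff)
  then show "(if pdiv i X then 1 else 0 :: complex) = (if pdiv i Y then 1 else 0)" by (simp only:)
qed

lemma lc_wG:
  assumes "S \<in> carrier_mat m m"
  shows "lc e n n (wG e S n w)"
proof (rule lcI)
  fix y z :: "'a padic_int mat" assume "y \<in> carrier_mat n n" "z \<in> carrier_mat n n" "pdiv e (y - z)"
  then have "psi e (pr y (gram S X)) = psi e (pr z (gram S X))" if "X \<in> carrier_mat m n" for X
    using assms that by (intro psi_pr_cong_left[of _ n n]) auto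
  then show "wG e S n w y = wG e S n w z"
    unfolding wG_def using assms by (intro avg_cong) auto
qed

lemma wG_conj:
  assumes S: "S \<in> carrier_mat m m" and y: "y \<in> carrier_mat n n" and V: "GLp n V W"
    and w: "right_inv m n w" "lc 1 m n w" and e: "e \<ge> 1"
  shows "wG e S n w (conj_mat V y) = wG e S n w y"
proof -
  have c: "V \<in> carrier_mat n n" using V by (simp add: GLp_def)
  let ?f = "\<lambda>X. w X * psi e (pr y (gram S X))"
  have lc: "lc e m n ?f" by (intro lc_mult lc_psi_gram S y lc_mono[OF w(2) e])
  have "wG e S n w (conj_mat V y) = avg e m n (\<lambda>X. ?f (X * V))"
    unfolding wG_def using S
  proof (simp, intro avg_cong)
    fix X :: "'a padic_int mat" assume X: "X \<in> carrier_mat m n"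
    have "pr (conj_mat V y) (gram S X) = pr y (gram S (X * V))"
      using pr_conj[OF y c, of "gram S X"] gram_mult[OF S X c] S X by (simp add: conj_mat_def)
    moreover have "w (X * V) = w X" using w(1) X V unfolding right_inv_def by blast
    ultimately show "w X * psi e (pr (conj_mat V y) (gram S X)) = ?f (X * V)" by simp
  qed
  also have "\<dots> = avg e m n ?f" using avg_mult_right[OF lc, of V W] V by (simp add: GLp_def)
  finally show ?thesis unfolding wG_def using S by simp
qed

text \<open>Gram matrices \<open>G\<close> are symmetric, so 2 tr(y^t G) depends only on y + y^t,
  and 2 is a unit. Hence \<open>y\<close> may be changed by any antisymmetric matrix.\<close>

lemma wG_sym:
  fixes S :: "'p::prime_card padic_int mat"
  assumes odd: "odd CARD('p)" and S: "S \<in> carrier_mat m m" "transpose_mat S = S"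
    and y: "y \<in> carrier_mat n n" and z: "z \<in> carrier_mat n n"
    and eq: "y + transpose_mat y = z + transpose_mat z"
  shows "wG e S n w y = wG e S n w z"
proof -
  have "pr y (gram S X) = pr z (gram S X)" if X: "X \<in> carrier_mat m n" for X
  proof -
    have g: "gram S X \<in> carrier_mat n n" "transpose_mat (gram S X) = gram S X"
      using S X by (auto simp: transpose_gram)
    have "2 * pr u (gram S X) = pr (u + transpose_mat u) (gram S X)" if u: "u \<in> carrier_mat n n" for u
      using pr_transpose[OF u g(1)] pr_add_left[OF u _ g(1), of "transpose_mat u"] u g by simp
    from this[OF y] this[OF z] have *: "2 * pr y (gram S X) = 2 * pr z (gram S X)" using eq by simp
    obtain v :: "'p padic_int" where v: "2 * v = 1" using padic_two_unit[OF odd] by (metis dvdE)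
    from * have "(2 * v) * pr y (gram S X) = (2 * v) * pr z (gram S X)"
      using arg_cong[OF *, of "\<lambda>x. v * x"] by (simp only: mult_ac)
    then show ?thesis by (simp add: v)
  qed
  then show ?thesis unfolding wG_def using S by (intro avg_cong) auto
qed

lemma wsum_conj:
  assumes S: "S \<in> carrier_mat m m" and y0: "y0 \<in> carrier_mat n n" and V: "GLp n V W"
    and w: "right_inv m n w" "lc 1 m n w" and e: "e \<ge> 1"
  shows "wsum e S n w (conj_mat V y0) = wsum e S n w y0"
proof -
  have c: "V \<in> carrier_mat n n" "W \<in> carrier_mat n n" and V': "GLp n W V" using V by (auto simp: GLp_def)
  let ?h = "\<lambda>z. if pdiv 1 (z - conj_mat V y0) then wG e S n w z else 0"
  have lc: "lc e n n ?h" using lc_if_pdiv[OF lc_wG[OF S] e] c y0 by simp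
  have "wsum e S n w y0 = avg e n n (\<lambda>y. ?h (conj_mat V y))"
    unfolding wsum_def
  proof (rule avg_cong)
    fix y :: "'a padic_int mat" assume y: "y \<in> carrier_mat n n"
    have "pdiv 1 (conj_mat V y - conj_mat V y0) \<longleftrightarrow> pdiv 1 (y - y0)"
      using pdiv_conj_iff[OF V, of "y - y0" 1] conj_mat_diff[OF c(1) y y0] y0 by simp
    then show "(if pdiv 1 (y - y0) then wG e S n w y else 0) = ?h (conj_mat V y)"
      using wG_conj[OF S y V w e] by simp
  qed
  also have "\<dots> = avg e n n ?h"
  proof (rule avg_transform[OF lc, where \<chi>="conj_mat W"])
    fix X Y :: "'a padic_int mat" assume "X \<in> carrier_mat n n" "Y \<in> carrier_mat n n" "pdiv e (X - Y)"
    then show "pdiv e (conj_mat V X - conj_mat V Y)" "pdiv e (conj_mat W X - conj_mat W Y)"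
      using c by (auto simp flip: conj_mat_diff intro!: pdiv_conj)
  qed (use c conj_mat_inv[OF V] conj_mat_inv[OF V'] in auto)
  finally show ?thesis by (simp add: wsum_def)
qed

section \<open>Stationary phase in one column\<close>

lemma mat_add_diff_cancel: "A \<in> carrier_mat m n \<Longrightarrow> B \<in> carrier_mat m n \<Longrightarrow> A + B - A = (B :: 'a::ab_group_add mat)"
  by (intro eq_matI) auto

lemma pdiv_smult_unit_iff:
  assumes "(u :: 'p::prime_card padic_int) dvd 1"
  shows "pdiv (d + t) (pp ^ t \<cdot>\<^sub>m (u \<cdot>\<^sub>m K)) \<longleftrightarrow> pdiv d K"
proof -
  have "pdiv (d + t) (pp ^ t \<cdot>\<^sub>m (u \<cdot>\<^sub>m K)) \<longleftrightarrow>
      (\<forall>i<dim_row K. \<forall>j<dim_col K. pp ^ (d + t) dvd pp ^ t * (u * K $$ (i,j)))"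
    by (simp add: pdiv_def)
  then show ?thesis unfolding pp_pow_add_dvd pp_pow_dvd_unit_mult[OF assms] by (simp add: pdiv_def)
qed

lemma transpose_1x1: "C \<in> carrier_mat 1 1 \<Longrightarrow> transpose_mat C = C"
  by (intro eq_matI) auto

text \<open>Translating \<open>x\<close> by p^t z leaves \<open>h\<close> alone, kills the quadratic
  term in z and multiplies the phase by a character linear in z. Averaging over z keeps only those x
  where this character is trivial, that is where p^(c+2) divides S x.\<close>

lemma avg_unit_support_dual:
  fixes S :: "'p::prime_card padic_int mat"
  assumes odd: "odd CARD('p)" and S: "S \<in> carrier_mat m m" "transpose_mat S = S"
    and a: "a \<in> carrier_mat 1 1" "a $$ (0,0) dvd 1" and h: "lc 2 m 1 h" and e: "e \<ge> 2 * c + 4"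
  shows "avg e m 1 (\<lambda>x. h x * psi e (pr a (gram S x))) =
    avg e m 1 (\<lambda>x. h x * psi e (pr a (gram S x)) * (if pdiv (c + 2) (S * x) then 1 else 0))"
proof -
  \<comment> \<open>With this \<open>t\<close> triviality of the linear term modulo p^e means
    divisibility by p^(e-t) = p^(c+2). The bound e >= 2c + 4 is exactly 2t >= e, which removes the
    quadratic term; it also gives t >= 2, the level of \<open>h\<close>.\<close>
  define t where "t = e - (c + 2)"
  have t: "2 \<le> t" "e \<le> t + t" "e = (c + 2) + t" using e by (auto simp: t_def)
  let ?F = "\<lambda>x. h x * psi e (pr a (gram S x))"
  let ?B = "\<lambda>x. pp ^ t \<cdot>\<^sub>m (2 \<cdot>\<^sub>m (S * x * a))"
  have lcF: "lc e m 1 ?F"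
    by (intro lc_mult lc_psi_gram S(1) a(1) lc_mono[OF h]) (use e in simp)
  have shift: "?F (x + pp ^ t \<cdot>\<^sub>m z) = ?F x * psi e (pr z (?B x))"
    if x: "x \<in> carrier_mat m 1" and z: "z \<in> carrier_mat m 1" for x z
  proof -
    let ?Z = "pp ^ t \<cdot>\<^sub>m z"
    let ?C = "transpose_mat x * S * ?Z"
    have Z: "?Z \<in> carrier_mat m 1" using z by simp
    have C: "?C \<in> carrier_mat 1 1" using x S Z by simp
    have Ct: "transpose_mat ?C = ?C" by (rule transpose_1x1[OF C])
    have "x + ?Z - x = ?Z" by (rule mat_add_diff_cancel[OF x Z])
    then have "h (x + ?Z) = h x"
      using x Z pdiv_mono[OF pdiv_smult_pp t(1), of z] by (intro lcD[OF h]) auto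
    moreover have "psi e (pr a (gram S (x + ?Z))) = psi e (pr a (gram S x)) * psi e (pr z (?B x))"
    proof -
      have "pr a (gram S (x + ?Z)) = pr a (gram S x) + (pr a ?C + pr a ?C) + pr a (gram S ?Z)"
        unfolding gram_add[OF S x Z] Ct using a(1) S x Z C by (simp add: pr_add_right[of _ 1 1])
      moreover have "pr a ?C + pr a ?C = pr z (?B x)"
      proof -
        have K: "S * x * a \<in> carrier_mat m 1" using S x a by simp
        have "transpose_mat (transpose_mat x * S) = S * x"
          using S x by (simp add: transpose_mult_dim)
        then have "pr a ?C = pr (S * x * a) ?Z"
          using pr_mult_right1[of a 1 1 "transpose_mat x * S" m ?Z] a(1) x S Z by simp
        also have "\<dots> = pp ^ t * pr z (S * x * a)"
          unfolding pr_smult_right[OF K z] pr_commute[OF K z] ..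
        finally show ?thesis
          unfolding pr_smult_right[OF z smult_carrier_mat[OF K]] pr_smult_right[OF z K] by (simp add: algebra_simps)
      qed
      moreover have "psi e (pr a (gram S ?Z)) = 1"
      proof (rule psi_eq_1, rule pr_dvd_right)
        have "gram S ?Z = pp ^ (t + t) \<cdot>\<^sub>m gram S z" using gram_smult[OF S(1) z] by (simp add: power_add)
        then show "pdiv e (gram S ?Z)" using pdiv_mono[OF pdiv_smult_pp t(2)] by simp
      qed (use a S Z in auto)
      ultimately show ?thesis by (simp add: psi_add)
    qed
    ultimately show ?thesis by simp
  qed
  \<comment> \<open>Each translate has the same average, so a further average over z changes
    nothing; after exchanging the order the inner one is a character sum.\<close>
  have "avg e m 1 ?F = avg e m 1 (\<lambda>z. avg e m 1 (\<lambda>x. ?F (x + pp ^ t \<cdot>\<^sub>m z)))"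
  proof -
    have "avg e m 1 (\<lambda>z. avg e m 1 (\<lambda>x. ?F (x + pp ^ t \<cdot>\<^sub>m z))) = avg e m 1 (\<lambda>z :: 'p padic_int mat. avg e m 1 ?F)"
      by (intro avg_cong avg_translate[OF lcF]) simp
    then show ?thesis by simp
  qed
  also have "\<dots> = avg e m 1 (\<lambda>z. avg e m 1 (\<lambda>x. ?F x * psi e (pr z (?B x))))"
    by (intro avg_cong shift)
  also have "\<dots> = avg e m 1 (\<lambda>x. avg e m 1 (\<lambda>z. ?F x * psi e (pr z (?B x))))" by (rule avg_swap)
  also have "\<dots> = avg e m 1 (\<lambda>x. ?F x * (if pdiv (c + 2) (S * x) then 1 else 0))"
  proof (rule avg_cong)
    fix x :: "'p padic_int mat" assume x: "x \<in> carrier_mat m 1"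
    have "pdiv e (?B x) \<longleftrightarrow> pdiv (c + 2) (S * x)"
    proof -
      have Sx: "S * x \<in> carrier_mat m 1" using S x by simp
      have u: "2 * a $$ (0,0) dvd 1" using mult_dvd_mono[OF padic_two_unit[OF odd] a(2)] by simp
      have "?B x = pp ^ t \<cdot>\<^sub>m ((2 * a $$ (0,0)) \<cdot>\<^sub>m (S * x))"
        unfolding mat_mult_1x1[OF a(1) Sx] using Sx by (intro eq_matI) (auto simp: mult.assoc)
      then show ?thesis unfolding t(3) by (simp only: pdiv_smult_unit_iff[OF u])
    qed
    then show "avg e m 1 (\<lambda>z. ?F x * psi e (pr z (?B x))) = ?F x * (if pdiv (c + 2) (S * x) then 1 else 0)"
      unfolding avg_cmult using avg_psi[of "?B x" m 1 e] S x a by simp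
  qed
  finally show ?thesis .
qed

text \<open>By means of \<open>Q\<close>, divisibility of S x by p^(c+2) forces p^2 to divide x. The
  dual form is applied to \<open>h\<close> and to \<open>h\<close> times the indicator; both become
  the same average. The bound i <= 2 keeps the indicator periodic modulo p^2.\<close>

lemma avg_unit_support:
  fixes S :: "'p::prime_card padic_int mat"
  assumes odd: "odd CARD('p)" and S: "S \<in> carrier_mat m m" "transpose_mat S = S"
    and Q: "Q \<in> carrier_mat m m" "Q * S = pp ^ c \<cdot>\<^sub>m 1\<^sub>m m"
    and a: "a \<in> carrier_mat 1 1" "a $$ (0,0) dvd 1" and h: "lc 2 m 1 h" and e: "e \<ge> 2 * c + 4" and i: "i \<le> 2"
  shows "avg e m 1 (\<lambda>x. h x * psi e (pr a (gram S x))) =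
    avg e m 1 (\<lambda>x. h x * (if pdiv i x then 1 else 0) * psi e (pr a (gram S x)))"
proof -
  have imp: "pdiv i x" if x: "x \<in> carrier_mat m 1" and p: "pdiv (c + 2) (S * x)" for x
  proof -
    have "Q * (S * x) = pp ^ c \<cdot>\<^sub>m x"
      using assoc_mult_mat[OF Q(1) S(1) x] Q(2) x by (simp add: mult_smult_assoc_mat[of _ m m])
    moreover have "pdiv (c + 2) (Q * (S * x))" by (rule pdiv_mult_right[OF Q(1) _ p, of 1]) (use S x in auto)
    ultimately have "pdiv (2 + c) (pp ^ c \<cdot>\<^sub>m x)" by (simp add: add.commute)
    then have "\<forall>i<m. \<forall>j<1. pp ^ (2 + c) dvd pp ^ c * x $$ (i,j)" using x by (simp add: pdiv_def)
    then have "pdiv 2 x" unfolding pdiv_def pp_pow_add_dvd using x by simp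
    then show ?thesis using i pdiv_mono by blast
  qed
  have h': "lc 2 m 1 (\<lambda>x. h x * (if pdiv i x then 1 else 0))"
    by (intro lc_mult h lc_mono[OF lc_indicator i])
  have "avg e m 1 (\<lambda>x. h x * (if pdiv i x then 1 else 0) * psi e (pr a (gram S x))) =
     avg e m 1 (\<lambda>x. h x * (if pdiv i x then 1 else 0) * psi e (pr a (gram S x)) * (if pdiv (c + 2) (S * x) then 1 else 0))"
    by (rule avg_unit_support_dual[OF odd S a h' e])
  also have "\<dots> = avg e m 1 (\<lambda>x. h x * psi e (pr a (gram S x)) * (if pdiv (c + 2) (S * x) then 1 else 0))"
    using imp by (intro avg_cong) auto
  also have "\<dots> = avg e m 1 (\<lambda>x. h x * psi e (pr a (gram S x)))"
    by (rule avg_unit_support_dual[OF odd S a h e, symmetric])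
  finally show ?thesis ..
qed

lemma lc_gam:
  assumes "S \<in> carrier_mat m m"
  shows "lc e 1 1 (gam e S)"
proof (rule lcI)
  fix y z :: "'a padic_int mat" assume "y \<in> carrier_mat 1 1" "z \<in> carrier_mat 1 1" "pdiv e (y - z)"
  then have "psi e (pr y (gram S X)) = psi e (pr z (gram S X))" if "X \<in> carrier_mat m 1" for X
    using assms that by (intro psi_pr_cong_left[of _ 1 1]) auto
  then show "gam e S y = gam e S z"
    unfolding gam_def using assms by (intro avg_cong) auto
qed

text \<open>The sum lives on x divisible by p^2, so x = p x' with x' again divisible by p. This
  costs the volume p^(-m) and divides the phase by p^2, so the same sum reappears two levels lower:
  the origin of the step two in \<open>ann\<close>.\<close>

lemma gam_step:
  fixes S :: "'p::prime_card padic_int mat"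
  assumes odd: "odd CARD('p)" and S: "S \<in> carrier_mat m m" "transpose_mat S = S"
    and Q: "Q \<in> carrier_mat m m" "Q * S = pp ^ c \<cdot>\<^sub>m 1\<^sub>m m"
    and a: "a \<in> carrier_mat 1 1" "a $$ (0,0) dvd 1" and e: "e \<ge> 2 * c + 4"
  shows "gam (e + 2) S a = gam e S a / of_nat CARD('p) ^ m"
proof -
  let ?f = "\<lambda>x. (if pdiv 2 x then 1 else 0) * psi (e + 2) (pr a (gram S x))"
  have "gam (e + 2) S a = avg (e + 2) m 1 (\<lambda>x. (if pdiv 1 x then 1 else 0) * (if pdiv 2 x then 1 else 0) * psi (e + 2) (pr a (gram S x)))"
    unfolding gam_def using avg_unit_support[OF odd S Q a lc_mono[OF lc_indicator[of 1]], of "e + 2" 2] S e by simp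
  also have "\<dots> = avg (e + 2) m 1 (\<lambda>x. if pdiv 1 (x - 0\<^sub>m m 1) then ?f x else 0)"
  proof (rule avg_cong)
    fix x :: "'p padic_int mat" assume x: "x \<in> carrier_mat m 1"
    then have "x - 0\<^sub>m m 1 = x" by (intro eq_matI) auto
    then show "(if pdiv 1 x then 1 else 0) * (if pdiv 2 x then 1 else 0) * psi (e + 2) (pr a (gram S x)) =
      (if pdiv 1 (x - 0\<^sub>m m 1) then ?f x else 0)" by simp
  qed
  also have "\<dots> = avg (e + 1) m 1 (\<lambda>x. ?f (0\<^sub>m m 1 + pp \<cdot>\<^sub>m x)) / of_nat CARD('p) ^ m"
  proof -
    have "lc (e + 2) m 1 ?f" by (intro lc_mult lc_psi_gram S a lc_mono[OF lc_indicator]) simp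
    then show ?thesis using avg_box[of "e + 1" m 1 ?f "0\<^sub>m m 1"] by simp
  qed
  \<comment> \<open>The box substitution lowers the averaging level only from e + 2 to e + 1,
    whereas the phase falls to level e; \<open>avg_level\<close> then closes the gap.\<close>
  also have "avg (e + 1) m 1 (\<lambda>x. ?f (0\<^sub>m m 1 + pp \<cdot>\<^sub>m x)) = avg (e + 1) m 1 (\<lambda>x. (if pdiv 1 x then 1 else 0) * psi e (pr a (gram S x)))"
  proof (rule avg_cong)
    fix x :: "'p padic_int mat" assume x: "x \<in> carrier_mat m 1"
    then have 0: "0\<^sub>m m 1 + pp \<cdot>\<^sub>m x = pp \<cdot>\<^sub>m x" by (intro eq_matI) auto
    have "pdiv 2 (pp \<cdot>\<^sub>m x) \<longleftrightarrow> pdiv 1 x"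
      unfolding pdiv_def using x pp_pow_add_dvd[of 1 1, where 'p='p] by (simp add: numeral_2_eq_2)
    moreover have "psi (e + 2) (pr a (gram S (pp \<cdot>\<^sub>m x))) = psi e (pr a (gram S x))"
      using psi_pp[of "Suc e" "pp * pr a (gram S x)"] psi_pp[of e "pr a (gram S x)"] S x a
      by (simp add: gram_smult[OF S(1) x] pr_smult_right[of _ 1 1] mult.assoc)
    ultimately show "?f (0\<^sub>m m 1 + pp \<cdot>\<^sub>m x) = (if pdiv 1 x then 1 else 0) * psi e (pr a (gram S x))" by (simp only: 0)
  qed
  also have "\<dots> = gam e S a"
  proof -
    have "lc e m 1 (\<lambda>x. (if pdiv 1 x then 1 else 0) * psi e (pr a (gram S x)))"
      by (intro lc_mult lc_psi_gram S a lc_mono[OF lc_indicator]) (use e in simp)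
    then show ?thesis unfolding gam_def using S avg_level[of e m 1 _ "e + 1"] by simp
  qed
  finally show ?thesis .
qed

lemma unit_cong:
  assumes "a0 \<in> carrier_mat 1 1" "a0 $$ (0,0) dvd 1" "a \<in> carrier_mat 1 1" "pdiv 1 (a - a0)"
  shows "a $$ (0,0) dvd (1 :: 'p::prime_card padic_int)"
proof -
  have "pp dvd a $$ (0,0) - a0 $$ (0,0)" using assms by (simp add: pdiv_def)
  then show ?thesis using assms(2) unfolding padic_unit_iff by (metis dvd_diff_right_iff)
qed

lemma phi_step:
  fixes S :: "'p::prime_card padic_int mat"
  assumes odd: "odd CARD('p)" and S: "S \<in> carrier_mat m m" "transpose_mat S = S"
    and Q: "Q \<in> carrier_mat m m" "Q * S = pp ^ c \<cdot>\<^sub>m 1\<^sub>m m"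
    and a0: "a0 \<in> carrier_mat 1 1" "a0 $$ (0,0) dvd 1" and e: "e \<ge> 2 * c + 4"
  shows "phi (e + 2) S a0 = of_rat (1 / of_nat CARD('p) ^ m) * phi e S a0"
proof -
  have "phi (e + 2) S a0 = avg (e + 2) 1 1 (\<lambda>a. (if pdiv 1 (a - a0) then gam e S a else 0) * (1 / of_nat CARD('p) ^ m))"
    unfolding phi_def using gam_step[OF odd S Q _ unit_cong[OF a0] e] by (intro avg_cong) auto
  also have "\<dots> = avg (e + 2) 1 1 (\<lambda>a. if pdiv 1 (a - a0) then gam e S a else 0) * (1 / of_nat CARD('p) ^ m)"
    by (rule avg_cmult_right)
  also have "avg (e + 2) 1 1 (\<lambda>a. if pdiv 1 (a - a0) then gam e S a else 0) = phi e S a0"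
    unfolding phi_def by (rule avg_level[OF lc_if_pdiv[OF lc_gam[OF S(1)]]]) (use a0 e in auto)
  finally show ?thesis by (simp add: of_rat_divide of_rat_power)
qed

section \<open>Splitting a unit off the Fourier variable\<close>

lemma pr_zero_left [simp]: "pr (0\<^sub>m m n) A = 0" if "A \<in> carrier_mat m n" for A
  using that by (simp add: pr_def)

text \<open>For block diagonal \<open>y\<close> the phase separates the first column x from the
  rest. Stationary phase makes x divisible by p, and a weight of level 1 cannot tell such an x from
  0, so the Gauss sum factors.\<close>

lemma wG_block:
  fixes S :: "'p::prime_card padic_int mat"
  assumes odd: "odd CARD('p)" and S: "S \<in> carrier_mat m m" "transpose_mat S = S"
    and Q: "Q \<in> carrier_mat m m" "Q * S = pp ^ c \<cdot>\<^sub>m 1\<^sub>m m"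
    and a: "a \<in> carrier_mat 1 1" "a $$ (0,0) dvd 1" and d: "d \<in> carrier_mat n n" and e: "e \<ge> 2 * c + 4"
    and w: "lc 1 m (Suc n) w"
  shows "wG e S (Suc n) w (four_block_mat a (0\<^sub>m 1 n) (0\<^sub>m n 1) d) = gam e S a * wG e S n (\<lambda>X. w (0\<^sub>m m 1 @\<^sub>c X)) d"
proof -
  have lcw: "pdiv 1 ((x @\<^sub>c X) - (z @\<^sub>c X))" if "pdiv 1 (x - z)" "x \<in> carrier_mat m 1" "z \<in> carrier_mat m 1" "X \<in> carrier_mat m n" for x z X :: "'p padic_int mat"
    using that unfolding pdiv_def append_cols_def by auto
  have "wG e S (Suc n) w (four_block_mat a (0\<^sub>m 1 n) (0\<^sub>m n 1) d) =
    avg e m 1 (\<lambda>x. avg e m n (\<lambda>X. w (x @\<^sub>c X) * psi e (pr (four_block_mat a (0\<^sub>m 1 n) (0\<^sub>m n 1) d) (gram S (x @\<^sub>c X)))))"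
    unfolding wG_def using S avg_cols[of e m 1 n] by simp
  also have "\<dots> = avg e m 1 (\<lambda>x. avg e m n (\<lambda>X. psi e (pr d (gram S X)) * (w (x @\<^sub>c X) * psi e (pr a (gram S x)))))"
  proof (intro avg_cong)
    fix x X :: "'p padic_int mat" assume "x \<in> carrier_mat m 1" "X \<in> carrier_mat m n"
    then have "pr (four_block_mat a (0\<^sub>m 1 n) (0\<^sub>m n 1) d) (gram S (x @\<^sub>c X)) = pr a (gram S x) + pr d (gram S X)"
      using S a d by (simp add: gram_cols[of S m x 1 X n] pr_four_block[of _ 1 1 _ n _ n])
    then show "w (x @\<^sub>c X) * psi e (pr (four_block_mat a (0\<^sub>m 1 n) (0\<^sub>m n 1) d) (gram S (x @\<^sub>c X))) =
      psi e (pr d (gram S X)) * (w (x @\<^sub>c X) * psi e (pr a (gram S x)))" by (simp add: psi_add)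
  qed
  also have "\<dots> = avg e m n (\<lambda>X. psi e (pr d (gram S X)) * avg e m 1 (\<lambda>x. w (x @\<^sub>c X) * psi e (pr a (gram S x))))"
    by (subst avg_swap) (simp only: avg_cmult)
  also have "\<dots> = avg e m n (\<lambda>X. gam e S a * (w (0\<^sub>m m 1 @\<^sub>c X) * psi e (pr d (gram S X))))"
  proof (rule avg_cong)
    fix X :: "'p padic_int mat" assume X: "X \<in> carrier_mat m n"
    have lch: "lc 1 m 1 (\<lambda>x. w (x @\<^sub>c X))"
    proof (rule lcI)
      fix x z :: "'p padic_int mat" assume xz: "x \<in> carrier_mat m 1" "z \<in> carrier_mat m 1" "pdiv 1 (x - z)"
      show "w (x @\<^sub>c X) = w (z @\<^sub>c X)"
        by (rule lcD[OF w]) (use lcw[OF xz(3) xz(1,2) X] carrier_append_cols[OF xz(1) X] carrier_append_cols[OF xz(2) X] in auto)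
    qed
    have "avg e m 1 (\<lambda>x. w (x @\<^sub>c X) * psi e (pr a (gram S x))) =
      avg e m 1 (\<lambda>x. w (x @\<^sub>c X) * (if pdiv 1 x then 1 else 0) * psi e (pr a (gram S x)))"
      by (rule avg_unit_support[OF odd S Q a lc_mono[OF lch] e]) auto
    also have "\<dots> = avg e m 1 (\<lambda>x. w (0\<^sub>m m 1 @\<^sub>c X) * ((if pdiv 1 x then 1 else 0) * psi e (pr a (gram S x))))"
    proof (rule avg_cong)
      fix x :: "'p padic_int mat" assume x: "x \<in> carrier_mat m 1"
      have "x - 0\<^sub>m m 1 = x" using x by (intro eq_matI) auto
      then have "w (x @\<^sub>c X) = w (0\<^sub>m m 1 @\<^sub>c X)" if "pdiv 1 x" using lcD[OF lch x, of "0\<^sub>m m 1"] that by simp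
      then show "w (x @\<^sub>c X) * (if pdiv 1 x then 1 else 0) * psi e (pr a (gram S x)) =
        w (0\<^sub>m m 1 @\<^sub>c X) * ((if pdiv 1 x then 1 else 0) * psi e (pr a (gram S x)))" by simp
    qed
    also have "\<dots> = w (0\<^sub>m m 1 @\<^sub>c X) * gam e S a" unfolding avg_cmult gam_def using S by simp
    finally show "psi e (pr d (gram S X)) * avg e m 1 (\<lambda>x. w (x @\<^sub>c X) * psi e (pr a (gram S x))) =
      gam e S a * (w (0\<^sub>m m 1 @\<^sub>c X) * psi e (pr d (gram S X)))" by simp
  qed
  also have "\<dots> = gam e S a * wG e S n (\<lambda>X. w (0\<^sub>m m 1 @\<^sub>c X)) d"
    unfolding avg_cmult wG_def using S by simp
  finally show ?thesis .
qed

lemma pdiv_four_block: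
  assumes "A \<in> carrier_mat m1 n1" "B \<in> carrier_mat m1 n2" "C \<in> carrier_mat m2 n1" "D \<in> carrier_mat m2 n2"
  shows "pdiv e (four_block_mat A B C D) \<longleftrightarrow> pdiv e A \<and> pdiv e B \<and> pdiv e C \<and> pdiv e D"
proof
  assume *: "pdiv e (four_block_mat A B C D)"
  then have p: "pp ^ e dvd four_block_mat A B C D $$ (i,j)" if "i < m1 + m2" "j < n1 + n2" for i j
    using assms that by (auto simp: pdiv_def)
  show "pdiv e A \<and> pdiv e B \<and> pdiv e C \<and> pdiv e D"
  proof (intro conjI)
    show "pdiv e A" unfolding pdiv_def
    proof (intro allI impI)
      fix i j assume "i < dim_row A" "j < dim_col A" then show "pp ^ e dvd A $$ (i,j)" using assms p[of i j] by simp
    qed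
    show "pdiv e B" unfolding pdiv_def
    proof (intro allI impI)
      fix i j assume "i < dim_row B" "j < dim_col B" then show "pp ^ e dvd B $$ (i,j)" using assms p[of i "j + n1"] by simp
    qed
    show "pdiv e C" unfolding pdiv_def
    proof (intro allI impI)
      fix i j assume "i < dim_row C" "j < dim_col C" then show "pp ^ e dvd C $$ (i,j)" using assms p[of "i + m1" j] by simp
    qed
    show "pdiv e D" unfolding pdiv_def
    proof (intro allI impI)
      fix i j assume "i < dim_row D" "j < dim_col D" then show "pp ^ e dvd D $$ (i,j)" using assms p[of "i + m1" "j + n1"] by simp
    qed
  qed
qed (use assms in \<open>auto simp: pdiv_def\<close>)

text \<open>
  Completing the square in \<open>y\<close> rather than in \<open>X\<close>: the lower right block changes only by a matrix
  divisible by \<open>p\<close>, which a translation of that block absorbs.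
\<close>

lemma wG_complete_square:
  fixes S :: "'p::prime_card padic_int mat"
  assumes odd: "odd CARD('p)" and S: "S \<in> carrier_mat m m" "transpose_mat S = S"
    and w: "right_inv m (Suc n) w" "lc 1 m (Suc n) w" and e: "e \<ge> 1"
    and a: "a \<in> carrier_mat 1 1" "a $$ (0,0) dvd 1" and b: "b \<in> carrier_mat 1 n" and c: "c \<in> carrier_mat n 1"
    and bc: "pdiv 1 (b + transpose_mat c)"
  shows "\<exists>E \<in> carrier_mat n n. pdiv 1 E \<and> (\<forall>d \<in> carrier_mat n n.
    wG e S (Suc n) w (four_block_mat a b c d) = wG e S (Suc n) w (four_block_mat a (0\<^sub>m 1 n) (0\<^sub>m n 1) (d + E)))"
proof -
  have "2 * a $$ (0,0) dvd 1" using mult_dvd_mono[OF padic_two_unit[OF odd] a(2)] by simp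
  then obtain v where v: "2 * a $$ (0,0) * v = 1" by (metis dvdE)
  \<comment> \<open>\<open>M\<close> solves 2 a M^t = b + c^t, with v = 1 / (2 a). Then
    \<open>?z\<close>, obtained by elimination, has the same symmetrisation as \<open>?y\<close>, so
    \<open>wG_sym\<close> identifies them.\<close>
  define B where "B = b + transpose_mat c"
  define M where "M = v \<cdot>\<^sub>m transpose_mat B"
  have cM: "B \<in> carrier_mat 1 n" "M \<in> carrier_mat n 1" using b c by (auto simp: B_def M_def)
  define K where "K = M * a * transpose_mat M"
  have K: "K \<in> carrier_mat n n" using cM a by (simp add: K_def)
  have "pdiv 1 M" unfolding M_def using bc by (intro pdiv_smult) (simp add: B_def)
  then have "pdiv 1 (M * a)" by (rule pdiv_mult_left[OF cM(2) a(1)])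
  then have pK: "pdiv 1 K" unfolding K_def by (rule pdiv_mult_left[rotated 2]) (use cM a in auto)
  have at: "transpose_mat a = a" by (rule transpose_1x1[OF a(1)])
  have aM: "a * transpose_mat M = (a $$ (0,0) * v) \<cdot>\<^sub>m B"
    using mat_1x1_mult[OF a(1), of "transpose_mat M" n] cM by (auto simp: M_def mult.assoc intro!: eq_matI)
  have Ma: "M * a = transpose_mat (a * transpose_mat M)"
    using cM a by (simp add: transpose_mult_dim at)
  let ?L = "four_block_mat (1\<^sub>m 1) (0\<^sub>m 1 n) M (1\<^sub>m n)"
  have L: "GLp (Suc n) ?L (four_block_mat (1\<^sub>m 1) (0\<^sub>m 1 n) (- M) (1\<^sub>m n))" using GLp_lower[OF cM(2)] by simp
  have eq: "wG e S (Suc n) w (four_block_mat a b c d) = wG e S (Suc n) w (four_block_mat a (0\<^sub>m 1 n) (0\<^sub>m n 1) (d + (- K)))"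
    if d: "d \<in> carrier_mat n n" for d
  proof -
    let ?y = "four_block_mat a b c d"
    let ?z = "four_block_mat a (a * transpose_mat M) (M * a) d"
    have y: "?y \<in> carrier_mat (Suc n) (Suc n)" "?z \<in> carrier_mat (Suc n) (Suc n)"
      using four_block_carrier_mat[OF a(1) d] by simp_all
    have dK: "d + (- K) \<in> carrier_mat n n" using d K by simp
    have "K + (d + (- K)) = d" using d K by (intro eq_matI) auto
    then have "conj_mat ?L (four_block_mat a (0\<^sub>m 1 n) (0\<^sub>m n 1) (d + (- K))) = ?z"
      using conj_lower[OF a(1) dK cM(2)] by (simp add: K_def)
    moreover have "four_block_mat a (0\<^sub>m 1 n) (0\<^sub>m n 1) (d + (- K)) \<in> carrier_mat (Suc n) (Suc n)"
      using four_block_carrier_mat[OF a(1) dK] by simp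
    ultimately have 1: "wG e S (Suc n) w ?z = wG e S (Suc n) w (four_block_mat a (0\<^sub>m 1 n) (0\<^sub>m n 1) (d + (- K)))"
      using wG_conj[OF S(1) _ L w e] by metis
    have "?y + transpose_mat ?y = ?z + transpose_mat ?z"
    proof -
      have ty: "transpose_mat ?y = four_block_mat a (transpose_mat c) (transpose_mat b) (transpose_mat d)"
        using transpose_four_block_mat[OF a(1) b c d] at by simp
      have aMc: "a * transpose_mat M \<in> carrier_mat 1 n" "M * a \<in> carrier_mat n 1" using a cM by auto
      have tz: "transpose_mat ?z = four_block_mat a (transpose_mat (M * a)) (transpose_mat (a * transpose_mat M)) (transpose_mat d)"
        using transpose_four_block_mat[OF a(1) aMc d] at by simp
      have half: "a * transpose_mat M + a * transpose_mat M = B"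
      proof -
        have "a $$ (0,0) * v * x + a $$ (0,0) * v * x = x" for x
        proof -
          have "a $$ (0,0) * v * x + a $$ (0,0) * v * x = (2 * a $$ (0,0) * v) * x" by (simp add: algebra_simps)
          then show ?thesis by (simp only: v mult_1)
        qed
        then show ?thesis unfolding aM using cM by (intro eq_matI) auto
      qed
      have up: "b + transpose_mat c = a * transpose_mat M + transpose_mat (M * a)"
        unfolding Ma using half by (simp add: B_def)
      have "transpose_mat (b + transpose_mat c) = transpose_mat (a * transpose_mat M + transpose_mat (M * a))"
        by (simp only: up)
      then have "transpose_mat b + c = transpose_mat (a * transpose_mat M) + M * a"
      proof -
        have t: "transpose_mat (P + transpose_mat R) = transpose_mat P + R" if "P \<in> carrier_mat 1 n" "R \<in> carrier_mat n 1"
          for P R :: "'p padic_int mat" using that by (intro eq_matI) auto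
        assume "transpose_mat (b + transpose_mat c) = transpose_mat (a * transpose_mat M + transpose_mat (M * a))"
        then show ?thesis unfolding t[OF b c] t[OF aMc] .
      qed
      then have lo: "c + transpose_mat b = M * a + transpose_mat (a * transpose_mat M)"
        using b c aMc comm_add_mat[of "transpose_mat b" n 1 c] comm_add_mat[of "M * a" n 1 "transpose_mat (a * transpose_mat M)"] by simp
      show ?thesis
        unfolding ty tz
        using add_four_block_mat[OF a(1) b c d a(1), of "transpose_mat c" "transpose_mat b" "transpose_mat d"]
          add_four_block_mat[OF a(1) aMc d a(1), of "transpose_mat (M * a)" "transpose_mat (a * transpose_mat M)" "transpose_mat d"]
          b c d aMc up lo by simp
    qed
    then show ?thesis using wG_sym[OF odd S y] 1 by metis
  qed
  show ?thesis by (rule bexI[of _ "- K"]) (use eq K pK in auto)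
qed

lemma lc_const: "lc e m n (\<lambda>_. k)"
  unfolding lc_def by blast

text \<open>After completing the square the class of \<open>y0\<close> factors into independent
  integrals over its four blocks: the corner gives \<open>phi\<close>, the off-diagonal blocks only
  their volumes, and the lower right block a sum of the same kind in size \<open>n\<close>.\<close>

lemma wsum_block:
  fixes S :: "'p::prime_card padic_int mat"
  assumes odd: "odd CARD('p)" and S: "S \<in> carrier_mat m m" "transpose_mat S = S"
    and Q: "Q \<in> carrier_mat m m" "Q * S = pp ^ c \<cdot>\<^sub>m 1\<^sub>m m"
    and w: "right_inv m (Suc n) w" "lc 1 m (Suc n) w" and e: "e \<ge> 2 * c + 4"
    and a0: "a0 \<in> carrier_mat 1 1" "a0 $$ (0,0) dvd 1" and b0: "b0 \<in> carrier_mat 1 n" and c0: "c0 \<in> carrier_mat n 1"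
    and d0: "d0 \<in> carrier_mat n n" and bc: "pdiv 1 (b0 + transpose_mat c0)"
  shows "wsum e S (Suc n) w (four_block_mat a0 b0 c0 d0) = 
    phi e S a0 * (avg 1 1 n (\<lambda>b. if pdiv 1 (b - b0) then 1 else 0) * avg 1 n 1 (\<lambda>b. if pdiv 1 (b - c0) then 1 else 0) *
    wsum e S n (\<lambda>X. w (0\<^sub>m m 1 @\<^sub>c X)) d0)"
proof -
  let ?w = "\<lambda>X. w (0\<^sub>m m 1 @\<^sub>c X)"
  let ?I = "\<lambda>b0 b :: 'p padic_int mat. (if pdiv 1 (b - b0) then 1 else 0 :: complex)"
  have e1: "e \<ge> 1" using e by simp
  have inner: "avg e n n (\<lambda>d. if pdiv 1 (four_block_mat a b cc d - four_block_mat a0 b0 c0 d0) then wG e S (Suc n) w (four_block_mat a b cc d) else 0) =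
    (?I b0 b * ?I c0 cc * wsum e S n ?w d0) * (if pdiv 1 (a - a0) then gam e S a else 0)"
    if a: "a \<in> carrier_mat 1 1" and b: "b \<in> carrier_mat 1 n" and cc: "cc \<in> carrier_mat n 1" for a b cc
  proof -
    have split: "pdiv 1 (four_block_mat a b cc d - four_block_mat a0 b0 c0 d0) \<longleftrightarrow>
        pdiv 1 (a - a0) \<and> pdiv 1 (b - b0) \<and> pdiv 1 (cc - c0) \<and> pdiv 1 (d - d0)" if d: "d \<in> carrier_mat n n" for d
    proof -
      have "four_block_mat a b cc d - four_block_mat a0 b0 c0 d0 = four_block_mat (a - a0) (b - b0) (cc - c0) (d - d0)"
        using a b cc d a0 b0 c0 d0 by (intro eq_matI) auto
      moreover have "pdiv 1 (four_block_mat (a - a0) (b - b0) (cc - c0) (d - d0)) \<longleftrightarrow>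
         pdiv 1 (a - a0) \<and> pdiv 1 (b - b0) \<and> pdiv 1 (cc - c0) \<and> pdiv 1 (d - d0)"
        by (rule pdiv_four_block) (use a0 b0 c0 d0 in auto)
      ultimately show ?thesis by simp
    qed
    show ?thesis
    proof (cases "pdiv 1 (a - a0) \<and> pdiv 1 (b - b0) \<and> pdiv 1 (cc - c0)")
      case False
      then have "avg e n n (\<lambda>d. if pdiv 1 (four_block_mat a b cc d - four_block_mat a0 b0 c0 d0) then wG e S (Suc n) w (four_block_mat a b cc d) else 0) = avg e n n (\<lambda>d :: 'p padic_int mat. 0)"
        using split by (intro avg_cong) auto
      then show ?thesis using False by auto
    next
      case True
      have ua: "a $$ (0,0) dvd 1" using unit_cong[OF a0 a] True by blast
      have "pdiv 1 (b + transpose_mat cc)"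
      proof -
        have "b + transpose_mat cc = (b - b0) + transpose_mat (cc - c0) + (b0 + transpose_mat c0)"
          using b cc b0 c0 by (intro eq_matI) auto
        then show ?thesis using True bc b cc b0 c0 by (auto intro!: pdiv_add[of _ 1 n])
      qed
      then obtain E where E: "E \<in> carrier_mat n n" "pdiv 1 E" "\<And>d. d \<in> carrier_mat n n \<Longrightarrow>
        wG e S (Suc n) w (four_block_mat a b cc d) = wG e S (Suc n) w (four_block_mat a (0\<^sub>m 1 n) (0\<^sub>m n 1) (d + E))"
        using wG_complete_square[OF odd S w e1 a ua b cc] by blast
      let ?f = "\<lambda>d. if pdiv 1 (d - d0) then wG e S n ?w d else 0"
      have "avg e n n (\<lambda>d. if pdiv 1 (four_block_mat a b cc d - four_block_mat a0 b0 c0 d0) then wG e S (Suc n) w (four_block_mat a b cc d) else 0) =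
        avg e n n (\<lambda>d. gam e S a * ?f (d + E))"
      proof (rule avg_cong)
        fix d :: "'p padic_int mat" assume d: "d \<in> carrier_mat n n"
        \<comment> \<open>Since p divides \<open>E\<close>, the shift by \<open>E\<close> does not
          leave the class of \<open>d0\<close>, so it can be undone by translation.\<close>
        have "d + E - d0 - (d - d0) = E" using d d0 E(1) by (intro eq_matI) auto
        then have "pdiv 1 (d + E - d0) \<longleftrightarrow> pdiv 1 (d - d0)" using E d d0 by (intro pdiv_diff_iff[of _ n n]) auto
        then show "(if pdiv 1 (four_block_mat a b cc d - four_block_mat a0 b0 c0 d0) then wG e S (Suc n) w (four_block_mat a b cc d) else 0) = gam e S a * ?f (d + E)"
          using split[OF d] True E(3)[OF d] wG_block[OF odd S Q a ua _ e w(2), where d="d + E"] d E(1) by simp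
      qed
      also have "\<dots> = gam e S a * avg e n n ?f"
        unfolding avg_cmult using avg_translate[OF lc_if_pdiv[OF lc_wG[OF S(1)] e1 d0] E(1)] by simp
      finally show ?thesis using True unfolding wsum_def by simp
    qed
  qed
  \<comment> \<open>The volumes of the off-diagonal classes do not depend on \<open>e\<close>; in
    the recurrence they are constants.\<close>
  have lev: "avg e k l (?I b') = avg 1 k l (?I b')" if "b' \<in> carrier_mat k l" for k l b'
  proof (rule avg_level[OF _ e1])
    show "lc 1 k l (?I b')" by (rule lc_if_pdiv[OF lc_const order_refl that])
  qed
  have "wsum e S (Suc n) w (four_block_mat a0 b0 c0 d0) = avg e 1 1 (\<lambda>a. avg e 1 n (\<lambda>b. avg e n 1 (\<lambda>cc. avg e n n (\<lambda>d.
     if pdiv 1 (four_block_mat a b cc d - four_block_mat a0 b0 c0 d0) then wG e S (Suc n) w (four_block_mat a b cc d) else 0))))"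
    unfolding wsum_def using avg_blocks[of e 1 n 1 n] by simp
  also have "\<dots> = avg e 1 1 (\<lambda>a. avg e 1 n (\<lambda>b. avg e n 1 (\<lambda>cc. 
    (?I b0 b * ?I c0 cc * wsum e S n ?w d0) * (if pdiv 1 (a - a0) then gam e S a else 0))))"
    by (intro avg_cong inner)
  also have "\<dots> = phi e S a0 * (avg e 1 n (?I b0) * avg e n 1 (?I c0) * wsum e S n ?w d0)"
    unfolding avg_cmult_right avg_cmult phi_def by (simp only: mult_ac)
  finally show ?thesis unfolding lev[OF b0] lev[OF c0] .
qed

text \<open>On such a class the symmetrisation of \<open>y\<close> is divisible by p, so
  \<open>y\<close> can be replaced by p times a matrix ranging over everything. The factor p lowers
  the level, and the full Fourier integral at level e appears; the right-hand side is the same for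
  all classes of this kind.\<close>

lemma wsum_zero:
  fixes S :: "'p::prime_card padic_int mat"
  assumes odd: "odd CARD('p)" and S: "S \<in> carrier_mat m m" "transpose_mat S = S"
    and w: "lc 1 m n w" and e: "e \<ge> 1"
    and y0: "y0 \<in> carrier_mat n n" and z: "pdiv 1 (y0 + transpose_mat y0)"
  shows "wsum (Suc e) S n w y0 = (\<Sum>y\<in>RM 1 n n. wsum e S n w y) / of_nat CARD('p) ^ (n * n)"
proof -
  obtain v :: "'p padic_int" where v: "2 * v = 1" using padic_two_unit[OF odd] by (metis dvdE)
  obtain H where H: "H \<in> carrier_mat n n" "y0 + transpose_mat y0 = pp ^ 1 \<cdot>\<^sub>m H"
    using pdivE[OF z, of n n] y0 by auto
  \<comment> \<open>\<open>h\<close> is (y0 + y0^t) / (2 p): y0 + p y and p (y + h) have the same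
    symmetrisation.\<close>
  define h where "h = v \<cdot>\<^sub>m H"
  have h: "h \<in> carrier_mat n n" using H by (simp add: h_def)
  have Ht: "transpose_mat H = H"
  proof (rule eq_matI)
    fix i j assume "i < dim_row H" "j < dim_col H"
    then have ij: "i < n" "j < n" using H by auto
    have "(y0 + transpose_mat y0) $$ (i,j) = (y0 + transpose_mat y0) $$ (j,i)" using ij y0 by (simp add: add.commute)
    then have "pp * H $$ (i,j) = pp * H $$ (j,i)" unfolding H(2) using ij H(1) by simp
    then show "transpose_mat H $$ (i,j) = H $$ (i,j)" using pp_nz[where 'p='p] ij H(1) by simp
  qed (use H in auto)
  have key: "wG (Suc e) S n w (y0 + pp \<cdot>\<^sub>m y) = wG e S n w (y + h)" if y: "y \<in> carrier_mat n n" for y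
  proof -
    have yh: "y + h \<in> carrier_mat n n" using y h by simp
    have c: "y0 + pp \<cdot>\<^sub>m y \<in> carrier_mat n n" "pp \<cdot>\<^sub>m (y + h) \<in> carrier_mat n n" using y y0 h by auto
    have "y0 + pp \<cdot>\<^sub>m y + transpose_mat (y0 + pp \<cdot>\<^sub>m y) = pp \<cdot>\<^sub>m (y + h) + transpose_mat (pp \<cdot>\<^sub>m (y + h))"
    proof (rule eq_matI)
      fix i j assume "i < dim_row (pp \<cdot>\<^sub>m (y + h) + transpose_mat (pp \<cdot>\<^sub>m (y + h)))" "j < dim_col (pp \<cdot>\<^sub>m (y + h) + transpose_mat (pp \<cdot>\<^sub>m (y + h)))"
      then have ij: "i < n" "j < n" using y h by auto
      have 1: "y0 $$ (i,j) + y0 $$ (j,i) = pp * H $$ (i,j)"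
        using arg_cong[OF H(2), of "\<lambda>M. M $$ (i,j)"] ij y0 H(1) by simp
      have 2: "H $$ (j,i) = H $$ (i,j)" using arg_cong[OF Ht, of "\<lambda>M. M $$ (i,j)"] ij H(1) by simp
      have "pp * (v * H $$ (i,j)) + pp * (v * H $$ (i,j)) = (2 * v) * (pp * H $$ (i,j))" by (simp add: algebra_simps)
      then have "pp * (v * H $$ (i,j)) + pp * (v * H $$ (j,i)) = y0 $$ (i,j) + y0 $$ (j,i)"
        unfolding v 1 2 by simp
      then show "(y0 + pp \<cdot>\<^sub>m y + transpose_mat (y0 + pp \<cdot>\<^sub>m y)) $$ (i,j) = (pp \<cdot>\<^sub>m (y + h) + transpose_mat (pp \<cdot>\<^sub>m (y + h))) $$ (i,j)"
        using ij y y0 H(1) unfolding h_def by (simp add: algebra_simps)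
    qed (use y y0 h in auto)
    then have "wG (Suc e) S n w (y0 + pp \<cdot>\<^sub>m y) = wG (Suc e) S n w (pp \<cdot>\<^sub>m (y + h))" by (rule wG_sym[OF odd S c])
    also have "\<dots> = avg (Suc e) m n (\<lambda>X. w X * psi e (pr (y + h) (gram S X)))"
      unfolding wG_def using S yh by (simp, intro avg_cong) (simp add: pr_smult_left[OF yh] psi_pp)
    also have "\<dots> = wG e S n w (y + h)"
      unfolding wG_def using S by (subst avg_level[of e]) (auto intro!: lc_mult lc_psi_gram yh lc_mono[OF w e])
    finally show ?thesis .
  qed
  have "wsum (Suc e) S n w y0 = avg e n n (\<lambda>y. wG (Suc e) S n w (y0 + pp \<cdot>\<^sub>m y)) / of_nat CARD('p) ^ (n * n)"
    unfolding wsum_def by (rule avg_box[OF lc_wG[OF S(1)] y0])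
  also have "avg e n n (\<lambda>y. wG (Suc e) S n w (y0 + pp \<cdot>\<^sub>m y)) = avg e n n (\<lambda>y. wG e S n w (y + h))"
    by (intro avg_cong key)
  also have "\<dots> = avg e n n (wG e S n w)" by (rule avg_translate[OF lc_wG[OF S(1)] h])
  also have "\<dots> = (\<Sum>y\<in>RM 1 n n. wsum e S n w y)"
    unfolding wsum_def using avg_classes[of "e - 1" n n "wG e S n w"] lc_wG[OF S(1)] e by simp
  finally show ?thesis .
qed

lemma right_inv_cols:
  assumes w: "right_inv m (Suc n) w"
  shows "right_inv m n (\<lambda>X. w (0\<^sub>m m 1 @\<^sub>c X))"
  unfolding right_inv_def
proof (intro ballI allI impI)
  fix X V W :: "'a padic_int mat" assume X: "X \<in> carrier_mat m n" and V: "GLp n V W"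
  let ?V = "four_block_mat (1\<^sub>m 1) (0\<^sub>m 1 n) (0\<^sub>m n 1) V"
  have "GLp (Suc n) ?V (four_block_mat (1\<^sub>m 1) (0\<^sub>m 1 n) (0\<^sub>m n 1) W)"
    using GLp_block[OF GLp_one[of 1] V] by simp
  moreover have "(0\<^sub>m m 1 @\<^sub>c X) * ?V = 0\<^sub>m m 1 @\<^sub>c (X * V)"
    by (rule mult_cols) (use X V in \<open>auto simp: GLp_def\<close>)
  moreover have "0\<^sub>m m 1 @\<^sub>c X \<in> carrier_mat m (Suc n)" using carrier_append_cols[of "0\<^sub>m m 1" m 1 X n] X by simp
  ultimately show "w (0\<^sub>m m 1 @\<^sub>c (X * V)) = w (0\<^sub>m m 1 @\<^sub>c X)"
    using w unfolding right_inv_def by metis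
qed

lemma lc_cols:
  assumes w: "lc e m (Suc n) w"
  shows "lc e m n (\<lambda>X. w (0\<^sub>m m 1 @\<^sub>c X))"
proof (rule lcI)
  fix X Y :: "'a padic_int mat" assume XY: "X \<in> carrier_mat m n" "Y \<in> carrier_mat m n" "pdiv e (X - Y)"
  have c: "0\<^sub>m m 1 @\<^sub>c X \<in> carrier_mat m (Suc n)" "0\<^sub>m m 1 @\<^sub>c Y \<in> carrier_mat m (Suc n)"
    using carrier_append_cols[of "0\<^sub>m m 1" m 1 _ n] XY by auto
  have "pdiv e ((0\<^sub>m m 1 @\<^sub>c X) - (0\<^sub>m m 1 @\<^sub>c Y))"
    unfolding pdiv_def
  proof (intro allI impI)
    fix i j assume "i < dim_row ((0\<^sub>m m 1 @\<^sub>c X) - (0\<^sub>m m 1 @\<^sub>c Y))" "j < dim_col ((0\<^sub>m m 1 @\<^sub>c X) - (0\<^sub>m m 1 @\<^sub>c Y))"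
    then have ij: "i < m" "j < Suc n" using c by auto
    show "pp ^ e dvd ((0\<^sub>m m 1 @\<^sub>c X) - (0\<^sub>m m 1 @\<^sub>c Y)) $$ (i,j)"
      using ij XY c by (cases j) (auto simp: append_cols_def pdiv_def)
  qed
  then show "w (0\<^sub>m m 1 @\<^sub>c X) = w (0\<^sub>m m 1 @\<^sub>c Y)" by (rule lcD[OF w c])
qed

text \<open>Induction on \<open>n\<close>. If y0 + y0^t has a unit modulo p,
  \<open>wsum_block\<close> reduces to size n - 1 with a geometric factor. The remaining classes
  share one value g, and \<open>wsum_zero\<close> expresses g at level e + 1 through g and the
  classes already treated, all of size n, at level e.\<close>

theorem wsum_recurrence:
  fixes S :: "'p::prime_card padic_int mat"
  assumes odd: "odd CARD('p)" and S: "S \<in> carrier_mat m m" "transpose_mat S = S"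
    and Q: "Q \<in> carrier_mat m m" "Q * S = pp ^ c \<cdot>\<^sub>m 1\<^sub>m m"
  shows "right_inv m n w \<Longrightarrow> lc 1 m n w \<Longrightarrow> y0 \<in> carrier_mat n n \<Longrightarrow> \<exists>ls. ann ls (\<lambda>e. wsum e S n w y0)"
proof (induction n arbitrary: w y0)
  case 0
  have "wsum e S 0 w y0 = w (0\<^sub>m m 0)" for e
  proof -
    have "wG e S 0 w y = w (0\<^sub>m m 0)" for y
    proof -
      have "wG e S 0 w y = avg e m 0 (\<lambda>X :: 'p padic_int mat. w (0\<^sub>m m 0))"
        unfolding wG_def carrier_matD(1)[OF S(1)]
      proof (rule avg_cong)
        fix X :: "'p padic_int mat" assume X: "X \<in> carrier_mat m 0"
        then have "X = 0\<^sub>m m 0" by (intro eq_matI) auto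
        then show "w X * psi e (pr y (gram S X)) = w (0\<^sub>m m 0)" using X by (simp add: pr_def gram_def)
      qed
      then show ?thesis by simp
    qed
    then have "wsum e S 0 w y0 = avg e 0 0 (\<lambda>y :: 'p padic_int mat. w (0\<^sub>m m 0))"
      unfolding wsum_def using 0(3) by (intro avg_cong) (auto simp: pdiv_def)
    then show ?thesis by simp
  qed
  then have "ann [1] (\<lambda>e. wsum e S 0 w y0)" by simp
  then show ?case by blast
next
  case (Suc n)
  have nonzero: "\<exists>ls. ann ls (\<lambda>e. wsum e S (Suc n) w y)" if y: "y \<in> carrier_mat (Suc n) (Suc n)"
    and nz: "\<not> pdiv 1 (y + transpose_mat y)" for y
  proof -
    have sym: "transpose_mat (y + transpose_mat y) = y + transpose_mat y"
      using y by (intro eq_matI) (auto simp: add.commute)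
    have yy: "y + transpose_mat y \<in> carrier_mat (Suc n) (Suc n)" using y by simp
    obtain V W a D where V: "GLp (Suc n) V W" and a: "a \<in> carrier_mat 1 1" "a $$ (0,0) dvd 1"
      and D: "D \<in> carrier_mat n n" "transpose_mat D = D" 
      and VD: "conj_mat V (y + transpose_mat y) = four_block_mat a (0\<^sub>m 1 n) (0\<^sub>m n 1) D"
      using symmetric_split_unit[OF odd yy sym nz] by blast
    have cV: "V \<in> carrier_mat (Suc n) (Suc n)" using V by (simp add: GLp_def)
    \<comment> \<open>The base change that splits y + y^t is applied to \<open>y\<close> itself. The
      off-diagonal blocks of \<open>z\<close> need not vanish, only their symmetrisation does, and
      this is what \<open>wsum_block\<close> asks for.\<close>
    define z where "z = conj_mat V y"
    have z: "z \<in> carrier_mat (Suc n) (Suc n)" using cV y by (simp add: z_def)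
    have zz: "z + transpose_mat z = four_block_mat a (0\<^sub>m 1 n) (0\<^sub>m n 1) D"
      unfolding VD[symmetric] z_def using cV y by (simp add: conj_mat_transpose[of _ "Suc n"] conj_mat_add[of _ "Suc n"])
    define a0 b0 c0 d0 where "a0 = mat 1 1 (\<lambda>(i,j). z $$ (i,j))" and "b0 = mat 1 n (\<lambda>(i,j). z $$ (i,Suc j))"
      and "c0 = mat n 1 (\<lambda>(i,j). z $$ (Suc i,j))" and "d0 = mat n n (\<lambda>(i,j). z $$ (Suc i,Suc j))"
    have car: "a0 \<in> carrier_mat 1 1" "b0 \<in> carrier_mat 1 n" "c0 \<in> carrier_mat n 1" "d0 \<in> carrier_mat n n"
      by (auto simp: a0_def b0_def c0_def d0_def)
    have zb: "z = four_block_mat a0 b0 c0 d0"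
      using z by (intro eq_matI) (auto simp: a0_def b0_def c0_def d0_def)
    have "2 * a0 $$ (0,0) = a $$ (0,0)"
      using arg_cong[OF zz, of "\<lambda>M. M $$ (0,0)"] z a(1) by (simp add: a0_def)
    then have u: "a0 $$ (0,0) dvd 1" using a(2) by (metis dvd_mult_right)
    have "b0 + transpose_mat c0 = 0\<^sub>m 1 n"
    proof (rule eq_matI)
      fix i j assume "i < dim_row (0\<^sub>m 1 n :: 'p padic_int mat)" "j < dim_col (0\<^sub>m 1 n :: 'p padic_int mat)"
      then have ij: "i = 0" "j < n" by auto
      then show "(b0 + transpose_mat c0) $$ (i,j) = 0\<^sub>m 1 n $$ (i,j)"
        using arg_cong[OF zz, of "\<lambda>M. M $$ (0,Suc j)"] z a(1) D(1) by (simp add: b0_def c0_def)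
    qed (auto simp: b0_def c0_def)
    then have bc: "pdiv 1 (b0 + transpose_mat c0)" by simp
    let ?w = "\<lambda>X. w (0\<^sub>m m 1 @\<^sub>c X)"
    obtain ls where ls: "ann ls (\<lambda>e. wsum e S n ?w d0)"
      using Suc.IH[OF right_inv_cols[OF Suc.prems(1)] lc_cols[OF Suc.prems(2)] car(4)] by blast
    let ?\<kappa> = "avg 1 1 n (\<lambda>b. if pdiv 1 (b - b0) then 1 else 0) * avg 1 n 1 (\<lambda>b. if pdiv 1 (b - c0) then 1 else 0)"
    have "ann (map ((*) (1 / of_nat CARD('p) ^ m)) ls) (\<lambda>e. phi e S a0 * (?\<kappa> * wsum e S n ?w d0))"
      by (rule ann_geometric[of "2 * c + 4", OF _ ann_cmult[OF ls]]) (rule phi_step[OF odd S Q car(1) u])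
    then have "ann (map ((*) (1 / of_nat CARD('p) ^ m)) ls) (\<lambda>e. wsum e S (Suc n) w y)"
    proof (rule ann_cong)
      fix e assume e: "2 * c + 4 \<le> e"
      then have "wsum e S (Suc n) w y = wsum e S (Suc n) w z"
        unfolding z_def using wsum_conj[OF S(1) y V Suc.prems(1,2)] by simp
      then show "phi e S a0 * (?\<kappa> * wsum e S n ?w d0) = wsum e S (Suc n) w y"
        unfolding zb using wsum_block[OF odd S Q Suc.prems(1,2) e car(1) u car(2-4) bc] by simp
    qed
    then show ?thesis by blast
  qed
  show ?case
  proof (cases "pdiv 1 (y0 + transpose_mat y0)")
    case False
    then show ?thesis using nonzero Suc.prems(3) by blast
  next
    case True
    \<comment> \<open>\<open>Z\<close> holds the classes with symmetrisation 0 modulo p,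
      \<open>s\<close> sums the others, and \<theta> is the volume p^(-n^2) of a class, with
      \<open>Suc n\<close> in place of n.\<close>
    define Z where "Z = {y \<in> RM 1 (Suc n) (Suc n) :: 'p padic_int mat set. pdiv 1 (y + transpose_mat y)}"
    define N where "N = RM 1 (Suc n) (Suc n) - Z"
    define \<nu> where "\<nu> = card Z"
    define s where "s e = (\<Sum>y\<in>N. wsum e S (Suc n) w y)" for e
    define \<theta> :: complex where "\<theta> = 1 / of_nat CARD('p) ^ (Suc n * Suc n)"
    define g where "g e = wsum e S (Suc n) w y0" for e
    have fin: "finite Z" "finite N" by (auto simp: Z_def N_def)
    obtain ls where ls: "ann ls s" unfolding s_def
      using ann_sum[OF fin(2), of "\<lambda>y e. wsum e S (Suc n) w y"] nonzero by (force simp: N_def Z_def RM_carrier)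
    have all: "wsum (Suc e) S (Suc n) w y = g (Suc e)" if "e \<ge> 1" "y \<in> Z" for e y
    proof -
      have y: "y \<in> carrier_mat (Suc n) (Suc n)" "pdiv 1 (y + transpose_mat y)"
        using that(2) by (auto simp: Z_def RM_carrier)
      show ?thesis
        unfolding g_def wsum_zero[OF odd S Suc.prems(2) that(1) y] wsum_zero[OF odd S Suc.prems(2) that(1) Suc.prems(3) True] ..
    qed
    \<comment> \<open>The classes in \<open>Z\<close> agree only at levels from 2 on, being computed
      from the level below, which must be at least 1; hence the bound on \<open>e\<close>.\<close>
    have rec: "g (Suc e) = \<theta> * (of_nat \<nu> * g e + s e)" if e: "e \<ge> 2" for e
    proof -
      obtain e' where e': "e = Suc e'" "e' \<ge> 1" using e by (cases e) auto
      have "RM 1 (Suc n) (Suc n) = Z \<union> N" "Z \<inter> N = {}" by (auto simp: Z_def N_def)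
      then have "(\<Sum>y\<in>RM 1 (Suc n) (Suc n). wsum e S (Suc n) w y) = (\<Sum>y\<in>Z. wsum e S (Suc n) w y) + s e"
        unfolding s_def using fin by (simp add: sum.union_disjoint)
      also have "(\<Sum>y\<in>Z. wsum e S (Suc n) w y) = of_nat \<nu> * g e"
        unfolding e'(1) using all[OF e'(2)] by (simp add: \<nu>_def)
      finally show ?thesis
        unfolding g_def[of "Suc e"] using wsum_zero[OF odd S Suc.prems(2) _ Suc.prems(3) True, of e] e
        by (simp add: \<theta>_def)
    qed
    \<comment> \<open>Iterating the first-order recursion twice turns it into step two: its root
      \<theta>\<nu> gets squared, and \<open>s\<close> enters through a combination of
      \<open>s\<close> and its shift.\<close>
    define \<mu> :: rat where "\<mu> = (1 / of_nat CARD('p) ^ (Suc n * Suc n))\<^sup>2 * (of_nat \<nu>)\<^sup>2"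
    have mu: "of_rat \<mu> = \<theta>\<^sup>2 * (of_nat \<nu>)\<^sup>2"
      by (simp add: \<mu>_def \<theta>_def of_rat_mult of_rat_divide of_rat_power)
    have "ann ls (\<lambda>e. \<theta>\<^sup>2 * of_nat \<nu> * s e + \<theta> * s (e + 1))"
      by (intro ann_add ann_cmult ann_shift ls)
    then have "ann ls (\<lambda>e. g (e + 2) - of_rat \<mu> * g e)"
    proof (rule ann_cong)
      fix e :: nat assume e: "2 \<le> e"
      have "g (e + 2) = \<theta> * (of_nat \<nu> * (\<theta> * (of_nat \<nu> * g e + s e)) + s (e + 1))"
        using rec[of "Suc e"] rec[OF e] e by simp
      then show "\<theta>\<^sup>2 * of_nat \<nu> * s e + \<theta> * s (e + 1) = g (e + 2) - of_rat \<mu> * g e"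
        unfolding mu by (simp add: algebra_simps power2_eq_square)
    qed
    then have "ann (\<mu> # ls) g" by simp
    then show ?thesis unfolding g_def by blast
  qed
qed

section \<open>The recurrence for representation counts\<close>

lemma mult_rows:
  fixes A :: "'a::semiring_1 mat"
  assumes "A \<in> carrier_mat m1 n" "B \<in> carrier_mat m2 n" "G \<in> carrier_mat n k"
  shows "(A @\<^sub>r B) * G = (A * G) @\<^sub>r (B * G)"
proof -
  have G: "G = four_block_mat G (0\<^sub>m n 0) (0\<^sub>m 0 k) (0\<^sub>m 0 0)" using assms by (intro eq_matI) auto
  have "(A @\<^sub>r B) * four_block_mat G (0\<^sub>m n 0) (0\<^sub>m 0 k) (0\<^sub>m 0 0) = (A * G) @\<^sub>r (B * G)"
    unfolding append_rows_def using assms by (subst mult_four_block_mat[of _ m1 n _ 0 _ m2]) auto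
  then show ?thesis by (simp flip: G)
qed

lemma pdiv_rows:
  assumes "A \<in> carrier_mat m1 n" "B \<in> carrier_mat m2 n" "A' \<in> carrier_mat m1 n" "B' \<in> carrier_mat m2 n"
    "pdiv e (A - A')" "pdiv e (B - B')"
  shows "pdiv e ((A @\<^sub>r B) - (A' @\<^sub>r B'))"
  using assms unfolding pdiv_def append_rows_def by auto

text \<open>Fourier inversion of the condition S[X] = 0 modulo p^e, with the Fourier integral cut
  into the classes modulo p.\<close>

lemma weighted_zero_recurrence_nondegenerate:
  fixes S :: "'p::prime_card padic_int mat"
  assumes odd: "odd CARD('p)" and S: "S \<in> carrier_mat m m" "transpose_mat S = S"
    and Q: "Q \<in> carrier_mat m m" "Q * S = pp ^ c \<cdot>\<^sub>m 1\<^sub>m m" and w: "right_inv m n w" "lc 1 m n w"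
  shows "\<exists>ls. ann ls (\<lambda>e. avg e m n (\<lambda>X. w X * (if pdiv e (gram S X) then 1 else 0)))"
proof -
  obtain ls where ls: "ann ls (\<lambda>e. \<Sum>y\<in>RM 1 n n. wsum e S n w y)"
    using ann_sum[of "RM 1 n n" "\<lambda>y e. wsum e S n w y"] wsum_recurrence[OF odd S Q w] RM_carrier by fastforce
  have "ann ls (\<lambda>e. avg e m n (\<lambda>X. w X * (if pdiv e (gram S X) then 1 else 0)))"
  proof (rule ann_cong[OF ls])
    fix e :: nat assume e: "e \<ge> 1"
    have "avg e m n (\<lambda>X. w X * (if pdiv e (gram S X) then 1 else 0)) = avg e m n (\<lambda>X. avg e n n (\<lambda>y. w X * psi e (pr y (gram S X))))"
      using S by (intro avg_cong) (simp add: avg_cmult avg_psi)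
    also have "\<dots> = avg e n n (wG e S n w)"
      unfolding wG_def carrier_matD(1)[OF S(1)] by (rule avg_swap)
    also have "\<dots> = (\<Sum>y\<in>RM 1 n n. wsum e S n w y)"
      unfolding wsum_def using avg_classes[of "e - 1" n n "wG e S n w"] lc_wG[OF S(1)] e by simp
    finally show "(\<Sum>y\<in>RM 1 n n. wsum e S n w y) = avg e m n (\<lambda>X. w X * (if pdiv e (gram S X) then 1 else 0))" ..
  qed
  then show ?thesis by blast
qed

text \<open>In normal form the coordinates \<open>B\<close> along the radical do not enter the Gram
  matrix, so they are averaged out of the weight. The new weight \<open>w1\<close> is still
  GL_n-invariant, because B -> B G preserves averages, and still of level 1.\<close>

lemma weighted_zero_recurrence:
  fixes S :: "'p::prime_card padic_int mat"
  assumes odd: "odd CARD('p)" and S: "S \<in> carrier_mat m m" "transpose_mat S = S" and w: "right_inv m n w" "lc 1 m n w"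
  shows "\<exists>ls. ann ls (\<lambda>e. avg e m n (\<lambda>X. w X * (if pdiv e (gram S X) then 1 else 0)))"
proof -
  obtain s r V W S1 Q c where nf: "m = s + r" "GLp m V W" "S1 \<in> carrier_mat s s" "transpose_mat S1 = S1" "Q \<in> carrier_mat s s"
      "Q * S1 = pp ^ c \<cdot>\<^sub>m 1\<^sub>m s" "conj_mat V S = four_block_mat S1 (0\<^sub>m s r) (0\<^sub>m r s) (0\<^sub>m r r)"
    using symmetric_normal_form[OF odd S] by blast
  let ?D = "four_block_mat S1 (0\<^sub>m s r) (0\<^sub>m r s) (0\<^sub>m r r)"
  let ?V = "transpose_mat V" and ?W = "transpose_mat W"
  have D: "?D \<in> carrier_mat m m" using nf by simp
  have cV: "V \<in> carrier_mat m m" "W \<in> carrier_mat m m" using nf(2) by (auto simp: GLp_def)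
  have SD: "gram S X = gram ?D (?W * X)" if X: "X \<in> carrier_mat m n" for X
  proof -
    have "S = conj_mat W ?D" using conj_mat_inv[OF nf(2) S(1)] nf(7) by simp
    also have "\<dots> = gram ?D ?W" by (simp add: conj_mat_def gram_def)
    finally have "S = gram ?D ?W" .
    then show ?thesis using gram_gram[OF D, of ?W m X n] cV X by simp
  qed
  have VW: "?V * (?W * X) = X" if X: "X \<in> carrier_mat m n" for X
  proof -
    have "?V * (?W * X) = (?V * ?W) * X" using cV X by (simp add: mult_assoc_dim)
    also have "?V * ?W = 1\<^sub>m m" using nf(2) cV transpose_mult_dim[of W V] by (simp add: GLp_def)
    finally show ?thesis using X by simp
  qed
  define w1 where "w1 A = avg 1 r n (\<lambda>B. w (?V * (A @\<^sub>r B)))" for A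
  have AB: "?V * (A @\<^sub>r B) \<in> carrier_mat m n" "A @\<^sub>r B \<in> carrier_mat m n"
    if "A \<in> carrier_mat s n" "B \<in> carrier_mat r n" for A B :: "'p padic_int mat"
    using that cV nf(1) carrier_append_rows[of A s n B r] by auto
  have wAB: "w (?V * (A @\<^sub>r B)) = w (?V * (A' @\<^sub>r B'))"
    if c: "A \<in> carrier_mat s n" "B \<in> carrier_mat r n" "A' \<in> carrier_mat s n" "B' \<in> carrier_mat r n"
      and p: "pdiv 1 (A - A')" "pdiv 1 (B - B')" for A B A' B'
  proof (rule lcD[OF w(2) AB(1)[OF c(1,2)] AB(1)[OF c(3,4)]])
    have "?V * (A @\<^sub>r B) - ?V * (A' @\<^sub>r B') = ?V * ((A @\<^sub>r B) - (A' @\<^sub>r B'))"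
      using AB(2)[OF c(1,2)] AB(2)[OF c(3,4)] cV by (subst mult_minus_distrib_mat[of _ m m]) auto
    then show "pdiv 1 (?V * (A @\<^sub>r B) - ?V * (A' @\<^sub>r B'))"
      using pdiv_mult_right[of ?V m m _ n, OF _ _ pdiv_rows[OF c p]] AB(2)[OF c(1,2)] AB(2)[OF c(3,4)] cV by simp
  qed
  have zero: "pdiv 1 (B - B)" for B :: "'p padic_int mat" by (simp add: pdiv_def)
  have lcB: "lc 1 r n (\<lambda>B. w (?V * (A @\<^sub>r B)))" if "A \<in> carrier_mat s n" for A
    by (rule lcI) (rule wAB[OF that _ that _ zero])
  have "lc 1 s n w1"
    unfolding w1_def by (intro lcI avg_cong wAB zero)
  moreover have "right_inv s n w1" unfolding right_inv_def
  proof (intro ballI allI impI)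
    fix A G G' :: "'p padic_int mat" assume A: "A \<in> carrier_mat s n" and G: "GLp n G G'"
    have cG: "G \<in> carrier_mat n n" "G' \<in> carrier_mat n n" "G * G' = 1\<^sub>m n" "G' * G = 1\<^sub>m n" using G by (auto simp: GLp_def)
    have "w1 (A * G) = avg 1 r n (\<lambda>B. w (?V * ((A * G) @\<^sub>r (B * G))))"
      unfolding w1_def using A cG by (intro avg_mult_right[symmetric, OF lcB]) auto
    also have "\<dots> = avg 1 r n (\<lambda>B. w (?V * (A @\<^sub>r B)))"
    proof (rule avg_cong)
      fix B :: "'p padic_int mat" assume B: "B \<in> carrier_mat r n"
      have "?V * ((A * G) @\<^sub>r (B * G)) = ?V * (A @\<^sub>r B) * G"
        unfolding mult_rows[OF A B cG(1), symmetric] using AB[OF A B] cV cG by (simp add: mult_assoc_dim)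
      then show "w (?V * ((A * G) @\<^sub>r (B * G))) = w (?V * (A @\<^sub>r B))"
        using w(1) AB(1)[OF A B] G unfolding right_inv_def by metis
    qed
    finally show "w1 (A * G) = w1 A" by (simp add: w1_def)
  qed
  ultimately obtain ls where ls: "ann ls (\<lambda>e. avg e s n (\<lambda>X. w1 X * (if pdiv e (gram S1 X) then 1 else 0)))"
    using weighted_zero_recurrence_nondegenerate[OF odd nf(3-6)] by blast
  have "ann ls (\<lambda>e. avg e m n (\<lambda>X. w X * (if pdiv e (gram S X) then 1 else 0)))"
  proof (rule ann_cong[OF ls])
    fix e :: nat assume e: "e \<ge> 1"
    let ?F = "\<lambda>X. w (?V * X) * (if pdiv e (gram ?D X) then 1 else 0)"
    have lcF: "lc e m n ?F"
    proof (intro lc_mult lcI)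
      fix X Y :: "'p padic_int mat" assume XY: "X \<in> carrier_mat m n" "Y \<in> carrier_mat m n" "pdiv e (X - Y)"
      have "?V * X - ?V * Y = ?V * (X - Y)" using XY cV by (subst mult_minus_distrib_mat[of _ m m]) auto
      moreover have "pdiv e (?V * (X - Y))" using XY cV by (intro pdiv_mult_right[of ?V m m _ n]) auto
      ultimately show "w (?V * X) = w (?V * Y)"
        using XY cV by (intro lcD[OF lc_mono[OF w(2) e]]) auto
      have "pdiv e (gram ?D X) \<longleftrightarrow> pdiv e (gram ?D Y)"
        using gram_cong[OF D XY] gram_carrier[OF D XY(1)] gram_carrier[OF D XY(2)] by (rule pdiv_diff_iff[rotated 2])
      then show "(if pdiv e (gram ?D X) then 1 else 0 :: complex) = (if pdiv e (gram ?D Y) then 1 else 0)" by (simp only:)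
    qed
    have "avg e m n (\<lambda>X. w X * (if pdiv e (gram S X) then 1 else 0)) = avg e m n (\<lambda>X. ?F (?W * X))"
      using SD VW by (intro avg_cong) simp
    also have "\<dots> = avg e m n ?F"
      using avg_mult_left[OF lcF, of ?W ?V] GLp_transpose[OF nf(2)] by (simp add: GLp_def)
    also have "\<dots> = avg e s n (\<lambda>A. avg e r n (\<lambda>B. w (?V * (A @\<^sub>r B)) * (if pdiv e (gram S1 A) then 1 else 0)))"
      unfolding nf(1) avg_rows
    proof (intro avg_cong)
      fix A B :: "'p padic_int mat" assume A: "A \<in> carrier_mat s n" and B: "B \<in> carrier_mat r n"
      have "gram ?D (A @\<^sub>r B) = gram S1 A + gram (0\<^sub>m r r) B" by (rule gram_rows[OF nf(3) _ A B]) simp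
      also have "gram (0\<^sub>m r r) B = 0\<^sub>m n n" using B by (simp add: gram_def)
      also have "gram S1 A + 0\<^sub>m n n = gram S1 A" using nf(3) A by simp
      finally show "?F (A @\<^sub>r B) = w (?V * (A @\<^sub>r B)) * (if pdiv e (gram S1 A) then 1 else 0)" by simp
    qed
    also have "\<dots> = avg e s n (\<lambda>A. w1 A * (if pdiv e (gram S1 A) then 1 else 0))"
      unfolding avg_cmult_right w1_def using avg_level[OF lcB e] by (intro avg_cong) simp
    finally show "avg e s n (\<lambda>A. w1 A * (if pdiv e (gram S1 A) then 1 else 0)) = avg e m n (\<lambda>X. w X * (if pdiv e (gram S X) then 1 else 0))" ..
  qed
  then show ?thesis by blast
qed

section \<open>Invertibility modulo p and invariance of representation volumes\<close>

lemma prod_cong_dvd: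
  fixes f g :: "'a \<Rightarrow> 'b::comm_ring_1"
  assumes "finite I" "\<And>i. i \<in> I \<Longrightarrow> d dvd f i - g i"
  shows "d dvd prod f I - prod g I"
  using assms
proof (induction I rule: finite_induct)
  case (insert i I)
  have "prod f (insert i I) - prod g (insert i I) = f i * (prod f I - prod g I) + (f i - g i) * prod g I"
    using insert.hyps by (simp add: algebra_simps)
  then show ?case using insert by simp
qed simp

lemma det_cong_dvd:
  assumes X: "X \<in> carrier_mat n n" and Y: "Y \<in> carrier_mat n n" and p: "pdiv e (X - Y)"
  shows "pp ^ e dvd det X - det Y"
proof -
  have "pp ^ e dvd (\<Prod>i = 0..<n. X $$ (i, \<sigma> i)) - (\<Prod>i = 0..<n. Y $$ (i, \<sigma> i))" if "\<sigma> permutes {0..<n}" for \<sigma>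
  proof (rule prod_cong_dvd)
    fix i assume i: "i \<in> {0..<n}"
    then have "\<sigma> i < n" using permutes_in_image[OF that, of i] by simp
    then show "pp ^ e dvd X $$ (i, \<sigma> i) - Y $$ (i, \<sigma> i)" using p X Y i by (simp add: pdiv_def)
  qed simp
  then show ?thesis
    unfolding det_def'[OF X] det_def'[OF Y] sum_subtractf[symmetric] right_diff_distrib[symmetric]
    by (intro dvd_sum) auto
qed

text \<open>Cramer's rule: the inverse is the adjugate divided by the determinant.\<close>

lemma GLp_of_det_unit:
  assumes Z: "Z \<in> carrier_mat n n" and u: "det Z dvd (1 :: 'a::comm_ring_1)"
  shows "\<exists>W. GLp n Z W"
proof -
  obtain v where v: "1 = det Z * v" using u by (rule dvdE)
  let ?W = "v \<cdot>\<^sub>m adj_mat Z"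
  have a: "adj_mat Z \<in> carrier_mat n n" "Z * adj_mat Z = det Z \<cdot>\<^sub>m 1\<^sub>m n" "adj_mat Z * Z = det Z \<cdot>\<^sub>m 1\<^sub>m n"
    using adj_mat[OF Z] by auto
  have 1: "v \<cdot>\<^sub>m (det Z \<cdot>\<^sub>m 1\<^sub>m n) = 1\<^sub>m n"
    using v by (intro eq_matI) (auto simp: mult.commute)
  have "Z * ?W = 1\<^sub>m n" using mult_smult_distrib[OF Z a(1), of v] a(2) 1 by simp
  moreover have "?W * Z = 1\<^sub>m n" using mult_smult_assoc_mat[OF a(1) Z, of v] a(3) 1 by simp
  ultimately show ?thesis using Z a by (intro exI[of _ ?W]) (auto simp: GLp_def)
qed

lemma det_unit_of_GLp: "GLp n Z W \<Longrightarrow> det Z dvd (1 :: 'a::comm_ring_1)"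
  using det_mult[of Z n W] by (metis GLp_def det_one dvd_triv_left)

lemma lc_vol_integrand:
  assumes S: "S \<in> carrier_mat m m" and T: "T \<in> carrier_mat n n"
  shows "lc e m n (\<lambda>X. if pdiv e (gram S X - T) then 1 else 0)"
proof (rule lcI)
  fix X Y :: "'a padic_int mat" assume XY: "X \<in> carrier_mat m n" "Y \<in> carrier_mat m n" "pdiv e (X - Y)"
  have "gram S X - T - (gram S Y - T) = gram S X - gram S Y"
    using gram_carrier[OF S XY(1)] gram_carrier[OF S XY(2)] T by (intro eq_matI) auto
  then have "pdiv e (gram S X - T) \<longleftrightarrow> pdiv e (gram S Y - T)"
    using gram_cong[OF S XY] XY T by (intro pdiv_diff_iff[of _ n n]) auto
  then show "(if pdiv e (gram S X - T) then 1 else 0 :: complex) = (if pdiv e (gram S Y - T) then 1 else 0)"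
    by (simp only:)
qed

lemma vol_cong:
  assumes S: "S \<in> carrier_mat m m" and T: "T \<in> carrier_mat n n" "T' \<in> carrier_mat n n" and p: "pdiv e (T - T')"
  shows "vol e S T = vol e S T'"
  unfolding vol_def carrier_matD(1)[OF S] carrier_matD(1)[OF T(1)] carrier_matD(1)[OF T(2)]
proof (rule avg_cong)
  fix X :: "'a padic_int mat" assume X: "X \<in> carrier_mat m n"
  have "gram S X - T' - (gram S X - T) = T - T'"
    using gram_carrier[OF S X] T by (intro eq_matI) auto
  then have "pdiv e (gram S X - T') \<longleftrightarrow> pdiv e (gram S X - T)"
    using p X T by (intro pdiv_diff_iff[of _ n n]) auto
  then show "(if pdiv e (gram S X - T) then 1 else 0 :: complex) = (if pdiv e (gram S X - T') then 1 else 0)"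
    by (simp only:)
qed

text \<open>The substitution X -> X Z turns S[X] - T[Z] into the congruence transform by Z^t of S[X]
  - T, which has the same divisibility.\<close>

lemma vol_gram:
  assumes S: "S \<in> carrier_mat m m" and T: "T \<in> carrier_mat n n" and W: "GLp n Z W"
  shows "vol e S (gram T Z) = vol e S T"
proof -
  have Z: "Z \<in> carrier_mat n n" using W by (simp add: GLp_def)
  let ?f = "\<lambda>X. if pdiv e (gram S X - gram T Z) then 1 else 0 :: complex"
  have lcf: "lc e m n ?f" by (rule lc_vol_integrand) (use S T Z in auto)
  have "avg e m n ?f = avg e m n (\<lambda>X. ?f (X * Z))"
    using avg_mult_right[OF lcf, of Z W] W by (simp add: GLp_def)
  also have "\<dots> = avg e m n (\<lambda>X. if pdiv e (gram S X - T) then 1 else 0)"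
  proof (rule avg_cong)
    fix X :: "'a padic_int mat" assume X: "X \<in> carrier_mat m n"
    have g: "gram S X \<in> carrier_mat n n" using S X by simp
    have "gram S (X * Z) - gram T Z = conj_mat (transpose_mat Z) (gram S X) - conj_mat (transpose_mat Z) T"
      using gram_mult[OF S X Z] by (simp add: conj_mat_def gram_def)
    also have "\<dots> = conj_mat (transpose_mat Z) (gram S X - T)"
      by (rule conj_mat_diff[symmetric]) (use Z g T in auto)
    finally have "pdiv e (gram S (X * Z) - gram T Z) \<longleftrightarrow> pdiv e (gram S X - T)"
      using pdiv_conj_iff[OF GLp_transpose[OF W], of "gram S X - T" e] T by simp
    then show "?f (X * Z) = (if pdiv e (gram S X - T) then 1 else 0)" by (simp only:)
  qed
  finally show ?thesis unfolding vol_def using S T carrier_matD(1)[OF gram_carrier[OF T Z]] by simp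
qed

text \<open>
  \<open>S[X] \<equiv> T[Z]\<close> with \<open>Z\<close> invertible has as many solutions \<open>X\<close> for every \<open>Z\<close>, so averaging over
  \<open>Z \<in> GL\<^sub>n\<close> turns the representations of \<open>T\<close> by \<open>S\<close> into isotropic matrices for \<open>S \<perp> -T\<close>.
\<close>

theorem vol_recurrence:
  fixes S T :: "'p::prime_card padic_int mat"
  assumes odd: "odd CARD('p)" and S: "S \<in> carrier_mat m m" "transpose_mat S = S"
    and T: "T \<in> carrier_mat n n" "transpose_mat T = T"
  shows "\<exists>ls. ann ls (\<lambda>e. vol e S T)"
proof -
  define bot where "bot X = mat n n (\<lambda>(i,j). X $$ (i + m, j))" for X :: "'p padic_int mat"
  \<comment> \<open>The weight is the indicator of GL_n on the bottom block. It has level 1 because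
    being a unit is decided modulo p, and it is invariant because det is multiplicative.\<close>
  define u where "u Z = (if det Z dvd 1 then 1 else 0 :: complex)" for Z :: "'p padic_int mat"
  let ?w = "\<lambda>X. u (bot X)"
  let ?S = "four_block_mat S (0\<^sub>m m n) (0\<^sub>m n m) (- T)"
  have lcu: "lc 1 n n u"
  proof (rule lcI)
    fix X Y :: "'p padic_int mat" assume "X \<in> carrier_mat n n" "Y \<in> carrier_mat n n" "pdiv 1 (X - Y)"
    then have "pp dvd det X - det Y" using det_cong_dvd[of X n Y 1] by simp
    then have "det X dvd 1 \<longleftrightarrow> det Y dvd 1" unfolding padic_unit_iff by (metis dvd_diff_left_iff dvd_diff_right_iff)
    then show "u X = u Y" unfolding u_def by (simp only:)
  qed
  have lcw: "lc 1 (m + n) n ?w"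
  proof (rule lcI)
    fix X Y :: "'p padic_int mat" assume "X \<in> carrier_mat (m + n) n" "Y \<in> carrier_mat (m + n) n" "pdiv 1 (X - Y)"
    then show "u (bot X) = u (bot Y)" by (intro lcD[OF lcu]) (auto simp: bot_def pdiv_def)
  qed
  have inv: "right_inv (m + n) n ?w" unfolding right_inv_def
  proof (intro ballI allI impI)
    fix X V W :: "'p padic_int mat" assume X: "X \<in> carrier_mat (m + n) n" and V: "GLp n V W"
    have c: "V \<in> carrier_mat n n" using V by (simp add: GLp_def)
    have "bot (X * V) = bot X * V" using X c by (intro eq_matI) (auto simp: bot_def scalar_prod_def)
    then have "det (bot (X * V)) = det (bot X) * det V" using det_mult[of "bot X" n V] c by (simp add: bot_def)
    then have "det (bot (X * V)) dvd 1 \<longleftrightarrow> det (bot X) dvd 1"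
      using det_unit_of_GLp[OF V] by (metis dvd_mult_left is_unit_mult_iff)
    then show "u (bot (X * V)) = u (bot X)" unfolding u_def by (simp only:)
  qed
  have cS: "?S \<in> carrier_mat (m + n) (m + n)" using S T by simp
  have "transpose_mat (- T) = - T"
  proof -
    have "transpose_mat (- T) = - transpose_mat T" by (intro eq_matI) auto
    then show ?thesis using T(2) by simp
  qed
  then have sS: "transpose_mat ?S = ?S"
    using S T by (subst transpose_four_block_mat[of _ m m _ n _ n]) auto
  obtain ls where ls: "ann ls (\<lambda>e. avg e (m + n) n (\<lambda>X. ?w X * (if pdiv e (gram ?S X) then 1 else 0)))"
    using weighted_zero_recurrence[OF odd cS sS inv lcw] by blast
  define \<kappa> where "\<kappa> = avg 1 n n u"
  have eq: "avg e (m + n) n (\<lambda>X. ?w X * (if pdiv e (gram ?S X) then 1 else 0)) = \<kappa> * vol e S T" if e: "e \<ge> 1" for e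
  proof -
    have "avg e (m + n) n (\<lambda>X. ?w X * (if pdiv e (gram ?S X) then 1 else 0)) =
      avg e m n (\<lambda>X. avg e n n (\<lambda>Z. u Z * (if pdiv e (gram S X - gram T Z) then 1 else 0)))"
      unfolding avg_rows
    proof (intro avg_cong)
      fix X Z :: "'p padic_int mat" assume X: "X \<in> carrier_mat m n" and Z: "Z \<in> carrier_mat n n"
      have "bot (X @\<^sub>r Z) = Z" using X Z by (intro eq_matI) (auto simp: bot_def append_rows_def)
      moreover have "gram ?S (X @\<^sub>r Z) = gram S X - gram T Z"
      proof -
        have "gram (- T) Z = - gram T Z" using T Z by (simp add: gram_def)
        then show ?thesis using gram_rows[OF S(1) _ X Z, of "- T"] T S X Z by (simp add: add_uminus_minus_mat[of _ n n])
      qed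
      ultimately show "u (bot (X @\<^sub>r Z)) * (if pdiv e (gram ?S (X @\<^sub>r Z)) then 1 else 0) = u Z * (if pdiv e (gram S X - gram T Z) then 1 else 0)"
        by simp
    qed
    also have "\<dots> = avg e n n (\<lambda>Z. u Z * avg e m n (\<lambda>X. if pdiv e (gram S X - gram T Z) then 1 else 0))"
      by (subst avg_swap) (simp only: avg_cmult)
    also have "\<dots> = avg e n n (\<lambda>Z. u Z * vol e S T)"
    proof (rule avg_cong)
      fix Z :: "'p padic_int mat" assume Z: "Z \<in> carrier_mat n n"
      show "u Z * avg e m n (\<lambda>X. if pdiv e (gram S X - gram T Z) then 1 else 0) = u Z * vol e S T"
      proof (cases "det Z dvd 1")
        case True
        obtain W where W: "GLp n Z W" using GLp_of_det_unit[OF Z True] by blast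
        show ?thesis using vol_gram[OF S(1) T(1) W, of e] S T carrier_matD(1)[OF gram_carrier[OF T(1) Z]]
          by (simp add: vol_def)
      qed (simp add: u_def)
    qed
    also have "\<dots> = \<kappa> * vol e S T"
      unfolding avg_cmult_right \<kappa>_def using avg_level[OF lcu e] by simp
    finally show ?thesis .
  qed
  \<comment> \<open>\<kappa> is the volume of GL_n(Z_p), positive because the identity class
    contributes; so it can be divided out.\<close>
  have "\<kappa> \<noteq> 0"
  proof -
    let ?A = "{Z \<in> RM 1 n n :: 'p padic_int mat set. det Z dvd 1}"
    have "(\<Sum>Z\<in>RM 1 n n. u Z) = of_nat (card ?A)"
      unfolding u_def by (simp add: sum.If_cases Int_def)
    moreover have "redM 1 (1\<^sub>m n) \<in> ?A"
    proof -
      have "u (redM 1 (1\<^sub>m n)) = u (1\<^sub>m n)" by (rule lcD[OF lcu _ _ redM_cong]) auto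
      then have "det (redM 1 (1\<^sub>m n :: 'p padic_int mat)) dvd 1" by (simp add: u_def split: if_splits)
      then show ?thesis using redM_RM[of "1\<^sub>m n" n n 1] by simp
    qed
    then have "card ?A \<noteq> 0" by (subst card_0_eq) auto
    ultimately show ?thesis unfolding \<kappa>_def avg_def by simp
  qed
  then have "ann ls (\<lambda>e. vol e S T)"
    by (intro ann_cong[OF ann_cmult[OF ls, of "1 / \<kappa>"], of 1]) (simp add: eq)
  then show ?thesis by blast
qed

section \<open>Stability for nondegenerate \<open>T\<close>\<close>

text \<open>A symmetric matrix is encoded by its values at pairs (j,i) with i <= j < n, one half
  with the diagonal.\<close>

lemma card_symmetric_RM:
  "card {U \<in> RM e n n :: 'p::prime_card padic_int mat set. transpose_mat U = U} = CARD('p) ^ (e * (n * (n + 1) div 2))"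
proof -
  let ?K = "SIGMA j:{..<n}. {..j}"
  let ?S = "{U \<in> RM e n n :: 'p padic_int mat set. transpose_mat U = U}"
  have "bij_betw (\<lambda>f. mat n n (\<lambda>(i,j). f (max i j, min i j))) (?K \<rightarrow>\<^sub>E (Res e :: 'p padic_int set)) ?S"
  proof (rule bij_betw_byWitness[where f'="\<lambda>U. restrict (\<lambda>(j,i). U $$ (i,j)) ?K"])
    show "\<forall>f\<in>?K \<rightarrow>\<^sub>E (Res e :: 'p padic_int set). restrict (\<lambda>(j,i). mat n n (\<lambda>(i,j). f (max i j, min i j)) $$ (i,j)) ?K = f"
    proof
      fix f :: "nat \<times> nat \<Rightarrow> 'p padic_int" assume f: "f \<in> ?K \<rightarrow>\<^sub>E Res e"
      show "restrict (\<lambda>(j,i). mat n n (\<lambda>(i,j). f (max i j, min i j)) $$ (i,j)) ?K = f"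
      proof
        fix x show "restrict (\<lambda>(j,i). mat n n (\<lambda>(i,j). f (max i j, min i j)) $$ (i,j)) ?K x = f x"
        proof (cases "x \<in> ?K")
          case True
          then show ?thesis by (auto simp: max_def min_def)
        next
          case False
          then show ?thesis using PiE_arb[OF f False] by (simp add: restrict_def)
        qed
      qed
    qed
    show "\<forall>U\<in>?S. mat n n (\<lambda>(i,j). restrict (\<lambda>(j,i). U $$ (i,j)) ?K (max i j, min i j)) = U"
    proof
      fix U :: "'p padic_int mat" assume U: "U \<in> ?S"
      have "U $$ (j,i) = U $$ (i,j)" if "i < n" "j < n" for i j
        using that U by (metis (mono_tags, lifting) mem_Collect_eq RM_carrier carrier_matD index_transpose_mat(1))
      then show "mat n n (\<lambda>(i,j). restrict (\<lambda>(j,i). U $$ (i,j)) ?K (max i j, min i j)) = U"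
        using U by (intro eq_matI) (auto simp: RM_def max_def min_def)
    qed
    show "(\<lambda>f. mat n n (\<lambda>(i,j). f (max i j, min i j))) ` (?K \<rightarrow>\<^sub>E Res e) \<subseteq> ?S"
    proof (rule image_subsetI)
      fix f :: "nat \<times> nat \<Rightarrow> 'p padic_int" assume f: "f \<in> ?K \<rightarrow>\<^sub>E Res e"
      have "f (max i j, min i j) \<in> Res e" if "i < n" "j < n" for i j
        using f that by (intro PiE_mem[OF f]) auto
      then show "mat n n (\<lambda>(i,j). f (max i j, min i j)) \<in> ?S"
        by (auto simp: RM_def max.commute min.commute intro!: eq_matI)
    qed
    show "(\<lambda>U. restrict (\<lambda>(j,i). U $$ (i,j)) ?K) ` ?S \<subseteq> ?K \<rightarrow>\<^sub>E Res e"
      by (intro image_subsetI restrict_PiE) (auto simp: RM_def)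
  qed
  then have "card ?S = card (?K \<rightarrow>\<^sub>E (Res e :: 'p padic_int set))" by (rule bij_betw_same_card[symmetric])
  also have "\<dots> = (CARD('p) ^ e) ^ card ?K" by (simp add: card_PiE card_Res)
  also have "card ?K = n * (n + 1) div 2"
  proof -
    have "card ?K = (\<Sum>j<n. Suc j)" by simp
    also have "\<dots> = n * (n + 1) div 2" by (induction n) auto
    finally show ?thesis .
  qed
  finally show ?thesis by (simp add: power_mult)
qed

text \<open>One Newton step for T[Z] = T + p^e U, starting at Z = 1. With Z = 1 + E the linear part
  T E + (T E)^t is made equal to p^e U, and the quadratic error T[E] is divisible by p^(2(e-v)). The
  bound e >= 2v + 1 gives 2(e-v) >= e + 1, and e - v >= 1, so that Z is invertible.\<close>

lemma symmetric_perturbation: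
  fixes T :: "'p::prime_card padic_int mat"
  assumes odd: "odd CARD('p)" and T: "T \<in> carrier_mat n n" "transpose_mat T = T"
    and v: "det T = pp ^ v * u" "u dvd 1" and e: "e \<ge> 2 * v + 1"
    and U: "U \<in> carrier_mat n n" "transpose_mat U = U"
  shows "\<exists>Z W. GLp n Z W \<and> pdiv (Suc e) (T + pp ^ e \<cdot>\<^sub>m U - gram T Z)"
proof -
  have "2 * u dvd 1" using mult_dvd_mono[OF padic_two_unit[OF odd] v(2)] by simp
  then obtain h where h: "2 * u * h = 1" by (metis dvdE)
  \<comment> \<open>Solves 2 T C = p^v U by the adjugate, \<open>h\<close> being the inverse of 2 u;
    multiplied by p^(e-v) this yields p^e U.\<close>
  define C where "C = h \<cdot>\<^sub>m (adj_mat T * U)"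
  have A: "adj_mat T \<in> carrier_mat n n" "T * adj_mat T = det T \<cdot>\<^sub>m 1\<^sub>m n" using adj_mat[OF T(1)] by auto
  have C: "C \<in> carrier_mat n n" using A U by (simp add: C_def)
  have TC: "T * C = (h * det T) \<cdot>\<^sub>m U"
  proof -
    have "T * C = h \<cdot>\<^sub>m (T * (adj_mat T * U))" unfolding C_def using T A U by (intro mult_smult_distrib) auto
    also have "T * (adj_mat T * U) = det T \<cdot>\<^sub>m U"
      using T A U assoc_mult_mat[OF T(1) A(1) U(1)] by (simp add: mult_smult_assoc_mat[of _ n n])
    finally show ?thesis by (auto intro!: eq_matI)
  qed
  let ?E = "pp ^ (e - v) \<cdot>\<^sub>m C"
  let ?Z = "1\<^sub>m n + ?E"
  have E: "?E \<in> carrier_mat n n" using C by simp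
  have Zc: "?Z \<in> carrier_mat n n" using C by simp
  have pE: "pdiv (e - v) ?E" by simp
  have "pdiv 1 (?Z - 1\<^sub>m n)"
    using mat_add_diff_cancel[OF one_carrier_mat E] pdiv_mono[OF pE, of 1] e by simp
  then have "pp dvd det ?Z - 1" using det_cong_dvd[OF Zc one_carrier_mat, of 1] by simp
  then have "det ?Z dvd 1"
    unfolding padic_unit_iff by (metis dvd_diff_right_iff padic_unit_iff dvd_refl)
  then obtain W where W: "GLp n ?Z W" using GLp_of_det_unit[OF Zc] by blast
  let ?P = "transpose_mat (1\<^sub>m n) * T * ?E"
  have P: "?P = (pp ^ (e - v) * (h * det T)) \<cdot>\<^sub>m U"
  proof -
    have "?P = pp ^ (e - v) \<cdot>\<^sub>m (T * C)" using T C by (simp add: mult_smult_distrib[of _ n n])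
    then show ?thesis unfolding TC by (auto intro!: eq_matI simp: mult.assoc)
  qed
  have "gram T ?Z = gram T (1\<^sub>m n) + (?P + transpose_mat ?P) + gram T ?E"
    by (rule gram_add[OF T one_carrier_mat E])
  also have "gram T (1\<^sub>m n) = T" using T by (simp add: gram_def)
  also have "?P + transpose_mat ?P = pp ^ e \<cdot>\<^sub>m U"
  proof -
    have "transpose_mat ?P = ?P"
    proof -
      have "transpose_mat (k \<cdot>\<^sub>m U) = k \<cdot>\<^sub>m transpose_mat U" for k by (intro eq_matI) auto
      then show ?thesis unfolding P using U(2) by simp
    qed
    moreover have "pp ^ (e - v) * (h * det T) + pp ^ (e - v) * (h * det T) = pp ^ e"
    proof -
      have "pp ^ (e - v) * (h * det T) + pp ^ (e - v) * (h * det T) = (pp ^ (e - v) * pp ^ v) * (2 * u * h)"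
        unfolding v(1) by (simp add: algebra_simps)
      also have "\<dots> = pp ^ e" unfolding h using e by (simp flip: power_add)
      finally show ?thesis .
    qed
    ultimately show ?thesis unfolding P using U(1) by (auto intro!: eq_matI simp flip: distrib_right)
  qed
  finally have g: "gram T ?Z = T + pp ^ e \<cdot>\<^sub>m U + gram T ?E" .
  have "pdiv (Suc e) (gram T ?E)"
  proof -
    have "gram T ?E = pp ^ (e - v + (e - v)) \<cdot>\<^sub>m gram T C"
      using gram_smult[OF T(1) C, of "pp ^ (e - v)"] unfolding power_add .
    moreover have "Suc e \<le> e - v + (e - v)" using e by simp
    ultimately show ?thesis by (simp only: pdiv_mono[OF pdiv_smult_pp])
  qed
  moreover have "T + pp ^ e \<cdot>\<^sub>m U - gram T ?Z = - gram T ?E"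
    unfolding g using T U gram_carrier[OF T(1) E] by (intro eq_matI) auto
  ultimately have "pdiv (Suc e) (T + pp ^ e \<cdot>\<^sub>m U - gram T ?Z)" by simp
  then show ?thesis using W by blast
qed

text \<open>A solution modulo p^e satisfies S[X] = T + p^e U modulo p^(e+1) for exactly one
  symmetric \<open>U\<close> modulo p. Each T + p^e U is equivalent to T, so all p^(n(n+1)/2)
  choices of \<open>U\<close> have equal volume.\<close>

theorem vol_step_nondegenerate:
  fixes S T :: "'p::prime_card padic_int mat"
  assumes odd: "odd CARD('p)" and S: "S \<in> carrier_mat m m" "transpose_mat S = S"
    and T: "T \<in> carrier_mat n n" "transpose_mat T = T"
    and v: "det T = pp ^ v * u" "u dvd 1" and e: "e \<ge> 2 * v + 1"
  shows "vol e S T = of_nat CARD('p) ^ (n * (n + 1) div 2) * vol (Suc e) S T"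
proof -
  let ?Sym = "{U \<in> RM 1 n n :: 'p padic_int mat set. transpose_mat U = U}"
  have "vol e S T = avg (Suc e) m n (\<lambda>X. if pdiv e (gram S X - T) then 1 else 0)"
    unfolding vol_def using S T avg_level[OF lc_vol_integrand[OF S(1) T(1)], of e "Suc e"] by simp
  also have "\<dots> = avg (Suc e) m n (\<lambda>X. \<Sum>U\<in>?Sym. if pdiv (Suc e) (gram S X - (T + pp ^ e \<cdot>\<^sub>m U)) then 1 else 0)"
  proof (rule avg_cong)
    fix X :: "'p padic_int mat" assume X: "X \<in> carrier_mat m n"
    let ?G = "gram S X - T"
    have G: "?G \<in> carrier_mat n n" using T by simp
    have eqn: "gram S X - (T + pp ^ e \<cdot>\<^sub>m U) = ?G - pp ^ e \<cdot>\<^sub>m U" if "U \<in> carrier_mat n n" for U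
      using that T gram_carrier[OF S(1) X] by (intro eq_matI) auto
    show "(if pdiv e ?G then 1 else 0) = (\<Sum>U\<in>?Sym. if pdiv (Suc e) (gram S X - (T + pp ^ e \<cdot>\<^sub>m U)) then 1 else (0::complex))"
    proof (cases "pdiv e ?G")
      case False
      have "\<not> pdiv (Suc e) (?G - pp ^ e \<cdot>\<^sub>m U)" if "U \<in> carrier_mat n n" for U
      proof
        assume "pdiv (Suc e) (?G - pp ^ e \<cdot>\<^sub>m U)"
        then have "pdiv e (?G - pp ^ e \<cdot>\<^sub>m U)" using pdiv_mono by fastforce
        then have "pdiv e ?G \<longleftrightarrow> pdiv e (pp ^ e \<cdot>\<^sub>m U)" using G that by (intro pdiv_diff_iff[of _ n n]) auto
        then show False using False by simp
      qed
      then have "(\<Sum>U\<in>?Sym. if pdiv (Suc e) (gram S X - (T + pp ^ e \<cdot>\<^sub>m U)) then 1 else 0 :: complex) = 0"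
      proof (intro sum.neutral ballI)
        fix U assume "U \<in> ?Sym"
        then have cU: "U \<in> carrier_mat n n" using RM_carrier by blast
        assume "\<And>U. U \<in> carrier_mat n n \<Longrightarrow> \<not> pdiv (Suc e) (?G - pp ^ e \<cdot>\<^sub>m U)"
        from this[OF cU] show "(if pdiv (Suc e) (gram S X - (T + pp ^ e \<cdot>\<^sub>m U)) then 1 else 0 :: complex) = 0"
          unfolding eqn[OF cU] by simp
      qed
      then show ?thesis using False by simp
    next
      case True
      then obtain K where K: "K \<in> carrier_mat n n" "?G = pp ^ e \<cdot>\<^sub>m K" using pdivE G by blast
      have Gt: "transpose_mat ?G = ?G"
      proof -
        have "transpose_mat ?G = transpose_mat (gram S X) - transpose_mat T"
          using gram_carrier[OF S(1) X] T(1) by (intro eq_matI) auto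
        then show ?thesis using transpose_gram[OF S X] T by simp
      qed
      \<comment> \<open>Symmetry of the quotient matters: it puts its residue among the symmetric
        \<open>U\<close> over which the sum runs.\<close>
      have Kt: "transpose_mat K = K"
      proof (rule eq_matI)
        fix i j assume "i < dim_row K" "j < dim_col K"
        then have ij: "i < n" "j < n" using K by auto
        have "?G $$ (j,i) = ?G $$ (i,j)" using Gt ij G by (metis carrier_matD index_transpose_mat(1))
        then have "pp ^ e * K $$ (j,i) = pp ^ e * K $$ (i,j)" unfolding K(2) using ij K(1) by simp
        then show "transpose_mat K $$ (i,j) = K $$ (i,j)" using ij K(1) pp_nz[where 'p='p] by simp
      qed (use K in auto)
      have "pdiv (Suc e) (gram S X - (T + pp ^ e \<cdot>\<^sub>m U)) \<longleftrightarrow> U = redM 1 K" if U: "U \<in> RM 1 n n" for U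
      proof -
        have cU: "U \<in> carrier_mat n n" using U by (rule RM_carrier)
        have "gram S X - (T + pp ^ e \<cdot>\<^sub>m U) = pp ^ e \<cdot>\<^sub>m (1 \<cdot>\<^sub>m (K - U))"
          unfolding eqn[OF cU] K(2) using K(1) cU by (intro eq_matI) (auto simp: algebra_simps)
        then have "pdiv (Suc e) (gram S X - (T + pp ^ e \<cdot>\<^sub>m U)) \<longleftrightarrow> pdiv 1 (K - U)"
          using pdiv_smult_unit_iff[of 1 1 e "K - U"] by simp
        also have "\<dots> \<longleftrightarrow> U = redM 1 K" using redM_eq_iff[OF K(1) cU, of 1] redM_id[OF U] by metis
        finally show ?thesis .
      qed
      then have "(\<Sum>U\<in>?Sym. if pdiv (Suc e) (gram S X - (T + pp ^ e \<cdot>\<^sub>m U)) then 1 else 0) = (\<Sum>U\<in>?Sym. if U = redM 1 K then 1 else (0::complex))"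
        by (intro sum.cong) auto
      also have "\<dots> = 1"
      proof -
        have "transpose_mat (redM 1 K) = redM 1 K"
        proof -
          have "transpose_mat (redM 1 K) = redM 1 (transpose_mat K)" unfolding redM_def by (intro eq_matI) auto
          then show ?thesis using Kt by simp
        qed
        then have "redM 1 K \<in> ?Sym" using redM_RM[OF K(1)] by simp
        then show ?thesis by (subst sum.delta) auto
      qed
      finally show ?thesis using True by simp
    qed
  qed
  also have "\<dots> = (\<Sum>U\<in>?Sym. vol (Suc e) S (T + pp ^ e \<cdot>\<^sub>m U))"
    unfolding avg_sum vol_def carrier_matD(1)[OF S(1)]
  proof (intro sum.cong refl)
    fix U assume "U \<in> ?Sym"
    then have "dim_row (T + pp ^ e \<cdot>\<^sub>m U) = n" using RM_carrier by fastforce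
    then show "avg (Suc e) m n (\<lambda>X. if pdiv (Suc e) (gram S X - (T + pp ^ e \<cdot>\<^sub>m U)) then 1 else 0) =
      avg (Suc e) m (dim_row (T + pp ^ e \<cdot>\<^sub>m U)) (\<lambda>X. if pdiv (Suc e) (gram S X - (T + pp ^ e \<cdot>\<^sub>m U)) then 1 else 0)"
      by simp
  qed
  also have "\<dots> = (\<Sum>U\<in>?Sym. vol (Suc e) S T)"
  proof (rule sum.cong[OF refl])
    fix U assume U: "U \<in> ?Sym"
    then have cU: "U \<in> carrier_mat n n" "transpose_mat U = U" using RM_carrier by auto
    obtain Z W where Z: "GLp n Z W" "pdiv (Suc e) (T + pp ^ e \<cdot>\<^sub>m U - gram T Z)"
      using symmetric_perturbation[OF odd T v e cU] by blast
    have "vol (Suc e) S (T + pp ^ e \<cdot>\<^sub>m U) = vol (Suc e) S (gram T Z)"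
      by (rule vol_cong[OF S(1) _ _ Z(2)]) (use T cU Z(1) in \<open>auto simp: GLp_def\<close>)
    also have "\<dots> = vol (Suc e) S T" by (rule vol_gram[OF S(1) T(1) Z(1)])
    finally show "vol (Suc e) S (T + pp ^ e \<cdot>\<^sub>m U) = vol (Suc e) S T" .
  qed
  also have "\<dots> = of_nat CARD('p) ^ (n * (n + 1) div 2) * vol (Suc e) S T"
    using card_symmetric_RM[of 1 n, where 'p='p] by simp
  finally show ?thesis .
qed

section \<open>Dependence on the level\<close>

lemma mat_add_diff_add:
  "A \<in> carrier_mat m n \<Longrightarrow> B \<in> carrier_mat m n \<Longrightarrow> C \<in> carrier_mat m n \<Longrightarrow> A + B - (A + C) = B - (C :: 'a::ab_group_add mat)"
  by (intro eq_matI) auto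

text \<open>Residue matrices form a group of p-power order under addition followed by reduction; a
  condition compatible with congruence cuts out a subgroup, and Lagrange's theorem applies.\<close>

lemma card_subgroup_RM:
  fixes P :: "'p::prime_card padic_int mat \<Rightarrow> bool"
  assumes P0: "P (0\<^sub>m m n)"
    and Padd: "\<And>x y. x \<in> carrier_mat m n \<Longrightarrow> y \<in> carrier_mat m n \<Longrightarrow> P x \<Longrightarrow> P y \<Longrightarrow> P (x + y)"
    and Pneg: "\<And>x. x \<in> carrier_mat m n \<Longrightarrow> P x \<Longrightarrow> P (- x)"
    and Pc: "\<And>x y. x \<in> carrier_mat m n \<Longrightarrow> y \<in> carrier_mat m n \<Longrightarrow> pdiv e (x - y) \<Longrightarrow> P x \<Longrightarrow> P y"
  shows "\<exists>a. card {x \<in> RM e m n. P x} = CARD('p) ^ a"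
proof -
  define G where "G = \<lparr>carrier = RM e m n :: 'p padic_int mat set, monoid.mult = (\<lambda>x y. redM e (x + y) :: 'p padic_int mat), one = 0\<^sub>m m n\<rparr>"
  have z: "(0\<^sub>m m n :: 'p padic_int mat) \<in> RM e m n"
    using card_prime_gt_1[where 'p='p] by (auto simp: RM_def Res_def intro!: image_eqI[of _ _ 0])
  have red: "redM e x = redM e y" if "x \<in> carrier_mat m n" "y \<in> carrier_mat m n" "pdiv e (x - y)" for x y :: "'p padic_int mat"
    using redM_eq_iff[OF that(1,2)] that(3) by simp
  have redr: "redM e (x + redM e y) = redM e (x + y)" if c: "x \<in> carrier_mat m n" "y \<in> carrier_mat m n" for x y :: "'p padic_int mat"
  proof (rule red)
    have "x + redM e y - (x + y) = redM e y - y"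
      by (rule mat_add_diff_add[OF c(1) redM_carrier[OF c(2)] c(2)])
    then show "pdiv e (x + redM e y - (x + y))" using redM_cong[OF c(2)] by simp
  qed (use c in auto)
  have comm: "x + y = y + x" if "x \<in> carrier_mat m n" "y \<in> carrier_mat m n" for x y :: "'p padic_int mat"
    using that by (rule comm_add_mat)
  have inv: "redM e (redM e (- x) + x) = 0\<^sub>m m n" if x: "x \<in> RM e m n" for x :: "'p padic_int mat"
  proof -
    have c: "x \<in> carrier_mat m n" using x by (rule RM_carrier)
    have "redM e (redM e (- x) + x) = redM e (x + (- x))"
      using comm[of "redM e (- x)" x] redr[OF c, of "- x"] c by simp
    also have "x + (- x) = 0\<^sub>m m n" using c by (intro eq_matI) auto
    finally show ?thesis using redM_id[OF z] by simp
  qed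
  have gG: "group G"
  proof (rule groupI)
    fix x y w assume "x \<in> carrier G" "y \<in> carrier G" "w \<in> carrier G"
    then have c: "x \<in> carrier_mat m n" "y \<in> carrier_mat m n" "w \<in> carrier_mat m n" by (auto simp: G_def RM_carrier)
    have "redM e (redM e (x + y) + w) = redM e (w + (x + y))"
      using comm[of "redM e (x + y)" w] redr[of w "x + y"] c by simp
    also have "w + (x + y) = x + (y + w)" using c by (intro eq_matI) auto
    also have "redM e (x + (y + w)) = redM e (x + redM e (y + w))" using redr[of x "y + w"] c by simp
    finally show "x \<otimes>\<^bsub>G\<^esub> y \<otimes>\<^bsub>G\<^esub> w = x \<otimes>\<^bsub>G\<^esub> (y \<otimes>\<^bsub>G\<^esub> w)" by (simp add: G_def)
  next
    fix x assume x: "x \<in> carrier G"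
    then have c: "x \<in> RM e m n" "x \<in> carrier_mat m n" by (auto simp: G_def RM_carrier)
    have "0\<^sub>m m n + x = x" using c by simp
    then show "\<one>\<^bsub>G\<^esub> \<otimes>\<^bsub>G\<^esub> x = x" using redM_id[OF c(1)] by (simp add: G_def)
    show "\<exists>y\<in>carrier G. y \<otimes>\<^bsub>G\<^esub> x = \<one>\<^bsub>G\<^esub>"
      by (rule bexI[of _ "redM e (- x)"]) (use inv[OF c(1)] redM_RM[of "- x" m n e] c in \<open>auto simp: G_def\<close>)
  qed (auto simp: G_def z RM_carrier intro!: redM_RM)
  interpret group G by (rule gG)
  let ?H = "{x \<in> RM e m n. P x}"
  have Pred: "P (redM e x)" if "x \<in> carrier_mat m n" "P x" for x
    using Pc[OF that(1) _ _ that(2)] pdiv_sym[OF _ that(1) redM_cong[OF that(1)]] that(1) by simp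
  have sub: "subgroup ?H G"
  proof (rule subgroupI)
    show "?H \<noteq> {}" using z P0 by blast
  next
    fix x assume x: "x \<in> ?H"
    have c: "x \<in> carrier_mat m n" using x RM_carrier by blast
    have "inv\<^bsub>G\<^esub> x = redM e (- x)"
      by (rule inv_equality) (use inv[of x] x redM_RM[of "- x" m n e] c in \<open>auto simp: G_def\<close>)
    then show "inv\<^bsub>G\<^esub> x \<in> ?H" using redM_RM[of "- x" m n e] Pred[of "- x"] Pneg[OF c] x c by simp
  next
    fix x y assume xy: "x \<in> ?H" "y \<in> ?H"
    then have c: "x \<in> carrier_mat m n" "y \<in> carrier_mat m n" using RM_carrier by blast+
    then show "x \<otimes>\<^bsub>G\<^esub> y \<in> ?H" using redM_RM[of "x + y" m n e] Pred[of "x + y"] Padd[OF c] xy by (simp add: G_def)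
  qed (auto simp: G_def)
  have "card (rcosets\<^bsub>G\<^esub> ?H) * card ?H = Coset.order G" by (rule lagrange[OF sub])
  also have "Coset.order G = CARD('p) ^ (e * m * n)" by (simp add: Coset.order_def G_def card_RM)
  finally have "card ?H dvd CARD('p) ^ (e * m * n)" by (metis dvd_triv_right)
  then show ?thesis using divides_primepow_nat[OF prime_card[where 'a='p]] by blast
qed

definition ker_vol :: "nat \<Rightarrow> 'p::prime_card padic_int mat \<Rightarrow> complex" where
  "ker_vol e Y = avg e 1 (dim_row Y) (\<lambda>r. if pdiv e (r * Y) then 1 else 0)"

text \<open>Both kernels are finite p-groups, say of orders p^a and p^b, so the ratio of volumes is
  a power of p. Inclusion of kernels gives a <= b, and multiplication by p gives b <= n + a.\<close>

lemma ker_vol_ratio: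
  fixes Y :: "'p::prime_card padic_int mat"
  assumes Y: "Y \<in> carrier_mat n n"
  shows "\<exists>r\<le>n. ker_vol (Suc e) (pp \<cdot>\<^sub>m Y) = of_nat CARD('p) ^ r * ker_vol (Suc e) Y"
proof -
  let ?E = "Suc e"
  have sub: "\<exists>a. card {x \<in> RM ?E 1 n. pdiv ?E (x * Z)} = CARD('p) ^ a" if Z: "Z \<in> carrier_mat n n" for Z :: "'p padic_int mat"
  proof (rule card_subgroup_RM)
    show "pdiv ?E (0\<^sub>m 1 n * Z)" using Z by simp
  next
    fix x y assume xy: "x \<in> carrier_mat 1 n" "y \<in> carrier_mat 1 n" "pdiv ?E (x * Z)" "pdiv ?E (y * Z)"
    then show "pdiv ?E ((x + y) * Z)" using Z by (simp add: add_mult_distrib_mat[of _ 1 n] pdiv_add[of _ 1 n])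
  next
    fix x assume "x \<in> carrier_mat 1 n" "pdiv ?E (x * Z)" then show "pdiv ?E (- x * Z)" using Z by simp
  next
    fix x y assume xy: "x \<in> carrier_mat 1 n" "y \<in> carrier_mat 1 n" "pdiv ?E (x - y)" "pdiv ?E (x * Z)"
    have "pdiv ?E ((x - y) * Z)" using xy Z by (intro pdiv_mult_left[of _ 1 n]) auto
    then have "pdiv ?E (x * Z - y * Z)" using xy Z by (simp add: minus_mult_distrib_mat[of _ 1 n])
    then show "pdiv ?E (y * Z)" using pdiv_diff_iff[of "x * Z" 1 n "y * Z" ?E] xy Z by simp
  qed
  let ?cY = "card {x \<in> RM ?E 1 n. pdiv ?E (x * Y)}" and ?cP = "card {x \<in> RM ?E 1 n. pdiv ?E (x * (pp \<cdot>\<^sub>m Y))}"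
  obtain a where a: "?cY = CARD('p) ^ a" using sub[OF Y] by blast
  obtain b where b: "?cP = CARD('p) ^ b" using sub[of "pp \<cdot>\<^sub>m Y"] Y by auto
  have kv: "ker_vol ?E Z = of_nat (card {x \<in> RM ?E 1 n. pdiv ?E (x * Z)}) / of_nat CARD('p) ^ (?E * n)"
    if "Z \<in> carrier_mat n n" for Z :: "'p padic_int mat"
    using that by (simp add: ker_vol_def avg_def sum.If_cases Int_def)
  have xpY: "x * (pp \<cdot>\<^sub>m Y) = pp \<cdot>\<^sub>m x * Y" "x * (pp \<cdot>\<^sub>m Y) = pp \<cdot>\<^sub>m (x * Y)" if "x \<in> carrier_mat 1 n" for x
    using that Y by (simp_all add: mult_smult_distrib[of _ 1 n] mult_smult_assoc_mat[of _ 1 n])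
  have "?cY \<le> ?cP"
    by (rule card_mono) (auto simp: xpY(2) RM_carrier intro!: pdiv_smult)
  then have ab: "a \<le> b" unfolding a b using card_prime_gt_1[where 'p='p] by simp
  text \<open>Multiplication by \<open>p\<close> maps the kernel of \<open>p Y\<close> into that of \<open>Y\<close>, with fibres of \<open>p\<^sup>n\<close> elements.\<close>
  have "?cP \<le> CARD('p) ^ n * ?cY"
  proof -
    let ?f = "\<lambda>x. if pdiv ?E (x * Y) then 1 else 0 :: complex"
    have lcf: "lc ?E 1 n ?f"
    proof (rule lcI)
      fix x y :: "'p padic_int mat" assume xy: "x \<in> carrier_mat 1 n" "y \<in> carrier_mat 1 n" "pdiv ?E (x - y)"
      have "pdiv ?E ((x - y) * Y)" using xy Y by (intro pdiv_mult_left[of _ 1 n]) auto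
      then have "pdiv ?E (x * Y - y * Y)" using xy Y by (simp add: minus_mult_distrib_mat[of _ 1 n])
      then have "pdiv ?E (x * Y) \<longleftrightarrow> pdiv ?E (y * Y)" using xy Y by (intro pdiv_diff_iff[of _ 1 n]) auto
      then show "?f x = ?f y" by (simp only:)
    qed
    \<comment> \<open>Modulo p^(e+1) the matrix p x depends only on x modulo p^e. So this average
      may be taken at level e, where \<open>avg_box\<close> with centre 0 relates it to the rows
      divisible by p.\<close>
    have lcg: "lc e 1 n (\<lambda>x. ?f (pp \<cdot>\<^sub>m x))"
    proof (rule lcI)
      fix x y :: "'p padic_int mat" assume xy: "x \<in> carrier_mat 1 n" "y \<in> carrier_mat 1 n" "pdiv e (x - y)"
      have "pp \<cdot>\<^sub>m x - pp \<cdot>\<^sub>m y = pp \<cdot>\<^sub>m (x - y)" using xy by (intro eq_matI) (auto simp: algebra_simps)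
      moreover have "pdiv ?E (pp \<cdot>\<^sub>m (x - y))" using xy(3) unfolding pdiv_def by auto
      ultimately show "?f (pp \<cdot>\<^sub>m x) = ?f (pp \<cdot>\<^sub>m y)" using xy by (intro lcD[OF lcf]) auto
    qed
    have "ker_vol ?E (pp \<cdot>\<^sub>m Y) = avg ?E 1 n (\<lambda>x. ?f (pp \<cdot>\<^sub>m x))"
      unfolding ker_vol_def using Y by (simp, intro avg_cong) (simp add: xpY)
    also have "\<dots> = avg e 1 n (\<lambda>x. ?f (0\<^sub>m 1 n + pp \<cdot>\<^sub>m x))"
    proof -
      have "avg ?E 1 n (\<lambda>x. ?f (pp \<cdot>\<^sub>m x)) = avg e 1 n (\<lambda>x. ?f (pp \<cdot>\<^sub>m x))" by (rule avg_level[OF lcg]) simp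
      also have "\<dots> = avg e 1 n (\<lambda>x. ?f (0\<^sub>m 1 n + pp \<cdot>\<^sub>m x))" by (rule avg_cong) simp
      finally show ?thesis .
    qed
    also have "\<dots> = of_nat CARD('p) ^ n * avg ?E 1 n (\<lambda>x. if pdiv 1 (x - 0\<^sub>m 1 n) then ?f x else 0)"
      using avg_box[OF lcf, of "0\<^sub>m 1 n"] by simp
    also have "\<dots> = of_nat CARD('p) ^ n * (of_nat (card {x \<in> RM ?E 1 n. pdiv 1 (x - 0\<^sub>m 1 n) \<and> pdiv ?E (x * Y)}) / of_nat CARD('p) ^ (?E * n))"
      by (simp add: avg_def sum.If_cases Int_def flip: if_if_eq_conj)
    finally have "of_nat ?cP / of_nat CARD('p) ^ (?E * n) = (of_nat CARD('p) ^ n * (of_nat (card {x \<in> RM ?E 1 n. pdiv 1 (x - 0\<^sub>m 1 n) \<and> pdiv ?E (x * Y)}) / of_nat CARD('p) ^ (?E * n)) :: complex)"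
      using kv[of "pp \<cdot>\<^sub>m Y"] Y by simp
    then have "of_nat ?cP = (of_nat (CARD('p) ^ n * card {x \<in> RM ?E 1 n. pdiv 1 (x - 0\<^sub>m 1 n) \<and> pdiv ?E (x * Y)}) :: complex)"
      by (simp add: field_simps)
    then have "?cP = CARD('p) ^ n * card {x \<in> RM ?E 1 n. pdiv 1 (x - 0\<^sub>m 1 n) \<and> pdiv ?E (x * Y)}"
      by (simp only: of_nat_eq_iff)
    also have "\<dots> \<le> CARD('p) ^ n * ?cY" by (intro mult_le_mono2 card_mono) auto
    finally show ?thesis .
  qed
  then have "CARD('p) ^ b \<le> CARD('p) ^ (n + a)" unfolding a b by (simp add: power_add)
  then have ban: "b \<le> n + a" using card_prime_gt_1[where 'p='p] by (meson power_le_imp_le_exp)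
  have "of_nat CARD('p) ^ b = (of_nat CARD('p) ^ (b - a) * of_nat CARD('p) ^ a :: complex)"
    using ab by (simp flip: power_add)
  then have "ker_vol ?E (pp \<cdot>\<^sub>m Y) = of_nat CARD('p) ^ (b - a) * ker_vol ?E Y"
    using kv[OF Y] kv[of "pp \<cdot>\<^sub>m Y"] Y a b by simp
  then show ?thesis using ban by (intro exI[of _ "b - a"]) auto
qed

section \<open>Gauss sums of hyperbolic planes\<close>

definition hpR :: "'p::prime_card padic_int \<Rightarrow> 'p padic_int mat" where
  "hpR h = mat 2 2 (\<lambda>(i,j). if i = j then 0 else h)"

text \<open>For a hyperbolic plane the phase is bilinear in the two rows r and s. Averaging over s
  is a character sum and leaves the condition that s pairs trivially with r (y + y^t).\<close>

lemma gs_hyperbolic: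
  fixes y :: "'p::prime_card padic_int mat"
  assumes y: "y \<in> carrier_mat n n"
  shows "gs e (hpR h) n y = avg e 1 n (\<lambda>r. if pdiv e (h \<cdot>\<^sub>m (r * (y + transpose_mat y))) then 1 else 0)"
proof -
  have "gs e (hpR h) n y = avg e 1 n (\<lambda>r. avg e 1 n (\<lambda>s. psi e (pr y (gram (hpR h) (r @\<^sub>r s)))))"
    unfolding gs_def using avg_rows[of e 1 1 n] by (simp add: hpR_def numeral_2_eq_2)
  also have "\<dots> = avg e 1 n (\<lambda>r. avg e 1 n (\<lambda>s. psi e (pr s (h \<cdot>\<^sub>m (r * (y + transpose_mat y))))))"
  proof (intro avg_cong arg_cong[where f="psi e"])
    fix r s :: "'p padic_int mat" assume r: "r \<in> carrier_mat 1 n" and s: "s \<in> carrier_mat 1 n"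
    let ?rt = "transpose_mat r" and ?st = "transpose_mat s"
    have c: "?rt * s \<in> carrier_mat n n" "?st * r \<in> carrier_mat n n" using r s by auto
    have "gram (hpR h) (r @\<^sub>r s) = h \<cdot>\<^sub>m (?rt * s + ?st * r)"
      using r s unfolding gram_def hpR_def append_rows_def
      by (intro eq_matI) (auto simp: scalar_prod_def numeral_2_eq_2 algebra_simps)
    then have "pr y (gram (hpR h) (r @\<^sub>r s)) = h * (pr y (?rt * s) + pr y (?st * r))"
      using c y by (simp add: pr_smult_right[of _ n n] pr_add_right[of _ n n])
    also have "pr y (?rt * s) = pr (r * y) s"
      using pr_mult_right1[of y n n ?rt 1 s] y r s by simp
    also have "pr y (?st * r) = pr (transpose_mat y) (?rt * s)"
      using pr_transpose[OF y c(2)] r s by (simp add: transpose_mult_dim)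
    also have "\<dots> = pr (r * transpose_mat y) s"
      using pr_mult_right1[of "transpose_mat y" n n ?rt 1 s] y r s by simp
    also have "h * (pr (r * y) s + pr (r * transpose_mat y) s) = pr (h \<cdot>\<^sub>m (r * (y + transpose_mat y))) s"
      using r s y by (simp add: pr_smult_left[of _ 1 n] pr_add_left[of _ 1 n] mult_add_distrib_mat[of _ 1 n])
    also have "\<dots> = pr s (h \<cdot>\<^sub>m (r * (y + transpose_mat y)))"
      by (rule pr_commute[of _ 1 n]) (use r s y in auto)
    finally show "pr y (gram (hpR h) (r @\<^sub>r s)) = pr s (h \<cdot>\<^sub>m (r * (y + transpose_mat y)))" .
  qed
  also have "\<dots> = avg e 1 n (\<lambda>r. if pdiv e (h \<cdot>\<^sub>m (r * (y + transpose_mat y))) then 1 else 0)"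
    by (intro avg_cong avg_psi) (use y in auto)
  finally show ?thesis .
qed

lemma pdiv_unit_smult_iff: "(u :: 'p::prime_card padic_int) dvd 1 \<Longrightarrow> pdiv e (u \<cdot>\<^sub>m K) \<longleftrightarrow> pdiv e K"
  using pdiv_smult_unit_iff[of u e 0 K] by (simp add: pdiv_def)

lemma gs_hyperbolic_unit:
  assumes y: "y \<in> carrier_mat n n" and h: "h dvd 1"
  shows "gs e (hpR h) n y = ker_vol e (y + transpose_mat y)"
    and "gs e (pp \<cdot>\<^sub>m hpR h) n y = ker_vol e (pp \<cdot>\<^sub>m (y + transpose_mat y))"
proof -
  show "gs e (hpR h) n y = ker_vol e (y + transpose_mat y)"
    unfolding gs_hyperbolic[OF y] ker_vol_def pdiv_unit_smult_iff[OF h] using y by simp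
  have dim: "dim_row (pp \<cdot>\<^sub>m (y + transpose_mat y)) = n" using y by simp
  have "pp \<cdot>\<^sub>m hpR h = hpR (h * pp)" by (auto simp: hpR_def mult.commute intro!: eq_matI)
  then have "gs e (pp \<cdot>\<^sub>m hpR h) n y = avg e 1 n (\<lambda>r. if pdiv e ((h * pp) \<cdot>\<^sub>m (r * (y + transpose_mat y))) then 1 else 0)"
    using gs_hyperbolic[OF y] by simp
  also have "\<dots> = ker_vol e (pp \<cdot>\<^sub>m (y + transpose_mat y))"
    unfolding ker_vol_def dim
  proof (rule avg_cong)
    fix r :: "'a padic_int mat" assume r: "r \<in> carrier_mat 1 n"
    have "(h * pp) \<cdot>\<^sub>m (r * (y + transpose_mat y)) = h \<cdot>\<^sub>m (r * (pp \<cdot>\<^sub>m (y + transpose_mat y)))"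
      using r y by (simp add: mult_smult_distrib[of _ 1 n]) (intro eq_matI, auto simp: mult.assoc)
    then show "(if pdiv e ((h * pp) \<cdot>\<^sub>m (r * (y + transpose_mat y))) then 1 else 0 :: complex) =
        (if pdiv e (r * (pp \<cdot>\<^sub>m (y + transpose_mat y))) then 1 else 0)"
      using pdiv_unit_smult_iff[OF h] by simp
  qed
  finally show "gs e (pp \<cdot>\<^sub>m hpR h) n y = ker_vol e (pp \<cdot>\<^sub>m (y + transpose_mat y))" .
qed

lemma gs_diag_block:
  fixes y :: "'p::prime_card padic_int mat"
  assumes "y \<in> carrier_mat n n" "\<And>A. A \<in> set As \<Longrightarrow> square_mat A"
  shows "gs e (diag_block_mat As) n y = prod_list (map (\<lambda>A. gs e A n y) As)"
  using assms(2)
proof (induction As)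
  case Nil
  have "gs e (diag_block_mat []) n y = avg e 0 n (\<lambda>X :: 'p padic_int mat. 1)"
    unfolding gs_def diag_block_mat.simps index_zero_mat
  proof (rule avg_cong)
    fix X :: "'p padic_int mat" assume X: "X \<in> carrier_mat 0 n"
    then have "gram (0\<^sub>m 0 0) X = 0\<^sub>m n n" by (intro eq_matI) (auto simp: gram_def scalar_prod_def)
    then show "psi e (pr y (gram (0\<^sub>m 0 0) X)) = 1" by (simp add: pr_def)
  qed
  then show ?case by simp
next
  case (Cons A As)
  let ?B = "diag_block_mat As"
  have A: "A \<in> carrier_mat (dim_row A) (dim_row A)" using Cons.prems[of A] by auto
  have "square_mat ?B" using Cons.prems by (intro diag_block_mat_square) auto
  then have B: "?B \<in> carrier_mat (dim_row ?B) (dim_row ?B)" by auto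
  have "gs e (diag_block_mat (A # As)) n y = gs e A n y * gs e ?B n y"
  proof -
    have dims: "dim_col A = dim_row A" "dim_col ?B = dim_row ?B" using carrier_matD[OF A] carrier_matD[OF B] by blast+
    have "diag_block_mat (A # As) = four_block_mat A (0\<^sub>m (dim_row A) (dim_row ?B)) (0\<^sub>m (dim_row ?B) (dim_row A)) ?B"
      unfolding diag_block_mat.simps Let_def dims ..
    then show ?thesis by (simp only: gs_block[OF A B assms(1)])
  qed
  then show ?case using Cons by simp
qed

lemma smult_diag_block:
  fixes c :: "'a::semiring_0"
  shows "c \<cdot>\<^sub>m diag_block_mat As = diag_block_mat (map ((\<cdot>\<^sub>m) c) As)"
proof (induction As)
  case (Cons A As)
  have "dim_row (diag_block_mat (map ((\<cdot>\<^sub>m) c) As)) = dim_row (diag_block_mat As)"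
       "dim_col (diag_block_mat (map ((\<cdot>\<^sub>m) c) As)) = dim_col (diag_block_mat As)"
    unfolding Cons[symmetric] by auto
  then show ?case using Cons[symmetric] by (simp add: Let_def) (intro eq_matI, auto)
qed (auto intro!: eq_matI)

text \<open>The parameter \<open>h\<close> stands for \<open>1 / 2\<close>.\<close>

definition levR :: "'p::prime_card padic_int \<Rightarrow> nat \<Rightarrow> nat \<Rightarrow> 'p padic_int mat \<Rightarrow> 'p padic_int mat" where
  "levR h k l S0 = diag_block_mat [diag_block_mat (replicate (k - l - 1) (hpR h)), pp \<cdot>\<^sub>m diag_block_mat (replicate l (hpR h)), S0]"

text \<open>For each \<open>y\<close> the k - l - 1 planes H and the l planes pH contribute
  K^(k-l-1) (p^r K)^l = K^(k-1) p^(rl), with K the kernel volume of y + y^t: \<open>l\<close>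
  survives only in p^(rl). Collecting the \<open>y\<close> with equal r gives coefficients free of
  \<open>l\<close>.\<close>

theorem vol_level_polynomial:
  fixes S0 T :: "'p::prime_card padic_int mat"
  assumes S0: "S0 \<in> carrier_mat d d" and T: "T \<in> carrier_mat n n" and h: "h dvd 1"
    and lev: "\<And>l. l < k \<Longrightarrow> levR h k l S0 \<in> carrier_mat (m l) (m l)"
  shows "\<exists>c. \<forall>l<k. vol (Suc e) (levR h k l S0) T = (\<Sum>i\<le>n. c i * of_nat CARD('p) ^ (i * l))"
proof -
  let ?E = "Suc e"
  let ?Y = "\<lambda>y :: 'p padic_int mat. y + transpose_mat y"
  have "\<exists>r. \<forall>y\<in>carrier_mat n n. r y \<le> n \<and> ker_vol ?E (pp \<cdot>\<^sub>m ?Y y) = of_nat CARD('p) ^ r y * ker_vol ?E (?Y y)"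
  proof (rule bchoice, intro ballI)
    fix y :: "'p padic_int mat" assume "y \<in> carrier_mat n n"
    then show "\<exists>r. r \<le> n \<and> ker_vol ?E (pp \<cdot>\<^sub>m ?Y y) = of_nat CARD('p) ^ r * ker_vol ?E (?Y y)"
      using ker_vol_ratio[of "?Y y" n e] by auto
  qed
  then obtain r where r: "\<And>y. y \<in> carrier_mat n n \<Longrightarrow> r y \<le> n"
    "\<And>y. y \<in> carrier_mat n n \<Longrightarrow> ker_vol ?E (pp \<cdot>\<^sub>m ?Y y) = of_nat CARD('p) ^ r y * ker_vol ?E (?Y y)" by blast
  define g where "g y = psi ?E (- pr y T) * ker_vol ?E (?Y y) ^ (k - 1) * gs ?E S0 n y" for y
  \<comment> \<open>The Fourier integral restricted to the \<open>y\<close> with exponent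
    \<open>i\<close>.\<close>
  define c where "c i = avg ?E n n (\<lambda>y. if r y = i then g y else 0)" for i
  have "vol ?E (levR h k l S0) T = (\<Sum>i\<le>n. c i * of_nat CARD('p) ^ (i * l))" if l: "l < k" for l
  proof -
    have gsl: "gs ?E (levR h k l S0) n y = ker_vol ?E (?Y y) ^ (k - 1) * of_nat CARD('p) ^ (r y * l) * gs ?E S0 n y"
      if y: "y \<in> carrier_mat n n" for y
    proof -
      have sq: "square_mat (hpR h)" "square_mat (pp \<cdot>\<^sub>m hpR h)" by (auto simp: hpR_def)
      have sd: "square_mat (diag_block_mat (replicate j (hpR h)))" for j
        by (rule diag_block_mat_square) (auto simp: hpR_def)
      have "gs ?E (levR h k l S0) n y = gs ?E (diag_block_mat (replicate (k - l - 1) (hpR h))) n y *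
         (gs ?E (pp \<cdot>\<^sub>m diag_block_mat (replicate l (hpR h))) n y * gs ?E S0 n y)"
        unfolding levR_def by (subst gs_diag_block[OF y]) (use S0 sd in auto)
      also have "gs ?E (diag_block_mat (replicate (k - l - 1) (hpR h))) n y = ker_vol ?E (?Y y) ^ (k - l - 1)"
        by (subst gs_diag_block[OF y]) (use sq in \<open>auto simp: gs_hyperbolic_unit[OF y h]\<close>)
      also have "gs ?E (pp \<cdot>\<^sub>m diag_block_mat (replicate l (hpR h))) n y = ker_vol ?E (pp \<cdot>\<^sub>m ?Y y) ^ l"
        unfolding smult_diag_block
        by (subst gs_diag_block[OF y]) (use sq in \<open>auto simp: gs_hyperbolic_unit[OF y h]\<close>)
      also have "\<dots> = of_nat CARD('p) ^ (r y * l) * ker_vol ?E (?Y y) ^ l"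
        unfolding r(2)[OF y] by (simp add: power_mult_distrib power_mult)
      also have "ker_vol ?E (?Y y) ^ (k - l - 1) * (of_nat CARD('p) ^ (r y * l) * ker_vol ?E (?Y y) ^ l * gs ?E S0 n y) =
         ker_vol ?E (?Y y) ^ (k - l - 1 + l) * of_nat CARD('p) ^ (r y * l) * gs ?E S0 n y"
        by (simp add: power_add mult_ac)
      also have "k - l - 1 + l = k - 1" using l by simp
      finally show ?thesis .
    qed
    have "vol ?E (levR h k l S0) T = avg ?E n n (\<lambda>y. psi ?E (- pr y T) * gs ?E (levR h k l S0) n y)"
      by (rule vol_fourier[OF lev[OF l] T])
    also have "\<dots> = avg ?E n n (\<lambda>y. \<Sum>i\<le>n. (if r y = i then g y else 0) * of_nat CARD('p) ^ (i * l))"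
    proof (rule avg_cong)
      fix y :: "'p padic_int mat" assume y: "y \<in> carrier_mat n n"
      have "(\<Sum>i\<le>n. (if r y = i then g y else 0) * of_nat CARD('p) ^ (i * l)) = (\<Sum>i\<le>n. if r y = i then g y * of_nat CARD('p) ^ (i * l) else 0)"
        by (intro sum.cong) auto
      also have "\<dots> = g y * of_nat CARD('p) ^ (r y * l)" using r(1)[OF y] by (subst sum.delta') auto
      finally show "psi ?E (- pr y T) * gs ?E (levR h k l S0) n y = (\<Sum>i\<le>n. (if r y = i then g y else 0) * of_nat CARD('p) ^ (i * l))"
        unfolding gsl[OF y] g_def by (simp add: mult_ac)
    qed
    also have "\<dots> = (\<Sum>i\<le>n. c i * of_nat CARD('p) ^ (i * l))"
      unfolding avg_sum avg_cmult_right c_def ..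
    finally show ?thesis .
  qed
  then show ?thesis by blast
qed

section \<open>Local densities as normalised volumes\<close>

interpretation tf: comm_ring_hom "to_fract :: 'a::idom \<Rightarrow> 'a fract"
  by unfold_locales simp_all

abbreviation tfm :: "'a::idom mat \<Rightarrow> 'a fract mat" where
  "tfm \<equiv> map_mat to_fract"

lemma to_fract_of_nat: "to_fract (of_nat k) = of_nat k"
  by (induction k) simp_all

lemma to_fract_pp: "to_fract (pp ^ e :: 'p::prime_card padic_int) = of_nat CARD('p) ^ e"
  by (induction e) (simp_all add: pp_def to_fract_of_nat)

lemma tfm_inj: "tfm A = tfm B \<longleftrightarrow> A = B"
proof
  assume eq: "tfm A = tfm B"
  show "A = B"
  proof (rule eq_matI)
    show d: "dim_row A = dim_row B" "dim_col A = dim_col B"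
      using arg_cong[OF eq, of dim_row] arg_cong[OF eq, of dim_col] by simp_all
    fix i j assume "i < dim_row B" "j < dim_col B"
    then show "A $$ (i,j) = B $$ (i,j)"
      using arg_cong[OF eq, of "\<lambda>M. M $$ (i,j)"] d by simp
  qed
qed simp

lemma tfm_diff: "A \<in> carrier_mat m n \<Longrightarrow> B \<in> carrier_mat m n \<Longrightarrow> tfm (A - B) = tfm A - tfm B"
  by (intro eq_matI) auto

lemma tfm_smult: "tfm (c \<cdot>\<^sub>m A) = to_fract c \<cdot>\<^sub>m tfm A"
  by (intro eq_matI) auto

lemma tfm_transpose: "tfm (transpose_mat A) = transpose_mat (tfm A)"
  by (intro eq_matI) auto

lemma tfm_gram:
  assumes "S \<in> carrier_mat m m" "X \<in> carrier_mat m n"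
  shows "tfm (gram S X) = transpose_mat (tfm X) * tfm S * tfm X"
proof -
  have "tfm (transpose_mat X * S * X) = tfm (transpose_mat X * S) * tfm X"
    by (rule tf.mat_hom_mult[of _ n m _ n]) (use assms in auto)
  also have "tfm (transpose_mat X * S) = tfm (transpose_mat X) * tfm S"
    by (rule tf.mat_hom_mult[of _ n m _ m]) (use assms in auto)
  finally show ?thesis by (simp add: gram_def tfm_transpose)
qed

lemma Zp_mat_iff: "X \<in> Zp_mat m n \<longleftrightarrow> (\<exists>Y\<in>carrier_mat m n. X = tfm Y)"
proof
  assume X: "X \<in> Zp_mat m n"
  then have "\<forall>i j. \<exists>z. i < m \<longrightarrow> j < n \<longrightarrow> X $$ (i,j) = to_fract z"
    by (auto simp: Zp_mat_def Zp_def)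
  then obtain z where z: "\<And>i j. i < m \<Longrightarrow> j < n \<Longrightarrow> X $$ (i,j) = to_fract (z i j)" by metis
  show "\<exists>Y\<in>carrier_mat m n. X = tfm Y"
    by (rule bexI[of _ "mat m n (\<lambda>(i,j). z i j)"]) (use X z in \<open>auto simp: Zp_mat_def intro!: eq_matI\<close>)
qed (auto simp: Zp_mat_def Zp_def)

text \<open>For odd p the factor 2 is a unit of Z_p, so half-integrality is integrality; this
  transfers the problem from the fraction field to Z_p.\<close>

lemma half_integral_iff:
  assumes odd: "odd CARD('p::prime_card)"
  shows "(T :: 'p padic mat) \<in> half_integral n \<longleftrightarrow> (\<exists>T'\<in>carrier_mat n n. transpose_mat T' = T' \<and> T = tfm T')"
proof
  assume T: "T \<in> half_integral n"
  obtain h :: "'p padic_int" where h: "1 = 2 * h" using padic_two_unit[OF odd] by (rule dvdE)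
  have "to_fract h * 2 = (1 :: 'p padic)"
    using arg_cong[OF h, of to_fract] to_fract_of_nat[of 2, where 'a="'p padic_int"] by (simp add: mult.commute)
  then have half: "x = to_fract h * (2 * x)" for x :: "'p padic" by (metis mult.assoc mult_1)
  have "T $$ (i,j) \<in> Zp" if "i < n" "j < n" for i j
  proof -
    have "2 * T $$ (i,j) \<in> Zp" using T that by (auto simp: half_integral_def)
    then obtain y where "2 * T $$ (i,j) = to_fract y" by (auto simp: Zp_def)
    then have "T $$ (i,j) = to_fract (h * y)" using half[of "T $$ (i,j)"] by simp
    then show ?thesis unfolding Zp_def by blast
  qed
  then have "T \<in> Zp_mat n n" using T by (auto simp: Zp_mat_def half_integral_def)
  then obtain T' where T': "T' \<in> carrier_mat n n" "T = tfm T'" using Zp_mat_iff by blast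
  have "tfm (transpose_mat T') = tfm T'" using T T' by (simp add: tfm_transpose half_integral_def)
  then show "\<exists>T'\<in>carrier_mat n n. transpose_mat T' = T' \<and> T = tfm T'" using T' tfm_inj by blast
next
  assume "\<exists>T'\<in>carrier_mat n n. transpose_mat T' = T' \<and> T = tfm T'"
  then obtain T' where T': "T' \<in> carrier_mat n n" "transpose_mat T' = T'" "T = tfm T'" by blast
  have "2 * to_fract x \<in> Zp" for x :: "'p padic_int"
    using to_fract_mult[of "of_nat 2" x] unfolding to_fract_of_nat Zp_def by (metis of_nat_numeral rangeI)
  then show "T \<in> half_integral n" using T' by (auto simp: half_integral_def Zp_def simp flip: tfm_transpose)
qed

text \<open>Every congruence class of solutions contains exactly one reduced matrix, and solving the
  congruence depends only on the class.\<close>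

lemma rep_count_eq:
  fixes S T :: "'p::prime_card padic_int mat"
  assumes odd: "odd CARD('p)" and S: "S \<in> carrier_mat m m" "transpose_mat S = S"
    and T: "T \<in> carrier_mat n n" "transpose_mat T = T"
  shows "rep_count (tfm S) (tfm T) e = card {X \<in> RM e m n. pdiv e (gram S X - T)}"
proof -
  let ?R = "Zp_mat_cong m n e :: ('p padic mat \<times> 'p padic mat) set"
  let ?Sol = "{X \<in> Zp_mat m n. \<exists>U \<in> half_integral n. transpose_mat X * tfm S * X - tfm T = of_nat CARD('p) ^ e \<cdot>\<^sub>m U}"
  let ?A = "{X \<in> RM e m n. pdiv e (gram S X - T)}"
  have sol: "tfm X \<in> ?Sol \<longleftrightarrow> pdiv e (gram S X - T)" if X: "X \<in> carrier_mat m n" for X :: "'p padic_int mat"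
  proof -
    have g: "gram S X - T \<in> carrier_mat n n" using T by simp
    have id: "transpose_mat (tfm X) * tfm S * tfm X - tfm T = tfm (gram S X - T)"
      using tfm_gram[OF S(1) X] tfm_diff[OF gram_carrier[OF S(1) X] T(1)] by simp
    have sym: "transpose_mat (gram S X - T) = gram S X - T"
    proof -
      have "transpose_mat (gram S X - T) = transpose_mat (gram S X) - transpose_mat T"
        using gram_carrier[OF S(1) X] T(1) by (intro eq_matI) auto
      then show ?thesis using transpose_gram[OF S X] T by simp
    qed
    have "tfm X \<in> ?Sol \<longleftrightarrow> (\<exists>U\<in>half_integral n. tfm (gram S X - T) = of_nat CARD('p) ^ e \<cdot>\<^sub>m U)"
      unfolding id[symmetric] using X Zp_mat_iff by blast
    also have "\<dots> \<longleftrightarrow> (\<exists>U\<in>carrier_mat n n. transpose_mat U = U \<and> tfm (gram S X - T) = tfm (pp ^ e \<cdot>\<^sub>m U))"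
      unfolding tfm_smult to_fract_pp Bex_def half_integral_iff[OF odd] by blast
    also have "\<dots> \<longleftrightarrow> (\<exists>U\<in>carrier_mat n n. transpose_mat U = U \<and> gram S X - T = pp ^ e \<cdot>\<^sub>m U)"
      unfolding tfm_inj ..
    also have "\<dots> \<longleftrightarrow> pdiv e (gram S X - T)"
    proof
      assume "pdiv e (gram S X - T)"
      then obtain U where U: "U \<in> carrier_mat n n" "gram S X - T = pp ^ e \<cdot>\<^sub>m U" using pdivE g by blast
      \<comment> \<open>The definition asks for a half-integral, hence symmetric, quotient; symmetry
        is inherited from S[X] - T.\<close>
      have "transpose_mat U = U"
      proof (rule eq_matI)
        fix i j assume "i < dim_row U" "j < dim_col U"
        then have ij: "i < n" "j < n" using U by auto
        have "(gram S X - T) $$ (j,i) = (gram S X - T) $$ (i,j)" using sym ij g by (metis carrier_matD index_transpose_mat(1))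
        then have "pp ^ e * U $$ (j,i) = pp ^ e * U $$ (i,j)" unfolding U(2) using ij U(1) by simp
        then show "transpose_mat U $$ (i,j) = U $$ (i,j)" using ij U(1) pp_nz[where 'p='p] by simp
      qed (use U in auto)
      then show "\<exists>U\<in>carrier_mat n n. transpose_mat U = U \<and> gram S X - T = pp ^ e \<cdot>\<^sub>m U" using U by blast
    qed (metis pdiv_smult_pp)
    finally show ?thesis .
  qed
  have rel: "(tfm X, tfm Y) \<in> ?R \<longleftrightarrow> pdiv e (X - Y)" if X: "X \<in> carrier_mat m n" and Y: "Y \<in> carrier_mat m n" for X Y :: "'p padic_int mat"
  proof -
    have mem: "tfm X \<in> Zp_mat m n" "tfm Y \<in> Zp_mat m n" using Zp_mat_iff X Y by blast+
    have "(tfm X, tfm Y) \<in> ?R \<longleftrightarrow> (\<exists>Z\<in>Zp_mat m n. tfm X - tfm Y = of_nat CARD('p) ^ e \<cdot>\<^sub>m Z)"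
      unfolding Zp_mat_cong_def using mem by simp
    also have "\<dots> \<longleftrightarrow> (\<exists>Z\<in>carrier_mat m n. tfm (X - Y) = tfm (pp ^ e \<cdot>\<^sub>m Z))"
      unfolding tfm_smult to_fract_pp tfm_diff[OF X Y] Bex_def Zp_mat_iff by blast
    also have "\<dots> \<longleftrightarrow> (\<exists>Z\<in>carrier_mat m n. X - Y = pp ^ e \<cdot>\<^sub>m Z)" unfolding tfm_inj ..
    also have "\<dots> \<longleftrightarrow> pdiv e (X - Y)"
    proof
      assume "pdiv e (X - Y)"
      then show "\<exists>Z\<in>carrier_mat m n. X - Y = pp ^ e \<cdot>\<^sub>m Z" using pdivE minus_carrier_mat[OF Y] by blast
    qed (metis pdiv_smult_pp)
    finally show ?thesis .
  qed
  define f where "f X = ?R `` {tfm X}" for X :: "'p padic_int mat"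
  have f_eq: "f X = f Y \<longleftrightarrow> pdiv e (X - Y)" if X: "X \<in> carrier_mat m n" and Y: "Y \<in> carrier_mat m n" for X Y
  proof
    assume "f X = f Y"
    moreover have "tfm Y \<in> f Y" unfolding f_def using rel[OF Y Y] by (simp add: pdiv_def)
    ultimately have "(tfm X, tfm Y) \<in> ?R" unfolding f_def by blast
    then show "pdiv e (X - Y)" using rel[OF X Y] by simp
  next
    assume p: "pdiv e (X - Y)"
    have "(tfm X, z) \<in> ?R \<longleftrightarrow> (tfm Y, z) \<in> ?R" for z
    proof (cases "z \<in> Zp_mat m n")
      case True
      then obtain Z where Z: "Z \<in> carrier_mat m n" "z = tfm Z" using Zp_mat_iff by blast
      show ?thesis unfolding Z(2) rel[OF X Z(1)] rel[OF Y Z(1)]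
        using redM_eq_iff[OF X Z(1), of e] redM_eq_iff[OF Y Z(1), of e] redM_eq_iff[OF X Y, of e] p by simp
    qed (auto simp: Zp_mat_cong_def)
    then show "f X = f Y" by (auto simp: f_def)
  qed
  have "bij_betw f ?A (?Sol // ?R)"
    unfolding bij_betw_def
  proof
    show "inj_on f ?A"
    proof (rule inj_onI)
      fix X Y assume "X \<in> ?A" "Y \<in> ?A" "f X = f Y"
      then show "X = Y" using f_eq[of X Y] RM_eqI[of X e m n Y] RM_carrier[of _ e m n] by blast
    qed
    show "f ` ?A = ?Sol // ?R"
    proof
      show "f ` ?A \<subseteq> ?Sol // ?R"
      proof (rule image_subsetI)
        fix X assume X: "X \<in> ?A"
        then have "X \<in> carrier_mat m n" using RM_carrier by blast
        with X have "tfm X \<in> ?Sol" using sol by blast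
        then show "f X \<in> ?Sol // ?R" unfolding f_def by (rule quotientI)
      qed
      show "?Sol // ?R \<subseteq> f ` ?A"
      proof
        fix C assume "C \<in> ?Sol // ?R"
        then obtain x where x: "x \<in> ?Sol" "C = ?R `` {x}" by (auto simp: quotient_def)
        then obtain X where X: "X \<in> carrier_mat m n" "x = tfm X" using Zp_mat_iff by blast
        have p: "pdiv e (gram S X - T)" using x sol[OF X(1)] X(2) by simp
        have r: "redM e X \<in> RM e m n" "redM e X \<in> carrier_mat m n" using X redM_RM by auto
        have rp: "pdiv e (redM e X - X)" by (rule redM_cong[OF X(1)])
        have "pdiv e (gram S (redM e X) - T)"
        proof -
          have "(if pdiv e (gram S (redM e X) - T) then 1 else 0 :: complex) = (if pdiv e (gram S X - T) then 1 else 0)"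
            by (rule lcD[OF lc_vol_integrand[OF S(1) T(1)] r(2) X(1) rp])
          then show ?thesis using p by (simp split: if_splits)
        qed
        moreover have "f (redM e X) = C" using f_eq[OF r(2) X(1)] rp x X by (simp add: f_def)
        ultimately show "C \<in> f ` ?A" using r by blast
      qed
    qed
  qed
  then have "card ?A = card (?Sol // ?R)" by (rule bij_betw_same_card)
  then show ?thesis unfolding rep_count_def Let_def using S T by simp
qed

text \<open>The part p^(-emn) of the normalisation is the denominator of the average, so the power
  of p that remains depends on \<open>n\<close> and \<open>e\<close> only.\<close>

lemma local_density_seq_eq:
  fixes S T :: "'p::prime_card padic_int mat"
  assumes odd: "odd CARD('p)" and S: "S \<in> carrier_mat m m" "transpose_mat S = S"
    and T: "T \<in> carrier_mat n n" "transpose_mat T = T"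
  shows "complex_of_real (local_density_seq (tfm S) (tfm T) e) =
    (if m = n then 1 / 2 else 1) * of_nat CARD('p) ^ (e * (n * (n + 1) div 2)) * vol e S T"
proof -
  let ?p = "real CARD('p)" and ?N = "n * (n + 1) div 2"
  let ?c = "card {X \<in> RM e m n. pdiv e (gram S X - T)}"
  have p: "?p \<noteq> 0" using card_prime_gt_1[where 'p='p] by simp
  have "?p powi (int e * (int ?N - int (m * n))) = ?p powi (int (e * ?N) - int (e * m * n))"
    by (simp add: algebra_simps)
  also have "\<dots> = ?p ^ (e * ?N) / ?p ^ (e * m * n)"
    by (subst power_int_diff) (use p in \<open>simp_all only: power_int_of_nat simp_thms\<close>)
  finally have "local_density_seq (tfm S) (tfm T) e = (if m = n then 1 / 2 else 1) * (?p ^ (e * ?N) / ?p ^ (e * m * n)) * real ?c"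
    unfolding local_density_seq_def Let_def rep_count_eq[OF odd S T] using S T by simp
  moreover have "vol e S T = of_nat ?c / of_nat CARD('p) ^ (e * m * n)"
    unfolding vol_def using S T by (simp add: avg_def sum.If_cases Int_def)
  ultimately show ?thesis by simp
qed

lemma local_density_seq_rational: "local_density_seq S T e \<in> \<rat>"
proof -
  have "x powi k \<in> \<rat>" if "x \<in> \<rat>" for x :: real and k
    using that by (auto simp: power_int_def)
  then show ?thesis unfolding local_density_seq_def Let_def by (intro Rats_mult) auto
qed

lemma tfm_diag_block: "tfm (diag_block_mat As) = diag_block_mat (map tfm As)"
proof (induction As)
  case (Cons A As)
  let ?B = "diag_block_mat As"
  have "tfm (diag_block_mat (A # As)) = four_block_mat (tfm A) (tfm (0\<^sub>m (dim_row A) (dim_col ?B))) (tfm (0\<^sub>m (dim_row ?B) (dim_col A))) (tfm ?B)"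
    unfolding diag_block_mat.simps Let_def by (rule map_four_block_mat) auto
  also have "\<dots> = diag_block_mat (map tfm (A # As))"
  proof -
    have "tfm (0\<^sub>m a b) = (0\<^sub>m a b :: 'a fract mat)" for a b by (intro eq_matI) auto
    then show ?thesis by (simp add: Let_def Cons[symmetric])
  qed
  finally show ?case .
qed (auto intro!: eq_matI)

lemma transpose_diag_block:
  assumes "\<And>A. A \<in> set As \<Longrightarrow> transpose_mat A = (A :: 'a::zero mat)"
  shows "transpose_mat (diag_block_mat As) = diag_block_mat As"
  using assms
proof (induction As)
  case (Cons A As)
  let ?B = "diag_block_mat As"
  have t: "transpose_mat A = A" "transpose_mat ?B = ?B" using Cons by auto
  have d: "dim_col A = dim_row A" "dim_col ?B = dim_row ?B"
    using arg_cong[OF t(1), of dim_row] arg_cong[OF t(2), of dim_row] by simp_all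
  have "transpose_mat (four_block_mat A (0\<^sub>m (dim_row A) (dim_col ?B)) (0\<^sub>m (dim_row ?B) (dim_col A)) ?B) =
    four_block_mat (transpose_mat A) (transpose_mat (0\<^sub>m (dim_row ?B) (dim_col A))) (transpose_mat (0\<^sub>m (dim_row A) (dim_col ?B))) (transpose_mat ?B)"
    by (rule transpose_four_block_mat) auto
  then show ?case unfolding diag_block_mat.simps Let_def t by (simp add: d)
qed (auto intro!: eq_matI)

lemma level_form_eq:
  fixes S0 :: "'p::prime_card padic_int mat"
  assumes h: "2 * h = 1"
  shows "level_form k l (tfm S0) = tfm (levR h k l S0)"
proof -
  have "2 * to_fract h = (1 :: 'p padic)"
    using arg_cong[OF h, of to_fract] to_fract_of_nat[of 2, where 'a="'p padic_int"] by simp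
  then have "to_fract h = (1 / 2 :: 'p padic)"
    by (metis mult_zero_left nonzero_mult_div_cancel_left zero_neq_one)
  then have hp: "tfm (hpR h) = hyp_plane" by (auto simp: hpR_def hyp_plane_def intro!: eq_matI)
  have "tfm (diag_block_mat (replicate j (hpR h))) = hyp j" for j
    by (simp add: tfm_diag_block hp hyp_def)
  then show ?thesis
    unfolding level_form_def levR_def tfm_diag_block list.map tfm_smult
    using to_fract_pp[of 1, where 'p='p] by simp
qed

text \<open>The degree is the same for all \<open>l\<close>, so the factor 1/2 of the case m = n
  does not vary with the level.\<close>

lemma levR_carrier:
  assumes "S0 \<in> carrier_mat d d" "transpose_mat S0 = S0" "l < k"
  shows "levR h k l S0 \<in> carrier_mat (2 * (k - 1) + d) (2 * (k - 1) + d)" "transpose_mat (levR h k l S0) = levR h k l S0"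
proof -
  have s: "sum_list (replicate j (2::nat)) = 2 * j" for j by (induction j) auto
  have "2 * (k - l - 1) + 2 * l = 2 * (k - 1)" using assms(3) by simp
  then show "levR h k l S0 \<in> carrier_mat (2 * (k - 1) + d) (2 * (k - 1) + d)"
    using assms(1) by (intro carrier_matI) (simp_all add: levR_def dim_diag_block_mat hpR_def s)
  have hp: "transpose_mat (hpR h) = hpR h" by (auto simp: hpR_def intro!: eq_matI)
  have r: "transpose_mat (diag_block_mat (replicate j (hpR h))) = diag_block_mat (replicate j (hpR h))" for j
    by (rule transpose_diag_block) (simp add: hp)
  have sm: "transpose_mat (c \<cdot>\<^sub>m A) = c \<cdot>\<^sub>m transpose_mat A" for c and A :: "'a padic_int mat" by (intro eq_matI) auto
  show "transpose_mat (levR h k l S0) = levR h k l S0"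
    unfolding levR_def by (rule transpose_diag_block) (use assms(2) r sm in auto)
qed

section \<open>Interpolation and conclusion\<close>

definition lagrange_poly :: "('i \<Rightarrow> 'a::field) \<Rightarrow> 'i set \<Rightarrow> 'i \<Rightarrow> 'a poly" where
  "lagrange_poly x I i = (\<Prod>j\<in>I - {i}. smult (1 / (x i - x j)) [:- x j, 1:])"

lemma poly_lagrange: "poly (lagrange_poly x I i) y = (\<Prod>j\<in>I - {i}. (y - x j) / (x i - x j))"
  unfolding lagrange_poly_def poly_prod by (intro prod.cong) (auto simp: diff_divide_distrib)

lemma degree_lagrange:
  assumes "finite I" "i \<in> I"
  shows "degree (lagrange_poly x I i) < card I"
proof -
  have "degree (lagrange_poly x I i) \<le> (\<Sum>j\<in>I - {i}. degree (smult (1 / (x i - x j)) [:- x j, 1:]))"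
    unfolding lagrange_poly_def
    using degree_prod_sum_le[of "I - {i}" "\<lambda>j. smult (1 / (x i - x j)) [:- x j, 1:]"] assms(1)
    unfolding o_def by blast
  also have "\<dots> \<le> (\<Sum>j\<in>I - {i}. 1)" by (rule sum_mono) (simp add: degree_smult_le)
  also have "\<dots> = card I - 1" using assms by simp
  finally show ?thesis using assms by (metis card_gt_0_iff diff_less le_less_trans less_one empty_iff)
qed

lemma lagrange_at:
  assumes "finite I" "inj_on x I" "i \<in> I" "l \<in> I"
  shows "poly (lagrange_poly x I i) (x l) = (if l = i then 1 else 0)"
proof (cases "l = i")
  case True
  then show ?thesis unfolding poly_lagrange using assms by (auto intro!: prod.neutral simp: inj_on_eq_iff)
next
  case False
  then show ?thesis unfolding poly_lagrange using assms by (auto intro!: prod_zero)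
qed

text \<open>The difference of the two sides has degree below the number of nodes and vanishes at
  each of them, so it is 0.\<close>

lemma lagrange_interpolation:
  fixes P :: "'a::field poly"
  assumes I: "finite I" "inj_on x I" and deg: "degree P < card I"
  shows "poly P y = (\<Sum>i\<in>I. poly P (x i) * poly (lagrange_poly x I i) y)"
proof -
  define Q where "Q = P - (\<Sum>i\<in>I. smult (poly P (x i)) (lagrange_poly x I i))"
  have "Q = 0"
  proof (rule ccontr)
    assume nz: "Q \<noteq> 0"
    have "degree (\<Sum>i\<in>I. smult (poly P (x i)) (lagrange_poly x I i)) < card I"
      by (rule degree_sum_less) (use deg I degree_lagrange in \<open>auto intro: le_less_trans[OF degree_smult_le]\<close>)
    then have "degree Q < card I" unfolding Q_def using deg by (rule degree_diff_less[rotated])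
    moreover have "x ` I \<subseteq> {z. poly Q z = 0}"
    proof (rule image_subsetI)
      fix l assume l: "l \<in> I"
      have "(\<Sum>i\<in>I. poly P (x i) * poly (lagrange_poly x I i) (x l)) = (\<Sum>i\<in>I. if l = i then poly P (x i) else 0)"
        using lagrange_at[OF I _ l] by (intro sum.cong) auto
      then show "x l \<in> {z. poly Q z = 0}" unfolding Q_def using l I by (simp add: poly_sum)
    qed
    then have "card I \<le> card {z. poly Q z = 0}"
      using card_mono[OF poly_roots_finite[OF nz], of "x ` I"] card_image[OF I(2)] by simp
    moreover have "card {z. poly Q z = 0} \<le> degree Q" by (rule card_poly_roots_bound[OF nz])
    ultimately show False by simp
  qed
  then have "poly P y = poly (\<Sum>i\<in>I. smult (poly P (x i)) (lagrange_poly x I i)) y" by (simp add: Q_def)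
  then show ?thesis by (simp add: poly_sum)
qed

text \<open>
  Where the set \<open>L\<close> of points has more than \<open>n + 1\<close> elements, the interpolation identity for
  polynomials of degree at most \<open>n\<close> survives the limit; otherwise there is nothing to check.
\<close>

lemma limit_interpolation:
  fixes D :: "nat \<Rightarrow> nat \<Rightarrow> complex" and \<delta> :: "nat \<Rightarrow> rat" and q :: nat
  assumes L: "finite L" and q: "q > 1"
    and poly: "\<And>e. \<exists>c. \<forall>l\<in>L. D l (Suc e) = (\<Sum>i\<le>n. c i * of_nat q ^ (i * l))"
    and lim: "\<And>l. l \<in> L \<Longrightarrow> D l \<longlonglongrightarrow> of_rat (\<delta> l)"
  shows "\<exists>a :: nat \<Rightarrow> rat. \<forall>l\<in>L. \<delta> l = (\<Sum>i\<le>n. a i * of_nat q ^ (i * l))"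
proof -
  \<comment> \<open>At most n + 1 nodes, so that the interpolating polynomial has degree at most
    \<open>n\<close>; if \<open>L\<close> is smaller, all its points are nodes.\<close>
  obtain I where I: "I \<subseteq> L" "card I = min (card L) (Suc n)"
    using obtain_subset_with_card_n[of "min (card L) (Suc n)" L] by auto
  have fI: "finite I" using I(1) L finite_subset by blast
  \<comment> \<open>The nodes p^l appear twice, as rationals for the final coefficients and as
    complex numbers for the values \<open>D\<close>; \<open>lag\<close> says that both give the same
    interpolation weights.\<close>
  define x :: "nat \<Rightarrow> rat" where "x l = of_nat q ^ l" for l
  define z :: "nat \<Rightarrow> complex" where "z l = of_nat q ^ l" for l
  have injq: "q ^ a = q ^ b \<longleftrightarrow> a = b" for a b using q by simp
  have xi: "inj_on x I" unfolding x_def inj_on_def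
    by (metis injq of_nat_eq_iff of_nat_power)
  have zi: "inj_on z I" unfolding z_def inj_on_def
    by (metis injq of_nat_eq_iff of_nat_power)
  have zx: "z l = of_rat (x l)" for l by (simp add: z_def x_def of_rat_power)
  have lag: "poly (lagrange_poly z I i) (z l) = of_rat (poly (lagrange_poly x I i) (x l))" for i l
    unfolding poly_lagrange zx by (simp add: of_rat_prod of_rat_divide of_rat_diff)
  define Q where "Q = (\<Sum>i\<in>I. smult (\<delta> i) (lagrange_poly x I i))"
  have val: "\<delta> l = poly Q (x l)" if l: "l \<in> L" for l
  proof (cases "l \<in> I")
    case True
    have "poly Q (x l) = (\<Sum>i\<in>I. if l = i then \<delta> i else 0)"
      unfolding Q_def poly_sum using lagrange_at[OF fI xi _ True] by (intro sum.cong) auto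
    then show ?thesis using True fI by simp
  next
    \<comment> \<open>A point outside the nodes exists only if there are n + 1 nodes. Each D(l, e)
      is then a fixed rational combination of the values at the nodes, and this identity passes to
      the limit.\<close>
    case False
    then have "I \<noteq> L" using l by blast
    then have "card I < card L" using I(1) L psubset_card_mono[of L I] by blast
    then have cI: "card I = Suc n" using I(2) by simp
    have "D l (Suc e) = (\<Sum>i\<in>I. D i (Suc e) * of_rat (poly (lagrange_poly x I i) (x l)))" for e
    proof -
      obtain c where c: "\<And>l. l \<in> L \<Longrightarrow> D l (Suc e) = (\<Sum>i\<le>n. c i * of_nat q ^ (i * l))" using poly[of e] by blast
      define P where "P = (\<Sum>i\<le>n. monom (c i) i)"
      have "degree P \<le> n" unfolding P_def
        by (rule degree_sum_le) (auto intro: le_trans[OF degree_monom_le])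
      then have "degree P < card I" using cI by simp
      moreover have "poly P (z l) = D l (Suc e)" if "l \<in> L" for l
        unfolding c[OF that] P_def poly_sum poly_monom z_def by (simp add: power_mult[symmetric] mult.commute)
      ultimately show ?thesis
        using lagrange_interpolation[OF fI zi, of P "z l"] l I(1) by (simp add: lag subset_iff cong: sum.cong)
    qed
    moreover have "(\<lambda>e. \<Sum>i\<in>I. D i (Suc e) * of_rat (poly (lagrange_poly x I i) (x l))) \<longlonglongrightarrow>
       (\<Sum>i\<in>I. of_rat (\<delta> i) * of_rat (poly (lagrange_poly x I i) (x l)))"
      using I(1) by (intro tendsto_sum tendsto_mult_right LIMSEQ_Suc lim) auto
    moreover have "(\<lambda>e. D l (Suc e)) \<longlonglongrightarrow> of_rat (\<delta> l)" by (intro LIMSEQ_Suc lim l)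
    ultimately have "of_rat (\<delta> l) = (\<Sum>i\<in>I. of_rat (\<delta> i) * of_rat (poly (lagrange_poly x I i) (x l)) :: complex)"
      using LIMSEQ_unique by simp
    also have "\<dots> = of_rat (poly Q (x l))" unfolding Q_def poly_sum by (simp add: of_rat_sum of_rat_mult)
    finally show ?thesis by simp
  qed
  have "degree Q \<le> n"
  proof -
    have "degree (smult (\<delta> i) (lagrange_poly x I i)) \<le> n" if "i \<in> I" for i
      using degree_lagrange[OF fI that, of x] degree_smult_le[of "\<delta> i" "lagrange_poly x I i"] I(2) by simp
    then show ?thesis unfolding Q_def by (intro degree_sum_le fI)
  qed
  then have "poly Q y = (\<Sum>i\<le>n. coeff Q i * y ^ i)" for y
    unfolding poly_altdef by (intro sum.mono_neutral_left) (auto simp: coeff_eq_0)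
  then show ?thesis using val by (intro exI[of _ "coeff Q"]) (simp add: x_def power_mult[symmetric] mult.commute)
qed

lemma of_real_of_rat: "complex_of_real (of_rat r) = of_rat r"
  by (cases r) (simp add: of_rat_rat)

theorem theorem5p2:
  fixes T S\<^sub>0 :: "'p::prime_card padic mat" and n k :: nat
  assumes "odd CARD('p)"
    and "n \<ge> 1" and "T \<in> half_integral n"
    and "k \<ge> 1"
    and "Zp_maximal S\<^sub>0" and "dim_row S\<^sub>0 \<le> 2"
  shows "\<exists>a :: nat \<Rightarrow> rat. \<forall>l<k.
    (det T = 0 \<longrightarrow> convergent (local_density_seq (level_form k l S\<^sub>0) T)) \<longrightarrow>
    local_density (level_form k l S\<^sub>0) T = (\<Sum>i\<le>n. of_rat (a i) * real CARD('p) ^ (i * l))"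
proof -
  note odd = assms(1)
  obtain T' where T': "T' \<in> carrier_mat n n" "transpose_mat T' = T'" "T = tfm T'"
    using assms(3) half_integral_iff[OF odd] by blast
  define d where "d = dim_row S\<^sub>0"
  have "S\<^sub>0 \<in> half_integral d" using assms(5) by (simp add: Zp_maximal_def d_def)
  then obtain S' where S': "S' \<in> carrier_mat d d" "transpose_mat S' = S'" "S\<^sub>0 = tfm S'"
    using half_integral_iff[OF odd] by blast
  obtain h :: "'p padic_int" where h: "1 = 2 * h" using padic_two_unit[OF odd] by (rule dvdE)
  then have hu: "h dvd 1" by (metis dvd_triv_right)
  define m where "m = 2 * (k - 1) + d"
  define F where "F l = levR h k l S'" for l
  have F: "F l \<in> carrier_mat m m" "transpose_mat (F l) = F l" if "l < k" for l
    using levR_carrier[OF S'(1,2) that, of h] by (auto simp: F_def m_def)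
  have lev: "level_form k l S\<^sub>0 = tfm (F l)" for l
    unfolding F_def S'(3) using level_form_eq[of h k l S'] h by simp
  define N where "N = n * (n + 1) div 2"
  define c0 :: complex where "c0 = (if m = n then 1 / 2 else 1)"
  \<comment> \<open>Complex-valued because volumes are computed with characters; rationality is read
    back to the reals at the end.\<close>
  define D where "D l e = complex_of_real (local_density_seq (level_form k l S\<^sub>0) T e)" for l e
  have D: "D l e = c0 * of_nat CARD('p) ^ (e * N) * vol e (F l) T'" if "l < k" for l e
    unfolding D_def lev T'(3) local_density_seq_eq[OF odd F[OF that] T'(1,2)] c0_def N_def ..
  have rational: "D l e \<in> \<rat>" for l e
    unfolding D_def using local_density_seq_rational[of "level_form k l S\<^sub>0" T e] by (auto elim!: Rats_cases)
  have ann: "\<exists>ls. ann ls (D l)" if l: "l < k" for l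
  proof -
    obtain ls where ls: "ann ls (\<lambda>e. vol e (F l) T')" using vol_recurrence[OF odd F[OF l] T'(1,2)] by blast
    \<comment> \<open>The normalising factor p^(eN) is geometric with ratio p^(2N) in steps of two,
      so it only rescales the roots.\<close>
    have "ann (map ((*) (of_nat CARD('p) ^ (2 * N))) ls) (\<lambda>e. (c0 * of_nat CARD('p) ^ (e * N)) * vol e (F l) T')"
    proof (rule ann_geometric[OF _ ls, of 0])
      fix e :: nat
      have "(e + 2) * N = 2 * N + e * N" by (simp add: algebra_simps)
      then show "c0 * of_nat CARD('p) ^ ((e + 2) * N) = of_rat (of_nat CARD('p) ^ (2 * N)) * (c0 * of_nat CARD('p) ^ (e * N))"
        by (simp only: power_add of_rat_power of_rat_of_nat_eq) (simp only: mult_ac)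
    qed
    then have "ann (map ((*) (of_nat CARD('p) ^ (2 * N))) ls) (D l)"
      by (rule ann_cong[of _ _ 0]) (simp add: D[OF l])
    then show ?thesis by blast
  qed
  have nondeg: "convergent (local_density_seq (level_form k l S\<^sub>0) T)" if l: "l < k" and nz: "det T \<noteq> 0" for l
  proof -
    have "det T' \<noteq> 0" using nz unfolding T'(3) by simp
    then obtain v u where vu: "det T' = pp ^ v * u" "u dvd 1" using padic_decomp by blast
    \<comment> \<open>The factor p^N lost by the volume at each level is exactly what the
      normalisation gains.\<close>
    have "D l (Suc e) = D l e" if e: "e \<ge> 2 * v + 1" for e
      unfolding D[OF l] vol_step_nondegenerate[OF odd F[OF l] T'(1,2) vu e]
      by (simp add: N_def power_add mult_ac)
    then have step: "local_density_seq (level_form k l S\<^sub>0) T (Suc e) = local_density_seq (level_form k l S\<^sub>0) T e" if "e \<ge> 2 * v + 1" for e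
      using that unfolding D_def by simp
    have "local_density_seq (level_form k l S\<^sub>0) T e = local_density_seq (level_form k l S\<^sub>0) T (2 * v + 1)" if "e \<ge> 2 * v + 1" for e
      using that by (induction e rule: dec_induct) (auto simp: step)
    then have "\<forall>\<^sub>F e in sequentially. local_density_seq (level_form k l S\<^sub>0) T (2 * v + 1) = local_density_seq (level_form k l S\<^sub>0) T e"
      unfolding eventually_sequentially by (metis (no_types))
    then have "local_density_seq (level_form k l S\<^sub>0) T \<longlonglongrightarrow> local_density_seq (level_form k l S\<^sub>0) T (2 * v + 1)"
      by (rule Lim_transform_eventually[OF tendsto_const])
    then show ?thesis by (rule convergentI)
  qed
  \<comment> \<open>The levels at which \<open>local_density\<close> is a genuine limit; for nonzero
    det T these are all l < k by \<open>nondeg\<close>. Interpolation uses only these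
    points.\<close>
  define L where "L = {l. l < k \<and> convergent (local_density_seq (level_form k l S\<^sub>0) T)}"
  have lim: "D l \<longlonglongrightarrow> complex_of_real (local_density (level_form k l S\<^sub>0) T)" if "l \<in> L" for l
    using that unfolding D_def local_density_def L_def
    by (intro tendsto_of_real) (simp add: convergent_LIMSEQ_iff)
  have "\<exists>\<delta>. local_density (level_form k l S\<^sub>0) T = of_rat \<delta>" if l: "l \<in> L" for l
  proof -
    obtain ls where "ann ls (D l)" using ann l by (auto simp: L_def)
    then have "complex_of_real (local_density (level_form k l S\<^sub>0) T) \<in> \<rat>"
      using ann_limit_rational lim[OF l] rational by blast
    then obtain \<delta> where "complex_of_real (local_density (level_form k l S\<^sub>0) T) = of_rat \<delta>" by (elim Rats_cases)
    then have "complex_of_real (local_density (level_form k l S\<^sub>0) T) = complex_of_real (of_rat \<delta>)" by (simp only: of_real_of_rat)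
    then show ?thesis using of_real_eq_iff by blast
  qed
  then obtain \<delta> where \<delta>: "\<And>l. l \<in> L \<Longrightarrow> local_density (level_form k l S\<^sub>0) T = of_rat (\<delta> l)" by metis
  have "\<exists>a :: nat \<Rightarrow> rat. \<forall>l\<in>L. \<delta> l = (\<Sum>i\<le>n. a i * of_nat CARD('p) ^ (i * l))"
  proof (rule limit_interpolation[where D=D])
    show "finite L" by (simp add: L_def)
    show "CARD('p) > 1" by (rule card_prime_gt_1)
    fix l assume l: "l \<in> L"
    show "D l \<longlonglongrightarrow> of_rat (\<delta> l)" using lim[OF l] unfolding \<delta>[OF l] of_real_of_rat .
  next
    fix e
    obtain c where c: "\<And>l. l < k \<Longrightarrow> vol (Suc e) (F l) T' = (\<Sum>i\<le>n. c i * of_nat CARD('p) ^ (i * l))"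
      using vol_level_polynomial[OF S'(1) T'(1) hu, of k "\<lambda>_. m" e] F unfolding F_def by blast
    show "\<exists>c. \<forall>l\<in>L. D l (Suc e) = (\<Sum>i\<le>n. c i * of_nat CARD('p) ^ (i * l))"
    proof (intro exI ballI)
      fix l assume "l \<in> L"
      then have "l < k" by (simp add: L_def)
      show "D l (Suc e) = (\<Sum>i\<le>n. (c0 * of_nat CARD('p) ^ (Suc e * N) * c i) * of_nat CARD('p) ^ (i * l))"
        unfolding D[OF \<open>l < k\<close>] c[OF \<open>l < k\<close>] sum_distrib_left mult.assoc ..
    qed
  qed
  then obtain a :: "nat \<Rightarrow> rat" where a: "\<And>l. l \<in> L \<Longrightarrow> \<delta> l = (\<Sum>i\<le>n. a i * of_nat CARD('p) ^ (i * l))" by blast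
  show ?thesis
  proof (intro exI allI impI)
    fix l assume "l < k" "det T = 0 \<longrightarrow> convergent (local_density_seq (level_form k l S\<^sub>0) T)"
    then have "l \<in> L" using nondeg by (auto simp: L_def)
    then have "local_density (level_form k l S\<^sub>0) T = of_rat (\<Sum>i\<le>n. a i * of_nat CARD('p) ^ (i * l))"
      using \<delta> a by simp
    then show "local_density (level_form k l S\<^sub>0) T = (\<Sum>i\<le>n. of_rat (a i) * real CARD('p) ^ (i * l))"
      by (simp add: of_rat_sum of_rat_mult of_rat_power)
  qed
qed

end
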